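(* Suppose that $M$ is a closed, orientable $3$-manifold which admits an even triangulation $\mathcal{T}$ with exactly one vertex. Then there is an epimorphism of $\pi_1(M)$ onto $C_2\times C_2$, $C_4$, $\mathrm{Alt}(4)$ or $\mathrm{Sym}(4)$.
   Context: A (singular) triangulation of a closed, connected, orientable 3-manifold $M$ is an identification of $M$ with the quotient of a finite disjoint union $\widetilde\Delta$ of oriented Euclidean 3-simplices by orientation-reversing affine isomorphisms pairing all the 2-dimensional faces. Vertices and edges of the triangulation are the images in $M$ of the corners and edges of $\widetilde\Delta$ (faces of one simplex may be identified with each other). The degree of an edge of the triangulation is the number of edges of $\widetilde\Delta$ mapped onto it. The triangulation is even if every edge has even degree. $C_m$ is the cyclic group of order $m$; $\mathrm{Sym}(4)$ and $\mathrm{Alt}(4)$ are the symmetric and alternating groups on four letters. *)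

theory Defs
  imports "HOL-Analysis.Analysis" "HOL-Homology.Homology" "HOL-Algebra.Sym_Groups"
begin

section \<open>Fundamental group\<close>

definition loops_at :: "'a::topological_space set \<Rightarrow> 'a \<Rightarrow> (real \<Rightarrow> 'a) set" where
  "loops_at S a = {p. path p \<and> path_image p \<subseteq> S \<and> pathstart p = a \<and> pathfinish p = a}"

definition path_class :: "'a::topological_space set \<Rightarrow> (real \<Rightarrow> 'a) \<Rightarrow> (real \<Rightarrow> 'a) set" where
  "path_class S p = {q. homotopic_paths S p q}"

definition fundamental_group :: "'a::topological_space set \<Rightarrow> 'a \<Rightarrow> (real \<Rightarrow> 'a) set monoid" where
  "fundamental_group S a =
     \<lparr> carrier = path_class S ` loops_at S a,
       monoid.mult = (\<lambda>C D. \<Union>p\<in>C. \<Union>q\<in>D. path_class S (p +++ q)),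
       one = path_class S (\<lambda>_. a) \<rparr>"

lemma path_class_eqI: "homotopic_paths S p q \<Longrightarrow> path_class S p = path_class S q"
  unfolding path_class_def using homotopic_paths_sym homotopic_paths_trans by blast

lemma mult_fundamental_group:
  assumes "p \<in> loops_at S a" "q \<in> loops_at S a"
  shows "path_class S p \<otimes>\<^bsub>fundamental_group S a\<^esub> path_class S q = path_class S (p +++ q)"
proof -
  have "path_class S (p' +++ q') = path_class S (p +++ q)"
    if "p' \<in> path_class S p" "q' \<in> path_class S q" for p' q'
  proof -
    have "homotopic_paths S (p +++ q) (p' +++ q')"
      using that assms by (intro homotopic_paths_join) (auto simp: path_class_def loops_at_def)
    then show ?thesis by (rule path_class_eqI[symmetric])
  qed
  moreover have "p \<in> path_class S p" "q \<in> path_class S q"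
    using assms by (auto simp: path_class_def loops_at_def)
  ultimately have "(\<Union>p'\<in>path_class S p. \<Union>q'\<in>path_class S q. path_class S (p' +++ q'))
      = path_class S (p +++ q)"
    by blast
  then show ?thesis by (simp add: fundamental_group_def)
qed

lemma group_fundamental_group:
  assumes "a \<in> S"
  shows "group (fundamental_group S a)"
proof -
  let ?G = "fundamental_group S a" and ?e = "\<lambda>_::real. a"
  have car: "carrier ?G = path_class S ` loops_at S a" and one: "\<one>\<^bsub>?G\<^esub> = path_class S ?e"
    by (simp_all add: fundamental_group_def)
  have e: "?e \<in> loops_at S a"
    using assms by (auto simp: loops_at_def path_def path_image_def pathstart_def pathfinish_def)
  have join: "p +++ q \<in> loops_at S a" if "p \<in> loops_at S a" "q \<in> loops_at S a" for p q
    using that by (auto simp: loops_at_def subset_path_image_join)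
  have rev: "reversepath p \<in> loops_at S a" if "p \<in> loops_at S a" for p
    using that by (auto simp: loops_at_def)
  have assoc: "homotopic_paths S (p +++ (q +++ r)) ((p +++ q) +++ r)"
    if "p \<in> loops_at S a" "q \<in> loops_at S a" "r \<in> loops_at S a" for p q r
    using that by (intro homotopic_paths_assoc) (auto simp: loops_at_def)
  have lid: "homotopic_paths S p (?e +++ p)" if "p \<in> loops_at S a" for p
  proof (rule homotopic_paths_reparametrize[where f = "\<lambda>t. if t \<le> 1/2 then 0 else 2 * t - 1"])
    show "continuous_on {0..1} (\<lambda>t::real. if t \<le> 1/2 then 0 else 2 * t - 1)"
      unfolding split_01 by (rule continuous_on_cases continuous_intros | force)+
  qed (use that in \<open>auto simp: loops_at_def joinpaths_def pathstart_def\<close>)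
  have linv: "homotopic_paths S (reversepath p +++ p) ?e" if "p \<in> loops_at S a" for p
  proof -
    define f where "f = (\<lambda>z::real \<times> real. 1 - (1 - fst z) * (1 - \<bar>2 * snd z - 1\<bar>))"
    have f01: "f z \<in> {0..1}" if "z \<in> {0..1} \<times> {0..1}" for z
      using that by (auto simp: f_def abs_if mult_le_one)
    have cp: "continuous_on {0..1} p" and im: "p ` {0..1} \<subseteq> S" and p0: "p 0 = a" and p1: "p 1 = a"
      using that by (auto simp: loops_at_def path_def path_image_def pathstart_def pathfinish_def)
    have "continuous_on ({0..1} \<times> {0..1}) (p \<circ> f)"
      by (intro continuous_on_compose continuous_on_subset[OF cp])
        (use f01 in \<open>auto simp: f_def intro!: continuous_intros\<close>)
    moreover have "p (f (0, x)) = (reversepath p +++ p) x" if "x \<in> {0..1}" for x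
      using that by (auto simp: f_def joinpaths_def reversepath_def abs_if algebra_simps)
    ultimately show ?thesis
      unfolding homotopic_paths
      by (intro exI[of _ "p \<circ> f"])
        (use f01 im p0 p1 in \<open>auto simp: f_def pathstart_def pathfinish_def joinpaths_def reversepath_def\<close>)
  qed
  show ?thesis
  proof (rule groupI)
    fix x y assume "x \<in> carrier ?G" "y \<in> carrier ?G"
    then show "x \<otimes>\<^bsub>?G\<^esub> y \<in> carrier ?G"
      using join by (auto simp: car mult_fundamental_group)
  next
    show "\<one>\<^bsub>?G\<^esub> \<in> carrier ?G" using e by (simp add: car one)
  next
    fix x y z assume "x \<in> carrier ?G" "y \<in> carrier ?G" "z \<in> carrier ?G"
    then show "x \<otimes>\<^bsub>?G\<^esub> y \<otimes>\<^bsub>?G\<^esub> z = x \<otimes>\<^bsub>?G\<^esub> (y \<otimes>\<^bsub>?G\<^esub> z)"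
      using path_class_eqI[OF assoc] by (auto simp: car mult_fundamental_group join)
  next
    fix x assume "x \<in> carrier ?G"
    then obtain p where "p \<in> loops_at S a" "x = path_class S p" by (auto simp: car)
    then show "\<one>\<^bsub>?G\<^esub> \<otimes>\<^bsub>?G\<^esub> x = x"
      using path_class_eqI[OF lid, symmetric] by (simp add: one mult_fundamental_group e)
  next
    fix x assume "x \<in> carrier ?G"
    then obtain p where p: "p \<in> loops_at S a" "x = path_class S p" by (auto simp: car)
    then have "path_class S (reversepath p) \<otimes>\<^bsub>?G\<^esub> x = \<one>\<^bsub>?G\<^esub>"
      using path_class_eqI[OF linv] by (simp add: one mult_fundamental_group rev)
    then show "\<exists>y\<in>carrier ?G. y \<otimes>\<^bsub>?G\<^esub> x = \<one>\<^bsub>?G\<^esub>"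
      using rev[OF p(1)] by (auto simp: car)
  qed
qed


section \<open>Closed orientable 3-manifolds\<close>

definition manifold3 :: "'a topology \<Rightarrow> bool" where
  "manifold3 X \<longleftrightarrow> Hausdorff_space X \<and> second_countable X \<and>
     (\<forall>x\<in>topspace X. \<exists>U. openin X U \<and> x \<in> U \<and>
        subtopology X U homeomorphic_space (euclidean :: (real^3) topology))"

text \<open>
  Homological orientability: \<open>\<mu> x\<close> generates the local homology group
  \<open>H\<^sub>3(X, X - {x})\<close>, and these generators are locally consistent, i.e. near every point they are
  the restrictions of one class in \<open>H\<^sub>3(X, X - U)\<close>.
\<close>

definition orientable3 :: "'a topology \<Rightarrow> bool" where
  "orientable3 X \<longleftrightarrow> (\<exists>\<mu>.
     (\<forall>x\<in>topspace X.
        \<mu> x \<in> carrier (relative_homology_group 3 X (topspace X - {x})) \<and>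
        generate (relative_homology_group 3 X (topspace X - {x})) {\<mu> x}
          = carrier (relative_homology_group 3 X (topspace X - {x}))) \<and>
     (\<forall>x\<in>topspace X. \<exists>U. openin X U \<and> x \<in> U \<and>
        (\<exists>\<alpha>\<in>carrier (relative_homology_group 3 X (topspace X - U)).
           \<forall>y\<in>U. hom_induced 3 X (topspace X - U) X (topspace X - {y}) id \<alpha> = \<mu> y)))"

definition closed_connected_orientable_3manifold :: "'a topology \<Rightarrow> bool" where
  "closed_connected_orientable_3manifold X \<longleftrightarrow>
     manifold3 X \<and> compact_space X \<and> connected_space X \<and> orientable3 X"


section \<open>Singular triangulations\<close>

text \<open>
  The simplices \<open>cell t\<close>, for \<open>t \<in> tets\<close>, lie in \<open>\<real>\<^sup>3\<close> and may overlap there; their disjoint union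
  consists of the pairs \<open>(t, x)\<close> with \<open>x \<in> cell t\<close>.  The sign \<open>orient t\<close> gives the orientation of
  \<open>cell t\<close> relative to the standard one of \<open>\<real>\<^sup>3\<close>.  A 2-face is a pair \<open>(t, F)\<close>; it is glued to
  the 2-face \<open>partner (t, F)\<close> by the map \<open>glue (t, F)\<close>.
\<close>

record ('t, 'a) triangulation_data =
  tets :: "'t set"
  cell :: "'t \<Rightarrow> (real^3) set"
  orient :: "'t \<Rightarrow> real"
  partner :: "'t \<times> (real^3) set \<Rightarrow> 't \<times> (real^3) set"
  glue :: "'t \<times> (real^3) set \<Rightarrow> real^3 \<Rightarrow> real^3"
  proj :: "'t \<times> (real^3) \<Rightarrow> 'a"

definition disjoint_union :: "('t, 'a) triangulation_data \<Rightarrow> ('t \<times> (real^3)) topology" where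
  "disjoint_union \<T> = sum_topology (\<lambda>t. top_of_set (cell \<T> t)) (tets \<T>)"

definition faces2 :: "('t, 'a) triangulation_data \<Rightarrow> ('t \<times> (real^3) set) set" where
  "faces2 \<T> = {(t, F). t \<in> tets \<T> \<and> F facet_of cell \<T> t}"

definition affine_iso :: "(real^3) set \<Rightarrow> (real^3) set \<Rightarrow> (real^3 \<Rightarrow> real^3) \<Rightarrow> bool" where
  "affine_iso F F' f \<longleftrightarrow> bij_betw f F F' \<and> (\<exists>L c. linear L \<and> (\<forall>x\<in>F. f x = L x + c))"

text \<open>
  For non-collinear \<open>x, y, z\<close> in a 2-face of the simplex \<open>S\<close> with orientation \<open>\<epsilon>\<close>: the triple is
  positive for the induced boundary orientation, with the convention ``outward vector first''
  (\<open>x - a\<close> points out of \<open>S\<close> for \<open>a\<close> in the interior).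
\<close>

definition boundary_positive :: "(real^3) set \<Rightarrow> real \<Rightarrow> real^3 \<Rightarrow> real^3 \<Rightarrow> real^3 \<Rightarrow> bool" where
  "boundary_positive S \<epsilon> x y z \<longleftrightarrow>
     (\<forall>a\<in>interior S. \<epsilon> * det (vector [x - a, y - x, z - x] :: real^3^3) > 0)"

definition orientation_reversing ::
    "(real^3) set \<Rightarrow> real \<Rightarrow> (real^3) set \<Rightarrow> (real^3) set \<Rightarrow> real \<Rightarrow> (real^3 \<Rightarrow> real^3) \<Rightarrow> bool" where
  "orientation_reversing S \<epsilon> F S' \<epsilon>' f \<longleftrightarrow>
     (\<forall>x\<in>F. \<forall>y\<in>F. \<forall>z\<in>F. \<not> collinear {x, y, z} \<longrightarrow>
        (boundary_positive S \<epsilon> x y z \<longleftrightarrow> \<not> boundary_positive S' \<epsilon>' (f x) (f y) (f z)))"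

definition glued :: "('t, 'a) triangulation_data \<Rightarrow> 't \<times> (real^3) \<Rightarrow> 't \<times> (real^3) \<Rightarrow> bool" where
  "glued \<T> u v \<longleftrightarrow> (\<exists>(t, F)\<in>faces2 \<T>. \<exists>x\<in>F.
     u = (t, x) \<and> v = (fst (partner \<T> (t, F)), glue \<T> (t, F) x))"

definition singular_triangulation :: "'a topology \<Rightarrow> ('t, 'a) triangulation_data \<Rightarrow> bool" where
  "singular_triangulation X \<T> \<longleftrightarrow>
     finite (tets \<T>) \<and>
     (\<forall>t\<in>tets \<T>. 3 simplex (cell \<T> t) \<and> orient \<T> t \<in> {-1, 1}) \<and>
     (\<forall>\<phi>\<in>faces2 \<T>. partner \<T> \<phi> \<in> faces2 \<T> \<and> partner \<T> \<phi> \<noteq> \<phi> \<and> partner \<T> (partner \<T> \<phi>) = \<phi>) \<and>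
     (\<forall>(t, F)\<in>faces2 \<T>. \<forall>t' F'. partner \<T> (t, F) = (t', F') \<longrightarrow>
        affine_iso F F' (glue \<T> (t, F)) \<and>
        (\<forall>x\<in>F. glue \<T> (t', F') (glue \<T> (t, F) x) = x) \<and>
        orientation_reversing (cell \<T> t) (orient \<T> t) F (cell \<T> t') (orient \<T> t') (glue \<T> (t, F))) \<and>
     quotient_map (disjoint_union \<T>) X (proj \<T>) \<and>
     (\<forall>u\<in>topspace (disjoint_union \<T>). \<forall>v\<in>topspace (disjoint_union \<T>).
        proj \<T> u = proj \<T> v \<longleftrightarrow> equivclp (glued \<T>) u v)"

definition vertices :: "('t, 'a) triangulation_data \<Rightarrow> 'a set" where
  "vertices \<T> = {proj \<T> (t, v) | t v. t \<in> tets \<T> \<and> v extreme_point_of cell \<T> t}"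

definition simplex_edges :: "('t, 'a) triangulation_data \<Rightarrow> ('t \<times> (real^3) set) set" where
  "simplex_edges \<T> = {(t, e). t \<in> tets \<T> \<and> e edge_of cell \<T> t}"

definition edge_image :: "('t, 'a) triangulation_data \<Rightarrow> 't \<times> (real^3) set \<Rightarrow> 'a set" where
  "edge_image \<T> = (\<lambda>(t, e). proj \<T> ` ({t} \<times> e))"

definition edges :: "('t, 'a) triangulation_data \<Rightarrow> 'a set set" where
  "edges \<T> = edge_image \<T> ` simplex_edges \<T>"

definition edge_degree :: "('t, 'a) triangulation_data \<Rightarrow> 'a set \<Rightarrow> nat" where
  "edge_degree \<T> E = card {\<eta> \<in> simplex_edges \<T>. edge_image \<T> \<eta> = E}"

definition even_triangulation :: "('t, 'a) triangulation_data \<Rightarrow> bool" where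
  "even_triangulation \<T> \<longleftrightarrow> (\<forall>E\<in>edges \<T>. even (edge_degree \<T> E))"

end

(*
  Label the corners of every tetrahedron by 1..4 and colour them by four colours. Reflecting a
  colouring through the common face of two adjacent tetrahedra transports it from one to the other.
  Around an edge of even degree this transport is trivial (orientation excludes that an edge is glued
  to itself with its ends exchanged), and around the vertex it is trivial since a punctured ball is
  simply connected. Hence the colourings form a covering of M, and its holonomy is a homomorphism
  from the fundamental group to Sym(4). There is only one vertex, whose colour is well defined near it,
  so running from a corner j of a tetrahedron to another corner k of it gives a loop whose
  holonomy sends k to j: the image is transitive. Every transitive subgroup of Sym(4) is
  Sym(4), Alt(4), cyclic of order 4, or has C2 x C2 as a quotient.
*)

theory Submission
  imports Defs
begin

section \<open>Holonomy of a locally constant cocycle\<close>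

text \<open>No covering space is built. A colouring of the fibre over \<open>x\<close> is recorded
  by its value at one chosen point \<open>pick x\<close>; recolouring acts on it from the left,
  gluing from the right. So the ratio of two colourings is constant on fibres and locally constant
  in \<open>x\<close>, and this cocycle carries the holonomy although \<open>pick\<close> is an
  arbitrary choice.

  The delicate point is the edge. If the walk around an edge returns to the same edge of the same
  tetrahedron, orientation excludes that only the two ends, or only the two faces at the edge, have
  changed places. Exchanging both pairs preserves orientation. It would reverse the cycle of
  tetrahedra around the edge and hence fix one of them or a face between two of them: the first is
  impossible for a nontrivial relabelling, the second glues a face to itself. Only then is the
  length of the walk the degree of the edge.

  Evenness enters because, in the frame carried along the walk, each step keeps the colours of the
  two ends and exchanges the other two. At the vertex the colouring is first found on a punctured
  neighbourhood and then extended by its limits at the corners.\<close>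

lemma eventually_at_within_continuous:
  assumes "continuous_on Z h" "h \<in> Z \<rightarrow> M" "z \<in> Z"
    and "\<forall>\<^sub>F y in at (h z) within M. P y" "P (h z)"
  shows "\<forall>\<^sub>F w in at z within Z. P (h w)"
proof -
  obtain T where T: "open T" "h z \<in> T" "\<And>y. y \<in> T \<Longrightarrow> y \<noteq> h z \<Longrightarrow> y \<in> M \<Longrightarrow> P y"
    using assms(4) by (auto simp: eventually_at_topological)
  have "(h \<longlongrightarrow> h z) (at z within Z)"
    using assms by (auto simp: continuous_on)
  then have "\<forall>\<^sub>F w in at z within Z. h w \<in> T"
    using T by (auto dest: topological_tendstoD)
  moreover have "\<forall>\<^sub>F w in at z within Z. w \<in> Z"
    by (auto simp: eventually_at_topological)
  \<comment> \<open>\<open>h w\<close> may equal \<open>h z\<close> although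
    \<open>w \<noteq> z\<close>; there \<open>P (h z)\<close> takes over from the punctured
    filter.\<close>
  ultimately show ?thesis
    by eventually_elim (use T(3) assms in \<open>force simp: Pi_iff\<close>)
qed

lemma eventually_at_within_openin:
  assumes "openin (top_of_set M) U" "x \<in> U"
  shows "\<forall>\<^sub>F y in at x within M. y \<in> U"
  using assms by (auto simp: openin_open eventually_at_topological)

text \<open>Only the ratios of sections are locally constant. \<open>s x\<close> is the coordinate
  over \<open>x\<close> of one sheet of a covering whose structure group acts by left
  multiplication.\<close>

locale flat_system = group G for G :: "'g monoid" (structure) +
  fixes M :: "'m::topological_space set" and \<S> :: "('m set \<times> ('m \<Rightarrow> 'g)) set"
  assumes openin_chart: "(U, s) \<in> \<S> \<Longrightarrow> openin (top_of_set M) U"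
    and section_closed: "(U, s) \<in> \<S> \<Longrightarrow> x \<in> U \<Longrightarrow> s x \<in> carrier G"
    and cover: "x \<in> M \<Longrightarrow> \<exists>(U, s)\<in>\<S>. x \<in> U"
    and transition: "(U, s) \<in> \<S> \<Longrightarrow> (V, t) \<in> \<S> \<Longrightarrow> x \<in> U \<Longrightarrow> x \<in> V \<Longrightarrow>
      \<forall>\<^sub>F y in at x within M. t y \<otimes> inv s y = t x \<otimes> inv s x"
begin

text \<open>A lift of \<open>h\<close> to that covering: \<open>k z \<otimes> inv s (h z)\<close>
  names the sheet on which \<open>k z\<close> lies. All charts at a point are quantified over, which
  is the convenient form for use; \<open>flatI\<close> reduces proofs to one chart.\<close>

definition flat :: "'z::topological_space set \<Rightarrow> ('z \<Rightarrow> 'm) \<Rightarrow> ('z \<Rightarrow> 'g) \<Rightarrow> bool" where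
  "flat Z h k \<longleftrightarrow> k \<in> Z \<rightarrow> carrier G \<and> (\<forall>z\<in>Z. \<forall>(U, s)\<in>\<S>. h z \<in> U \<longrightarrow>
     (\<forall>\<^sub>F w in at z within Z. h w \<in> U \<and> k w \<otimes> inv s (h w) = k z \<otimes> inv s (h z)))"

section \<open>Lifts: locality, uniqueness and gluing\<close>

lemma inv_cancel3:
  "\<lbrakk>a \<in> carrier G; b \<in> carrier G; c \<in> carrier G\<rbrakk> \<Longrightarrow> (a \<otimes> inv b) \<otimes> (b \<otimes> c) = a \<otimes> c"
  by (simp add: m_assoc) (simp flip: m_assoc)

lemma eventually_in_chart:
  assumes "continuous_on Z h" "h \<in> Z \<rightarrow> M" "z \<in> Z" "(U, s) \<in> \<S>" "h z \<in> U"
  shows "\<forall>\<^sub>F w in at z within Z. h w \<in> U"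
  by (rule eventually_at_within_continuous[OF assms(1-3) eventually_at_within_openin])
    (use assms openin_chart in auto)

lemma flatI:
  assumes h: "continuous_on Z h" "h \<in> Z \<rightarrow> M" and k: "k \<in> Z \<rightarrow> carrier G"
    and loc: "\<And>z. z \<in> Z \<Longrightarrow> \<exists>(U, s)\<in>\<S>. h z \<in> U \<and>
       (\<forall>\<^sub>F w in at z within Z. k w \<otimes> inv s (h w) = k z \<otimes> inv s (h z))"
  shows "flat Z h k"
  unfolding flat_def
proof (intro conjI ballI k, clarify)
  fix z V t assume z: "z \<in> Z" and V: "(V, t) \<in> \<S>" "h z \<in> V"
  obtain U s where U: "(U, s) \<in> \<S>" "h z \<in> U"
      and ev: "\<forall>\<^sub>F w in at z within Z. k w \<otimes> inv s (h w) = k z \<otimes> inv s (h z)"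
    using loc[OF z] by blast
  have "\<forall>\<^sub>F w in at z within Z. s (h w) \<otimes> inv t (h w) = s (h z) \<otimes> inv t (h z)"
    by (rule eventually_at_within_continuous[OF h z, where P = "\<lambda>y. s y \<otimes> inv t y = s (h z) \<otimes> inv t (h z)"])
      (use transition[OF V(1) U(1) V(2) U(2)] in auto)
  moreover have "\<forall>\<^sub>F w in at z within Z. h w \<in> U"
    by (rule eventually_in_chart[OF h z U])
  moreover have "\<forall>\<^sub>F w in at z within Z. h w \<in> V"
    by (rule eventually_in_chart[OF h z V])
  moreover have "\<forall>\<^sub>F w in at z within Z. w \<in> Z"
    by (auto simp: eventually_at_topological)
  ultimately show "\<forall>\<^sub>F w in at z within Z. h w \<in> V \<and> k w \<otimes> inv t (h w) = k z \<otimes> inv t (h z)"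
    using ev
  proof eventually_elim
    case (elim w)
    have c: "k w \<in> carrier G" "k z \<in> carrier G" "s (h w) \<in> carrier G" "s (h z) \<in> carrier G"
       "t (h w) \<in> carrier G" "t (h z) \<in> carrier G"
      using elim k z section_closed U V by auto
    \<comment> \<open>The ratio to \<open>t\<close> is the ratio to \<open>s\<close> times the
      transition, and both factors are locally constant.\<close>
    have "k w \<otimes> inv t (h w) = (k w \<otimes> inv s (h w)) \<otimes> (s (h w) \<otimes> inv t (h w))"
      using c by (simp add: inv_cancel3)
    also have "\<dots> = k z \<otimes> inv t (h z)"
      using c by (simp add: elim inv_cancel3)
    finally show ?case using elim by simp
  qed
qed

lemma flat_closed: "flat Z h k \<Longrightarrow> z \<in> Z \<Longrightarrow> k z \<in> carrier G"
  by (auto simp: flat_def)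

lemma flatD:
  "flat Z h k \<Longrightarrow> z \<in> Z \<Longrightarrow> (U, s) \<in> \<S> \<Longrightarrow> h z \<in> U \<Longrightarrow>
     \<forall>\<^sub>F w in at z within Z. h w \<in> U \<and> k w \<otimes> inv s (h w) = k z \<otimes> inv s (h z)"
  unfolding flat_def by blast

lemma flat_section:
  assumes h: "continuous_on Z h" "h \<in> Z \<rightarrow> M" and U: "(U, s) \<in> \<S>" "h \<in> Z \<rightarrow> U"
  shows "flat Z h (\<lambda>z. s (h z))"
proof (rule flatI[OF h])
  show "(\<lambda>z. s (h z)) \<in> Z \<rightarrow> carrier G" using U section_closed by auto
  fix z assume z: "z \<in> Z"
  have "\<forall>\<^sub>F w in at z within Z. w \<in> Z" by (auto simp: eventually_at_topological)
  then have "\<forall>\<^sub>F w in at z within Z. s (h w) \<otimes> inv s (h w) = s (h z) \<otimes> inv s (h z)"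
    by eventually_elim (use z U section_closed in \<open>auto simp: Pi_iff\<close>)
  then show "\<exists>(U, s')\<in>\<S>. h z \<in> U \<and>
       (\<forall>\<^sub>F w in at z within Z. s (h w) \<otimes> inv s' (h w) = s (h z) \<otimes> inv s' (h z))"
    using U z by blast
qed

lemma flat_subset:
  assumes "flat Z h k" "Y \<subseteq> Z"
  shows "flat Y h k"
  unfolding flat_def
proof (intro conjI ballI, use assms in \<open>force simp: flat_def\<close>, clarify)
  fix z U s assume z: "z \<in> Y" "(U, s) \<in> \<S>" "h z \<in> U"
  show "\<forall>\<^sub>F w in at z within Y. h w \<in> U \<and> k w \<otimes> inv s (h w) = k z \<otimes> inv s (h z)"
    by (rule filter_leD[OF at_le[OF assms(2)] flatD[OF assms(1) _ z(2,3)]]) (use z assms in auto)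
qed

lemma flat_cong:
  assumes "flat Z h k" "\<And>z. z \<in> Z \<Longrightarrow> h z = h' z" "\<And>z. z \<in> Z \<Longrightarrow> k z = k' z"
  shows "flat Z h' k'"
  unfolding flat_def
proof (intro conjI ballI, use assms in \<open>force simp: flat_def\<close>, clarify)
  fix z U s assume z: "z \<in> Z" "(U, s) \<in> \<S>" "h' z \<in> U"
  have "\<forall>\<^sub>F w in at z within Z. w \<in> Z" by (auto simp: eventually_at_topological)
  with flatD[OF assms(1) z(1,2)] z
  show "\<forall>\<^sub>F w in at z within Z. h' w \<in> U \<and> k' w \<otimes> inv s (h' w) = k' z \<otimes> inv s (h' z)"
    by (auto simp: assms(2,3)[symmetric] z elim: eventually_elim2)
qed

lemma flat_compose:
  assumes k: "flat Z h k" and f: "continuous_on Y f" "f \<in> Y \<rightarrow> Z"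
  shows "flat Y (h \<circ> f) (k \<circ> f)"
  unfolding flat_def
proof (intro conjI ballI)
  show "k \<circ> f \<in> Y \<rightarrow> carrier G" using flat_closed[OF k] f by (auto simp: Pi_iff)
  fix y assume y: "y \<in> Y"
  show "case Us of (U, s) \<Rightarrow> (h \<circ> f) y \<in> U \<longrightarrow> (\<forall>\<^sub>F w in at y within Y. (h \<circ> f) w \<in> U \<and>
      (k \<circ> f) w \<otimes> inv s ((h \<circ> f) w) = (k \<circ> f) y \<otimes> inv s ((h \<circ> f) y))" if "Us \<in> \<S>" for Us
  proof (cases Us, clarify)
    fix U s assume Us: "Us = (U, s)" "(h \<circ> f) y \<in> U"
    have "\<forall>\<^sub>F w in at y within Y. h (f w) \<in> U \<and> k (f w) \<otimes> inv s (h (f w)) = k (f y) \<otimes> inv s (h (f y))"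
      by (rule eventually_at_within_continuous[OF f y])
        (use flatD[OF k, of "f y" U s] Us that f y in auto)
    then show "\<forall>\<^sub>F w in at y within Y. (h \<circ> f) w \<in> U \<and>
      (k \<circ> f) w \<otimes> inv s ((h \<circ> f) w) = (k \<circ> f) y \<otimes> inv s ((h \<circ> f) y)" by simp
  qed
qed

lemma flat_mult:
  assumes k: "flat Z h k" and g: "g \<in> carrier G"
  shows "flat Z h (\<lambda>z. g \<otimes> k z)"
  unfolding flat_def
proof (intro conjI ballI)
  show "(\<lambda>z. g \<otimes> k z) \<in> Z \<rightarrow> carrier G" using flat_closed[OF k] g by auto
  fix z assume z: "z \<in> Z"
  show "case Us of (U, s) \<Rightarrow> h z \<in> U \<longrightarrow> (\<forall>\<^sub>F w in at z within Z. h w \<in> U \<and>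
      g \<otimes> k w \<otimes> inv s (h w) = g \<otimes> k z \<otimes> inv s (h z))" if "Us \<in> \<S>" for Us
  proof (cases Us, clarify)
    fix U s assume Us: "Us = (U, s)" "h z \<in> U"
    have "\<forall>\<^sub>F w in at z within Z. w \<in> Z" by (auto simp: eventually_at_topological)
    with flatD[OF k z that[unfolded Us(1)] Us(2)]
    show "\<forall>\<^sub>F w in at z within Z. h w \<in> U \<and>
      g \<otimes> k w \<otimes> inv s (h w) = g \<otimes> k z \<otimes> inv s (h z)"
    proof eventually_elim
      case (elim w)
      have "k w \<in> carrier G" "k z \<in> carrier G" "s (h w) \<in> carrier G" "s (h z) \<in> carrier G"
        using elim z flat_closed[OF k] section_closed that Us by auto
      then show ?case using elim g by (simp add: m_assoc)
    qed
  qed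
qed

text \<open>In a chart the section cancels from \<open>k' \<otimes> inv k\<close>, leaving a
  quotient of two locally constant ratios; connectedness makes it constant.\<close>

lemma flat_unique:
  assumes h: "h \<in> Z \<rightarrow> M" and k: "flat Z h k" "flat Z h k'" and Z: "connected Z" "z \<in> Z" "w \<in> Z"
  shows "k' w \<otimes> inv k w = k' z \<otimes> inv k z"
proof (rule connected_local_const[OF Z(1,3,2)], intro ballI)
  fix y assume y: "y \<in> Z"
  then obtain U s where U: "(U, s) \<in> \<S>" "h y \<in> U" using cover h by blast
  have "\<forall>\<^sub>F w in at y within Z. w \<in> Z" by (auto simp: eventually_at_topological)
  with flatD[OF k(1) y U] flatD[OF k(2) y U]
  show "\<forall>\<^sub>F x in at y within Z. k' y \<otimes> inv k y = k' x \<otimes> inv k x"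
  proof eventually_elim
    case (elim x)
    have c: "k x \<in> carrier G" "k y \<in> carrier G" "s (h x) \<in> carrier G" "s (h y) \<in> carrier G"
       "k' x \<in> carrier G" "k' y \<in> carrier G"
      using elim y flat_closed[OF k(1)] flat_closed[OF k(2)] section_closed[OF U(1)] U by auto
    have *: "k' a \<otimes> inv k a = (k' a \<otimes> inv s (h a)) \<otimes> inv (k a \<otimes> inv s (h a))"
      if "a \<in> {x, y}" for a
      using c that by (auto simp: inv_mult_group inv_cancel3)
    show ?case using elim *[of x] *[of y] by simp
  qed
qed

lemma flat_unique_eq:
  assumes "h \<in> Z \<rightarrow> M" "flat Z h k" "flat Z h k'" "connected Z" "z \<in> Z" "w \<in> Z" "k' z = k z"
  shows "k' w = k w"
proof -
  have "k' w \<otimes> inv k w = \<one>"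
    using flat_unique[OF assms(1-6)] assms flat_closed[OF assms(2)] by simp
  then show ?thesis
    using flat_closed[OF assms(2,6)] flat_closed[OF assms(3,6)] inv_solve_right[of \<one> "k' w" "k w"] by simp
qed

text \<open>Left multiplication moves one lift onto the other at a single common point, and
  connectedness of the intersection spreads the agreement. Closedness keeps each piece away from the
  points outside it, so that local constancy can be checked on the two pieces separately.\<close>

lemma flat_glue:
  assumes h: "continuous_on (A \<union> B) h" "h \<in> A \<union> B \<rightarrow> M"
    and k: "flat A h k" "flat B h k'"
    and cl: "closed A" "closed B" and conn: "connected (A \<inter> B)"
  shows "\<exists>k. flat (A \<union> B) h k"
proof -
  obtain k'' where k'': "flat B h k''" "\<And>z. z \<in> A \<inter> B \<Longrightarrow> k'' z = k z"
  proof (cases "A \<inter> B = {}")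
    case False
    then obtain z where z: "z \<in> A" "z \<in> B" by blast
    define g where "g = k z \<otimes> inv k' z"
    have g: "g \<in> carrier G" using z flat_closed[OF k(1)] flat_closed[OF k(2)] by (auto simp: g_def)
    have fl: "flat B h (\<lambda>w. g \<otimes> k' w)" by (rule flat_mult[OF k(2) g])
    have "g \<otimes> k' w = k w" if "w \<in> A \<inter> B" for w
    proof (rule flat_unique_eq[OF _ _ _ conn _ that])
      show "h \<in> A \<inter> B \<rightarrow> M" using h by auto
      show "flat (A \<inter> B) h k" "flat (A \<inter> B) h (\<lambda>w. g \<otimes> k' w)"
        using flat_subset[OF k(1)] flat_subset[OF fl] by auto
      show "z \<in> A \<inter> B" using z by auto
      show "g \<otimes> k' z = k z"
        using z flat_closed[OF k(1)] flat_closed[OF k(2)] by (simp add: g_def m_assoc)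
    qed
    with fl that show thesis by blast
  qed (use k in blast)
  define K where "K z = (if z \<in> A then k z else k'' z)" for z
  have KA: "flat A h K" by (rule flat_cong[OF k(1)]) (auto simp: K_def)
  have KB: "flat B h K" by (rule flat_cong[OF k''(1)]) (auto simp: K_def k''(2))
  have "flat (A \<union> B) h K"
  proof (rule flatI[OF h])
    show "K \<in> A \<union> B \<rightarrow> carrier G" using flat_closed[OF KA] flat_closed[OF KB] by auto
    fix z assume z: "z \<in> A \<union> B"
    then obtain U s where U: "(U, s) \<in> \<S>" "h z \<in> U" using cover h by blast
    have ev: "\<forall>\<^sub>F w in at z within C. K w \<otimes> inv s (h w) = K z \<otimes> inv s (h z)"
      if C: "closed C" "flat C h K" for C
    proof (cases "z \<in> C")
      case True
      from flatD[OF C(2) True U] show ?thesis by (auto elim: eventually_mono)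
    next
      case False
      then show ?thesis using C(1)
        unfolding eventually_at_topological
        by (intro exI[of _ "- C"]) auto
    qed
    have "\<forall>\<^sub>F w in at z within A \<union> B. K w \<otimes> inv s (h w) = K z \<otimes> inv s (h z)"
      using ev[OF cl(1) KA] ev[OF cl(2) KB]
      by (simp add: at_within_union eventually_sup)
    then show "\<exists>(U, s)\<in>\<S>. h z \<in> U \<and>
      (\<forall>\<^sub>F w in at z within A \<union> B. K w \<otimes> inv s (h w) = K z \<otimes> inv s (h z))"
      using U by blast
  qed
  then show ?thesis by blast
qed

text \<open>A bisection in the second coordinate inside a bisection in the first one.\<close>

lemma flat_exists_square:
  fixes h :: "real \<times> real \<Rightarrow> 'm"
  assumes h: "continuous_on ({0..1} \<times> {0..1}) h" "h \<in> {0..1} \<times> {0..1} \<rightarrow> M"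
  shows "\<exists>k. flat ({0..1} \<times> {0..1}) h k"
proof -
  \<comment> \<open>Rectangles are clipped to the unit square, so that a rectangle around a boundary
    point still belongs to the family and stays connected.\<close>
  define R where "R a b c d = (({a..b} \<inter> {0..1}) \<times> ({c..d} \<inter> {0..1}) :: (real \<times> real) set)" for a b c d
  have Rsub: "R a b c d \<subseteq> {0..1} \<times> {0..1}" for a b c d by (auto simp: R_def)
  have R_Times: "R a b c d = {max a 0..min b 1} \<times> {max c 0..min d 1}" for a b c d
    by (auto simp: R_def)
  have Rcl: "closed (R a b c d)" for a b c d
    unfolding R_Times by (intro closed_Times closed_atLeastAtMost)
  have Rconn: "connected (R a b c d)" for a b c d
    unfolding R_Times by (intro connected_Times) auto
  have ch: "continuous_on A h" "h \<in> A \<rightarrow> M" if "A \<subseteq> {0..1} \<times> {0..1}" for A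
    using h that by (auto intro: continuous_on_subset)
  have glue: "\<exists>k. flat C h k"
    if prems: "\<exists>k. flat (R a b c d) h k" "\<exists>k. flat (R a' b' c' d') h k"
      "R a b c d \<inter> R a' b' c' d' = R a'' b'' c'' d''" "R a b c d \<union> R a' b' c' d' = C"
    for C a b c d a' b' c' d' a'' b'' c'' d''
  proof -
    obtain k k' where k: "flat (R a b c d) h k" "flat (R a' b' c' d') h k'" using prems by blast
    have "R a b c d \<union> R a' b' c' d' \<subseteq> {0..1} \<times> {0..1}" using Rsub by simp
    from flat_glue[OF ch[OF this] k Rcl Rcl] show ?thesis
      unfolding prems(3,4) using Rconn by blast
  qed
  have point: "\<exists>e>0. \<exists>k. flat (R (x - e) (x + e) (y - e) (y + e)) h k"
    if xy: "x \<in> {0..1}" "y \<in> {0..1}" for x y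
  proof -
    have hM: "h (x, y) \<in> M" using h xy by auto
    then obtain U s where U: "(U, s) \<in> \<S>" "h (x, y) \<in> U" using cover by blast
    have "\<forall>\<^sub>F w in at (x, y) within {0..1} \<times> {0..1}. h w \<in> U"
      by (rule eventually_in_chart[OF h _ U]) (use xy in auto)
    then obtain d where d: "d > 0"
        "\<And>w. w \<in> {0..1} \<times> {0..1} \<Longrightarrow> w \<noteq> (x, y) \<Longrightarrow> dist w (x, y) < d \<Longrightarrow> h w \<in> U"
      by (auto simp: eventually_at)
    \<comment> \<open>With \<open>d/3\<close> in each coordinate the distance to the centre is at
      most \<open>2 * d / 3\<close>, below \<open>d\<close>.\<close>
    have "h w \<in> U" if "w \<in> R (x - d/3) (x + d/3) (y - d/3) (y + d/3)" for w
    proof (cases "w = (x, y)")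
      case False
      obtain w1 w2 where w: "w = (w1, w2)" by force
      have "dist w (x, y) \<le> dist w1 x + dist w2 y"
        by (simp add: w dist_Pair_Pair sqrt_sum_squares_le_sum)
      also have "\<dots> \<le> d/3 + d/3"
        using that by (intro add_mono) (auto simp: R_def w dist_real_def abs_if)
      also have "\<dots> < d" using \<open>d > 0\<close> by simp
      finally have "dist w (x, y) < d" .
      then show ?thesis using d(2)[of w] False that by (auto simp: R_def)
    qed (use U in auto)
    then have "flat (R (x - d/3) (x + d/3) (y - d/3) (y + d/3)) h (\<lambda>z. s (h z))"
      using U ch[OF Rsub] by (intro flat_section) auto
    then show ?thesis using d(1) by (intro exI[of _ "d/3"]) auto
  qed
  have strip: "\<exists>e>0. \<exists>k. flat (R (x - e) (x + e) 0 1) h k" if x: "x \<in> {0..1}" for x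
  proof -
    have "0 \<le> (1::real)" by simp
    then show ?thesis
    proof (induction rule: Bolzano[where P = "\<lambda>c d. \<exists>e>0. \<exists>k. flat (R (x - e) (x + e) c d) h k"])
      case (trans a b c)
      then obtain e e' k k' where e: "e > 0" "e' > 0" "flat (R (x - e) (x + e) a b) h k"
        "flat (R (x - e') (x + e') b c) h k'" by blast
      \<comment> \<open>The two widths may differ; both pieces are narrowed to the smaller one, so
        that they meet in the segment at height \<open>b\<close>.\<close>
      define m where "m = min e e'"
      have "flat (R (x - m) (x + m) a b) h k" "flat (R (x - m) (x + m) b c) h k'"
        by (rule flat_subset[OF e(3)] flat_subset[OF e(4)]; force simp: R_def m_def)+
      moreover have "R (x - m) (x + m) a b \<inter> R (x - m) (x + m) b c = R (x - m) (x + m) b b"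
        using trans by (auto simp: R_def)
      moreover have "R (x - m) (x + m) a b \<union> R (x - m) (x + m) b c = R (x - m) (x + m) a c"
        using trans by (auto simp: R_def)
      ultimately have "\<exists>k. flat (R (x - m) (x + m) a c) h k"
        by (intro glue[OF exI exI])
      then show ?case using e by (intro exI[of _ m]) (auto simp: m_def)
    next
      case (local y)
      obtain e k where e: "e > 0" "flat (R (x - e) (x + e) (y - e) (y + e)) h k"
        using point[OF x, of y] local by auto
      show ?case
      proof (rule exI[of _ e], intro conjI allI impI e(1))
        fix a b assume "a \<le> y \<and> y \<le> b \<and> b - a < e"
        then have "flat (R (x - e) (x + e) a b) h k"
          by (intro flat_subset[OF e(2)]) (auto simp: R_def)
        with e(1) show "\<exists>e>0. \<exists>k. flat (R (x - e) (x + e) a b) h k" by blast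
      qed
    qed
  qed
  have "0 \<le> (1::real)" by simp
  then have "\<exists>k. flat (R 0 1 0 1) h k"
  proof (induction rule: Bolzano[where P = "\<lambda>a b. \<exists>k. flat (R a b 0 1) h k"])
    case (trans a b c)
    have "R a b 0 1 \<inter> R b c 0 1 = R b b 0 1" "R a b 0 1 \<union> R b c 0 1 = R a c 0 1"
      using trans by (auto simp: R_def)
    then show ?case by (rule glue[OF trans(1,2)])
  next
    case (local x)
    then obtain e k where e: "e > 0" "flat (R (x - e) (x + e) 0 1) h k"
      using strip[of x] by auto
    show ?case
    proof (intro exI[of _ e] conjI allI impI e(1))
      fix a b assume "a \<le> x \<and> x \<le> b \<and> b - a < e"
      then have "flat (R a b 0 1) h k"
        by (intro flat_subset[OF e(2)]) (auto simp: R_def)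
      then show "\<exists>k. flat (R a b 0 1) h k" by blast
    qed
  qed
  then show ?thesis by (simp add: R_def)
qed

lemma flat_exists_path:
  assumes p: "path p" "path_image p \<subseteq> M"
  shows "\<exists>k. flat {0..1} p k"
proof -
  have c: "continuous_on ({0..1} \<times> {0..1::real}) (p \<circ> fst)"
    using p by (intro continuous_on_compose continuous_intros)
      (auto simp: path_def intro: continuous_on_subset)
  have "\<exists>k. flat ({0..1} \<times> {0..1::real}) (p \<circ> fst) k"
    using flat_exists_square[OF c] p by (force simp: path_image_def)
  then obtain k where k: "flat ({0..1} \<times> {0..1::real}) (p \<circ> fst) k" ..
  have "flat {0..1} ((p \<circ> fst) \<circ> (\<lambda>t. (t, 0::real))) (k \<circ> (\<lambda>t. (t, 0)))"
    by (rule flat_compose[OF k]) (auto intro!: continuous_intros)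
  then show ?thesis by (auto simp: o_def)
qed

section \<open>Holonomy of paths and its homotopy invariance\<close>

definition hol :: "(real \<Rightarrow> 'm) \<Rightarrow> 'g" where
  "hol p = (let k = (SOME k. flat {0..1} p k) in inv k 0 \<otimes> k 1)"

text \<open>Two lifts of a path differ by a left factor, which cancels in
  \<open>inv k 0 \<otimes> k 1\<close>.\<close>

lemma hol_eq:
  assumes p: "path p" "path_image p \<subseteq> M" and k: "flat {0..1} p k"
  shows "hol p = inv k 0 \<otimes> k 1"
proof -
  define k' where "k' = (SOME k. flat {0..1} p k)"
  have k': "flat {0..1} p k'" unfolding k'_def by (rule someI[where P = "flat {0..1} p", OF k])
  have c: "k 0 \<in> carrier G" "k 1 \<in> carrier G" "k' 0 \<in> carrier G" "k' 1 \<in> carrier G"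
    using flat_closed[OF k] flat_closed[OF k'] by auto
  define g where "g = k' 0 \<otimes> inv k 0"
  have g: "g \<in> carrier G" using c by (simp add: g_def)
  have "k' 1 = g \<otimes> k 1"
    by (rule flat_unique_eq[OF _ flat_mult[OF k g] k', of 0])
      (use p c in \<open>auto simp: g_def path_image_def m_assoc\<close>)
  moreover have "k' 0 = g \<otimes> k 0" using c by (simp add: g_def m_assoc)
  ultimately have "inv k' 0 \<otimes> k' 1 = inv k 0 \<otimes> (inv g \<otimes> (g \<otimes> k 1))"
    using c g by (simp add: inv_mult_group m_assoc)
  also have "inv g \<otimes> (g \<otimes> k 1) = k 1"
    using c g by (simp flip: m_assoc)
  finally show ?thesis by (simp add: hol_def k'_def Let_def)
qed

lemma hol_closed:
  assumes "path p" "path_image p \<subseteq> M" shows "hol p \<in> carrier G"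
proof -
  obtain k where k: "flat {0..1} p k" using flat_exists_path[OF assms] ..
  then show ?thesis using hol_eq[OF assms k] flat_closed[OF k] by simp
qed

lemma hol_join:
  assumes p: "path p" "path_image p \<subseteq> M" and q: "path q" "path_image q \<subseteq> M"
    and pq: "pathfinish p = pathstart q"
  shows "hol (p +++ q) = hol p \<otimes> hol q"
proof -
  have P: "path (p +++ q)" "path_image (p +++ q) \<subseteq> M"
    using p q pq by (auto simp: subset_path_image_join)
  obtain k where k: "flat {0..1} (p +++ q) k" using flat_exists_path[OF P] ..
  define f1 f2 :: "real \<Rightarrow> real" where "f1 = (\<lambda>t. t / 2)" and "f2 = (\<lambda>t. t / 2 + 1 / 2)"
  have "flat {0..1} ((p +++ q) \<circ> f1) (k \<circ> f1)"
    by (rule flat_compose[OF k]) (auto simp: f1_def intro!: continuous_intros)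
  then have k1: "flat {0..1} p (k \<circ> f1)"
    by (rule flat_cong) (auto simp: f1_def joinpaths_def)
  have "flat {0..1} ((p +++ q) \<circ> f2) (k \<circ> f2)"
    by (rule flat_compose[OF k]) (auto simp: f2_def intro!: continuous_intros)
  then have k2: "flat {0..1} q (k \<circ> f2)"
    by (rule flat_cong)
      (use pq in \<open>auto simp: f2_def joinpaths_def pathfinish_def pathstart_def algebra_simps\<close>)
  have c: "k 0 \<in> carrier G" "k 1 \<in> carrier G" "k (1/2) \<in> carrier G"
    using flat_closed[OF k] by auto
  show ?thesis
    using c by (simp add: hol_eq[OF P k] hol_eq[OF p k1] hol_eq[OF q k2] f1_def f2_def m_assoc
      flip: m_assoc[of "k (1/2)"])
qed

lemma hol_reversepath:
  assumes p: "path p" "path_image p \<subseteq> M"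
  shows "hol (reversepath p) = inv (hol p)"
proof -
  obtain k where k: "flat {0..1} p k" using flat_exists_path[OF p] ..
  have "flat {0..1} (p \<circ> (\<lambda>t. 1 - t)) (k \<circ> (\<lambda>t. 1 - t))"
    by (rule flat_compose[OF k]) (auto intro!: continuous_intros)
  then have "flat {0..1} (reversepath p) (k \<circ> (\<lambda>t. 1 - t))"
    by (rule flat_cong) (auto simp: reversepath_def)
  from hol_eq[OF _ _ this] hol_eq[OF p k] show ?thesis
    using p flat_closed[OF k] by (simp add: inv_mult_group)
qed

text \<open>The whole homotopy is lifted. On the two sides where the endpoints rest, the lift is
  constant, so the lifts of \<open>p\<close> and \<open>q\<close> have the same end values.\<close>

lemma hol_homotopic:
  assumes hpq: "homotopic_paths M p q"
  shows "hol p = hol q"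
proof -
  note P = homotopic_paths_imp_path[OF hpq] homotopic_paths_imp_subset[OF hpq]
  obtain h where h: "continuous_on ({0..1} \<times> {0..1}) h" "h ` ({0..1} \<times> {0..1}) \<subseteq> M"
    and h0: "\<And>x. x \<in> {0..1} \<Longrightarrow> h (0, x) = p x" and h1: "\<And>x. x \<in> {0..1} \<Longrightarrow> h (1, x) = q x"
    and ends: "\<And>t. t \<in> {0..1::real} \<Longrightarrow> h (t, 0) = p 0" "\<And>t. t \<in> {0..1::real} \<Longrightarrow> h (t, 1) = p 1"
    using hpq unfolding homotopic_paths pathstart_def pathfinish_def o_def by (elim exE conjE) blast
  have hM: "h \<in> {0..1} \<times> {0..1} \<rightarrow> M" using h(2) by blast
  obtain k where k: "flat ({0..1} \<times> {0..1}) h k"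
    using flat_exists_square[OF h(1) hM] ..
  have side: "flat {0..1} (h \<circ> f) (k \<circ> f)" if "continuous_on {0..1} f" "f \<in> {0..1} \<rightarrow> {0..1} \<times> {0..1}"
    for f :: "real \<Rightarrow> real \<times> real"
    by (rule flat_compose[OF k that])
  have kp: "flat {0..1} p (k \<circ> Pair 0)"
    by (rule flat_cong[OF side[of "Pair 0"]]) (auto intro!: continuous_intros simp: h0)
  have kq: "flat {0..1} q (k \<circ> Pair 1)"
    by (rule flat_cong[OF side[of "Pair 1"]]) (auto intro!: continuous_intros simp: h1)
  have const: "k (1, y) = k (0, y)" if y: "y \<in> {0, 1}" for y
  proof -
    have yy: "y \<in> {0..1}" using y by auto
    have fl: "flat {0..1} (\<lambda>_::real. p y) (k \<circ> (\<lambda>t. (t, y)))"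
      by (rule flat_cong[OF side[of "\<lambda>t. (t, y)"]])
        (use y yy ends in \<open>auto intro!: continuous_intros\<close>)
    have pM: "p y \<in> M" using P yy by (auto simp: path_image_def)
    have fc: "flat {0..1} (\<lambda>_::real. p y) (\<lambda>_. k (0, y))"
      by (rule flatI) (use pM flat_closed[OF k] yy cover[OF pM] in \<open>auto intro!: continuous_intros\<close>)
    have "(k \<circ> (\<lambda>t. (t, y))) 1 = k (0, y)"
      by (rule flat_unique_eq[OF _ fc fl, of 0]) (use pM in auto)
    then show ?thesis by simp
  qed
  show ?thesis
    using P const by (simp add: hol_eq[OF _ _ kp] hol_eq[OF _ _ kq])
qed

text \<open>The holonomy along paths from a base point is the lift. Simple connectedness allows the
  chosen path to a nearby \<open>w\<close> to be replaced by the path to \<open>z\<close> followed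
  by a segment, and the segment lies in one chart.\<close>

lemma flat_exists_simply_connected:
  fixes Z :: "'z::euclidean_space set"
  assumes Z: "open Z" "simply_connected Z" and h: "continuous_on Z h" "h \<in> Z \<rightarrow> M"
  shows "\<exists>k. flat Z h k"
proof (cases "Z = {}")
  case True
  then show ?thesis by (simp add: flat_def)
next
  case False
  then obtain z0 where z0: "z0 \<in> Z" by blast
  have pc: "path_connected Z" using Z(2) by (rule simply_connected_imp_path_connected)
  define \<gamma> where "\<gamma> z = (SOME p. path p \<and> path_image p \<subseteq> Z \<and> pathstart p = z0 \<and> pathfinish p = z)" for z
  have \<gamma>: "path (\<gamma> z)" "path_image (\<gamma> z) \<subseteq> Z" "pathstart (\<gamma> z) = z0" "pathfinish (\<gamma> z) = z" if "z \<in> Z" for z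
  proof -
    have "\<exists>p. path p \<and> path_image p \<subseteq> Z \<and> pathstart p = z0 \<and> pathfinish p = z"
      using pc z0 that by (auto simp: path_connected_def)
    from someI_ex[OF this]
    show "path (\<gamma> z)" "path_image (\<gamma> z) \<subseteq> Z" "pathstart (\<gamma> z) = z0" "pathfinish (\<gamma> z) = z"
      by (auto simp: \<gamma>_def)
  qed
  have hp: "path (h \<circ> p)" "path_image (h \<circ> p) \<subseteq> M" if "path p" "path_image p \<subseteq> Z" for p
  proof -
    show "path (h \<circ> p)"
      using that by (intro path_continuous_image continuous_on_subset[OF h(1)])
    show "path_image (h \<circ> p) \<subseteq> M" using that(2) h(2) by (auto simp: path_image_compose)
  qed
  define K where "K z = hol (h \<circ> \<gamma> z)" for z
  have Kc: "K z \<in> carrier G" if "z \<in> Z" for z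
    unfolding K_def using \<gamma>[OF that] hp by (intro hol_closed) auto
  have "flat Z h K"
  proof (rule flatI[OF h])
    show "K \<in> Z \<rightarrow> carrier G" using Kc by blast
    fix z assume z: "z \<in> Z"
    then obtain U s where U: "(U, s) \<in> \<S>" "h z \<in> U" using cover h by blast
    have "\<forall>\<^sub>F w in at z within Z. h w \<in> U"
      by (rule eventually_in_chart[OF h z U])
    then have "\<forall>\<^sub>F w in at z. h w \<in> U" by (simp add: at_within_open[OF z Z(1)])
    then obtain d where d: "d > 0" "\<And>w. w \<noteq> z \<Longrightarrow> dist w z < d \<Longrightarrow> h w \<in> U"
      by (auto simp: eventually_at)
    obtain e where e: "e > 0" "ball z e \<subseteq> Z" using Z(1) z by (auto simp: open_contains_ball)
    define m where "m = min d e"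
    have m: "m > 0" "\<And>w. w \<in> ball z m \<Longrightarrow> w \<in> Z \<and> h w \<in> U"
    proof -
      show "m > 0" using d e by (simp add: m_def)
      fix w assume "w \<in> ball z m"
      then have "dist w z < d" "w \<in> ball z e" by (auto simp: m_def dist_commute)
      then show "w \<in> Z \<and> h w \<in> U" using d(2)[of w] e(2) U by (cases "w = z") auto
    qed
    have step: "K w \<otimes> inv s (h w) = K z \<otimes> inv s (h z)" if w: "w \<in> ball z m" for w
    proof -
      let ?l = "linepath z w"
      have seg: "closed_segment z w \<subseteq> ball z m"
        using w m(1) by (intro closed_segment_subset) auto
      have l: "path ?l" "path_image ?l \<subseteq> Z" using seg m by auto
      have wZ: "w \<in> Z" using w m by auto
      have "flat {0..1} (h \<circ> ?l) (\<lambda>t. s ((h \<circ> ?l) t))"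
      proof (rule flat_section[OF _ _ U(1)])
        show "continuous_on {0..1} (h \<circ> ?l)" using hp(1)[OF l] by (simp add: path_def)
        show "h \<circ> ?l \<in> {0..1} \<rightarrow> M" using hp(2)[OF l] by (auto simp: path_image_def)
        show "h \<circ> ?l \<in> {0..1} \<rightarrow> U"
          using subsetD[OF seg linepath_in_path[of _ z w]] m(2) by (auto simp del: mem_ball)
      qed
      from hol_eq[OF hp[OF l] this] have hl: "hol (h \<circ> ?l) = inv s (h z) \<otimes> s (h w)"
        by (simp add: linepath_def)
      have "homotopic_paths Z (\<gamma> w) (\<gamma> z +++ ?l)"
        using Z(2) \<gamma>[OF z] \<gamma>[OF wZ] l unfolding simply_connected_eq_homotopic_paths
        by (auto simp: subset_path_image_join)
      then have "homotopic_paths M (h \<circ> \<gamma> w) (h \<circ> (\<gamma> z +++ ?l))"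
        using h by (intro homotopic_paths_continuous_image) auto
      then have "K w = hol (h \<circ> (\<gamma> z +++ ?l))"
        unfolding K_def by (rule hol_homotopic)
      also have "h \<circ> (\<gamma> z +++ ?l) = (h \<circ> \<gamma> z) +++ (h \<circ> ?l)"
        by (auto simp: joinpaths_def)
      also have "hol \<dots> = K z \<otimes> hol (h \<circ> ?l)"
        unfolding K_def using \<gamma>[OF z] l hp
        by (intro hol_join) (auto simp: pathfinish_compose pathstart_compose)
      finally have "K w = K z \<otimes> (inv s (h z) \<otimes> s (h w))" by (simp add: hl)
      moreover have "s (h z) \<in> carrier G" "s (h w) \<in> carrier G"
        using section_closed U m w by auto
      ultimately show ?thesis using Kc[OF z] by (simp add: m_assoc)
    qed
    have "\<forall>\<^sub>F w in at z within Z. K w \<otimes> inv s (h w) = K z \<otimes> inv s (h z)"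
      unfolding eventually_at
      by (intro exI[of _ m] conjI ballI impI step m(1)) (simp add: dist_commute)
    then show "\<exists>(U, s)\<in>\<S>. h z \<in> U \<and>
       (\<forall>\<^sub>F w in at z within Z. K w \<otimes> inv s (h w) = K z \<otimes> inv s (h z))"
      using U by blast
  qed
  then show ?thesis by blast
qed

lemma hol_hom:
  assumes "a \<in> M"
  shows "(\<lambda>C. hol (SOME p. p \<in> C)) \<in> hom (fundamental_group M a) G"
    and "p \<in> loops_at M a \<Longrightarrow> hol (SOME q. q \<in> path_class M p) = hol p"
proof -
  show cl: "hol (SOME q. q \<in> path_class M p) = hol p" if "p \<in> loops_at M a" for p
  proof -
    have "p \<in> path_class M p" using that by (auto simp: path_class_def loops_at_def)
    then have "(SOME q. q \<in> path_class M p) \<in> path_class M p" by (rule someI[where P = "\<lambda>q. q \<in> _"])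
    then show ?thesis by (auto simp: path_class_def dest: hol_homotopic)
  qed
  have join: "p +++ q \<in> loops_at M a" if "p \<in> loops_at M a" "q \<in> loops_at M a" for p q
    using that by (auto simp: loops_at_def subset_path_image_join)
  show "(\<lambda>C. hol (SOME p. p \<in> C)) \<in> hom (fundamental_group M a) G"
  proof (rule homI)
    fix x assume "x \<in> carrier (fundamental_group M a)"
    then show "hol (SOME p. p \<in> x) \<in> carrier G"
      using cl by (auto simp: fundamental_group_def) (auto simp: loops_at_def intro!: hol_closed)
  next
    fix x y assume "x \<in> carrier (fundamental_group M a)" "y \<in> carrier (fundamental_group M a)"
    then obtain p q where pq: "p \<in> loops_at M a" "q \<in> loops_at M a"
      "x = path_class M p" "y = path_class M q"
      by (auto simp: fundamental_group_def)
    then show "hol (SOME p. p \<in> x \<otimes>\<^bsub>fundamental_group M a\<^esub> y)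
        = hol (SOME p. p \<in> x) \<otimes> hol (SOME p. p \<in> y)"
      using hol_join[of p q] by (simp add: mult_fundamental_group cl join) (simp add: loops_at_def)
  qed
qed

end

section \<open>Transitive subgroups of Sym(4)\<close>

definition perms4 :: "nat list list" where
  "perms4 = [[a, b, c, d]. a \<leftarrow> [1, 2, 3, 4], b \<leftarrow> [1, 2, 3, 4], c \<leftarrow> [1, 2, 3, 4], d \<leftarrow> [1, 2, 3, 4],
     a \<noteq> b \<and> a \<noteq> c \<and> a \<noteq> d \<and> b \<noteq> c \<and> b \<noteq> d \<and> c \<noteq> d]"

definition app4 :: "nat list \<Rightarrow> nat \<Rightarrow> nat" where
  "app4 p i = (if i = 1 then hd p else if i = 2 then hd (tl p) else if i = 3 then hd (tl (tl p))
     else hd (tl (tl (tl p))))"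

definition mult4 :: "nat list \<Rightarrow> nat list \<Rightarrow> nat list" where
  "mult4 p q = map (app4 p) q"

text \<open>\<open>pairing4 j p\<close>: the permutation \<open>p\<close> preserves the partition \<open>{1, j}\<close>, \<open>{1..4} - {1, j}\<close>;
  it swaps the two blocks iff \<open>swaps4 j p\<close>.\<close>

definition pairing4 :: "nat \<Rightarrow> nat list \<Rightarrow> bool" where
  "pairing4 j p \<longleftrightarrow> ((app4 p 1 = 1 \<or> app4 p 1 = j) \<longleftrightarrow> (app4 p j = 1 \<or> app4 p j = j))"

definition swaps4 :: "nat \<Rightarrow> nat list \<Rightarrow> bool" where
  "swaps4 j p \<longleftrightarrow> \<not> (app4 p 1 = 1 \<or> app4 p 1 = j)"

text \<open>Boolean \<open>\<noteq>\<close> is addition modulo 2. The six comparisons count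
  non-inversions, which have the parity of the inversions because six is even.\<close>

definition odd4 :: "nat list \<Rightarrow> bool" where
  "odd4 p \<longleftrightarrow> ((app4 p 1 < app4 p 2) \<noteq> ((app4 p 1 < app4 p 3) \<noteq> ((app4 p 1 < app4 p 4) \<noteq>
     ((app4 p 2 < app4 p 3) \<noteq> ((app4 p 2 < app4 p 4) \<noteq> (app4 p 3 < app4 p 4))))))"

text \<open>Order three; in Sym(4) these are exactly the 3-cycles.\<close>

definition three4 :: "nat list \<Rightarrow> bool" where
  "three4 p \<longleftrightarrow> p \<noteq> [1, 2, 3, 4] \<and> mult4 p (mult4 p p) = [1, 2, 3, 4]"

text \<open>The position, modulo 4, in the cyclic order in which \<open>1\<close> and \<open>j\<close> are opposite.\<close>

definition rot4 :: "nat \<Rightarrow> nat list \<Rightarrow> int" where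
  "rot4 j p = (let x = app4 p 1 in if x = 1 then 0 else if x = j then 2
     else if x < (if j = 4 then 3 else 4) then 1 else 3)"

lemma odd4_mult4:
  "\<forall>p\<in>set perms4. \<forall>q\<in>set perms4. odd4 (mult4 p q) = (odd4 p \<noteq> odd4 q)"
  by code_simp

lemma swaps4_mult4:
  "\<forall>j\<in>set [2, 3, 4]. \<forall>p\<in>set perms4. \<forall>q\<in>set perms4. pairing4 j p \<longrightarrow> pairing4 j q \<longrightarrow>
     swaps4 j (mult4 p q) = (swaps4 j p \<noteq> swaps4 j q)"
  by code_simp

text \<open>The even permutations in the dihedral group of one pairing form the Klein four-group,
  which preserves every pairing.\<close>

lemma pairing4_even:
  "\<forall>j\<in>set [2, 3, 4]. \<forall>p\<in>set perms4. pairing4 j p \<longrightarrow> \<not> odd4 p \<longrightarrow>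
     pairing4 2 p \<and> pairing4 3 p"
  by code_simp

text \<open>In the dihedral group of a pairing, \<open>odd4 p = swaps4 j p\<close> cuts out the
  rotations of the square whose diagonals are \<open>{1, j}\<close> and its complement. A rotation
  is known by where it sends 1.\<close>

lemma rot4_mult4:
  "\<forall>j\<in>set [2, 3, 4]. \<forall>p\<in>set perms4. \<forall>q\<in>set perms4. pairing4 j p \<longrightarrow> pairing4 j q \<longrightarrow>
     odd4 p = swaps4 j p \<longrightarrow> odd4 q = swaps4 j q \<longrightarrow> rot4 j (mult4 p q) = (rot4 j p + rot4 j q) mod 4"
  by code_simp

text \<open>Sym(4) acts on the three pairings as Sym(3). Here \<open>p\<close> and \<open>q\<close>
  act as two different transpositions, so their product acts as a 3-cycle, and the permutations
  acting as 3-cycles on the pairings are exactly the 3-cycles of Sym(4).\<close>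

lemma three4_mult4:
  "\<forall>j\<in>set [2, 3, 4]. \<forall>p\<in>set perms4. \<forall>q\<in>set perms4. \<not> three4 p \<longrightarrow> \<not> three4 q \<longrightarrow> pairing4 j p \<longrightarrow>
     \<not> (pairing4 2 p \<and> pairing4 3 p \<and> pairing4 4 p) \<longrightarrow> \<not> pairing4 j q \<longrightarrow> three4 (mult4 p q)"
  by code_simp

lemma three4_or_pairing4:
  "\<forall>p\<in>set perms4. three4 p \<or> pairing4 2 p \<or> pairing4 3 p \<or> pairing4 4 p"
  by code_simp

text \<open>The conjugate of \<open>c\<close> by \<open>h\<close> is a 3-cycle fixing
  \<open>j\<close>, and there are only two of these, inverse to each other. The premises stand as
  early as possible so that evaluation visits few cases.\<close>

lemma three4_conj:
  "\<forall>c\<in>set (filter three4 perms4). \<forall>i\<in>set [1, 2, 3, 4]. app4 c i = i \<longrightarrow>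
     (\<forall>d\<in>set (filter three4 perms4). \<forall>j\<in>set [1, 2, 3, 4]. app4 d j = j \<longrightarrow>
       (\<forall>h\<in>set perms4. app4 h i = j \<longrightarrow> mult4 h c = mult4 d h \<or> mult4 h c = mult4 (mult4 d d) h))"
  by code_simp

lemma three4_fixes:
  "\<forall>c\<in>set perms4. three4 c \<longrightarrow> (\<exists>i\<in>set [1, 2, 3, 4]. app4 c i = i)"
  by code_simp

text \<open>Recovers a 3-cycle from its square.\<close>

lemma three4_power:
  "\<forall>d\<in>set perms4. three4 d \<longrightarrow> mult4 (mult4 d d) (mult4 d d) = d"
  by code_simp

section \<open>Translation between permutations and lists\<close>

definition list4 :: "(nat \<Rightarrow> nat) \<Rightarrow> nat list" where
  "list4 p = map p [1, 2, 3, 4]"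

lemma atLeastAtMost_1_4: "{1..4::nat} = {1, 2, 3, 4}"
  by auto

lemma app4_list4: "i \<in> {1..4} \<Longrightarrow> app4 (list4 p) i = p i"
  unfolding atLeastAtMost_1_4 by (auto simp: app4_def list4_def)

lemma perms4_complete:
  "\<forall>a\<in>set [1, 2, 3, 4]. \<forall>b\<in>set [1, 2, 3, 4]. \<forall>c\<in>set [1, 2, 3, 4]. \<forall>d\<in>set [1, 2, 3, 4].
     a \<noteq> b \<and> a \<noteq> c \<and> a \<noteq> d \<and> b \<noteq> c \<and> b \<noteq> d \<and> c \<noteq> d \<longrightarrow> [a, b, c, d] \<in> set perms4"
  by code_simp

lemma list4_in_perms4:
  assumes "p permutes {1..4}"
  shows "list4 p \<in> set perms4"
proof -
  have "p i \<in> {1, 2, 3, 4}" if "i \<in> {1, 2, 3, 4}" for i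
    using permutes_in_image[OF assms, of i] that by (simp only: atLeastAtMost_1_4)
  then have "p 1 \<in> {1, 2, 3, 4}" "p 2 \<in> {1, 2, 3, 4}" "p 3 \<in> {1, 2, 3, 4}" "p 4 \<in> {1, 2, 3, 4}"
    by blast+
  moreover have "p i \<noteq> p j" if "i \<noteq> j" for i j
    using permutes_inj[OF assms] that by (auto dest: injD)
  then have "p 1 \<noteq> p 2" "p 1 \<noteq> p 3" "p 1 \<noteq> p 4" "p 2 \<noteq> p 3" "p 2 \<noteq> p 4" "p 3 \<noteq> p 4"
    by simp_all
  ultimately show ?thesis
    using perms4_complete unfolding list4_def list.map set_simps by blast
qed

lemma list4_comp:
  assumes "q permutes {1..4}"
  shows "list4 (p \<circ> q) = mult4 (list4 p) (list4 q)"
proof -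
  have "app4 (list4 p) (q i) = p (q i)" if "i \<in> {1..4}" for i
    using permutes_in_image[OF assms, of i] that app4_list4 by blast
  then show ?thesis by (simp add: mult4_def list4_def)
qed

lemma list4_inj:
  assumes "p permutes {1..4}" "q permutes {1..4}" "list4 p = list4 q"
  shows "p = q"
proof
  fix i
  show "p i = q i"
  proof (cases "i \<in> {1..4}")
    case True
    then show ?thesis using assms(3) app4_list4 by metis
  next
    case False
    then show ?thesis using assms permutes_not_in by metis
  qed
qed

lemma three4_cycle:
  "\<forall>x\<in>set [1, 2, 3, 4]. \<forall>y\<in>set [1, 2, 3, 4]. \<forall>z\<in>set [1, 2, 3, 4].
     x \<noteq> y \<and> x \<noteq> z \<and> y \<noteq> z \<longrightarrow> three4 (list4 (cycle_of_list [x, y, z]))"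
  by code_simp

section \<open>Quotients of transitive subgroups\<close>

lemma epiI: "f \<in> hom A B \<Longrightarrow> carrier B \<subseteq> f ` carrier A \<Longrightarrow> f \<in> epi A B"
  by (auto simp: epi_def hom_def)

text \<open>Without an invariant pairing \<open>H\<close> contains Alt(4). With one,
  \<open>H\<close> lies in a dihedral group of order 8, where the sign and the exchange of the two
  blocks are homomorphisms to C2; together they are onto C2 x C2 unless \<open>H\<close> is cyclic
  or the Klein four-group.\<close>

lemma transitive_subgroup_epi:
  assumes H: "subgroup H (sym_group 4)"
    and transitive: "\<forall>i\<in>{1..4}. \<forall>j\<in>{1..4}. \<exists>h\<in>H. h i = j"
  defines "S \<equiv> (sym_group 4)\<lparr>carrier := H\<rparr>"
  shows "(\<exists>h. h \<in> epi S (integer_mod_group 2 \<times>\<times> integer_mod_group 2)) \<or>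
         (\<exists>h. h \<in> epi S (integer_mod_group 4)) \<or>
         (\<exists>h. h \<in> epi S (alt_group 4)) \<or> (\<exists>h. h \<in> epi S (sym_group 4))"
proof -
  interpret H: subgroup H "sym_group 4" by (rule H)
  have trans: "\<exists>h\<in>H. h i = j" if "i \<in> {1..4}" "j \<in> {1..4}" for i j
    using transitive that by blast
  have perm: "h permutes {1..4}" if "h \<in> H" for h
    using H.subset that by (auto simp: sym_group_carrier)
  have mem: "list4 h \<in> set perms4" if "h \<in> H" for h
    using that perm list4_in_perms4 by blast
  have comp: "g \<circ> h \<in> H" "list4 (g \<circ> h) = mult4 (list4 g) (list4 h)" if "g \<in> H" "h \<in> H" for g h
    using H.m_closed[OF that] that perm list4_comp by (auto simp: sym_group_mult)
  have S: "carrier S = H" "monoid.mult S = (\<circ>)" by (auto simp: S_def sym_group_mult)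
  have app1: "app4 (list4 h) (Suc 0) = h (Suc 0)" for h by (simp add: app4_list4)
  define bit where "bit b = (if b then 1 else 0 :: int)" for b
  have bit_add: "bit (a = (\<not> b)) = (bit a + bit b) mod 2" for a b
    by (auto simp: bit_def)
  have Z2: "bit b \<in> carrier (integer_mod_group 2)" for b
    by (simp add: bit_def)
  have carZ2: "carrier (integer_mod_group 2) = {0, 1}"
    by (auto simp: carrier_integer_mod_group)
  have carZ22: "carrier (integer_mod_group 2 \<times>\<times> integer_mod_group 2) = {(0, 0), (0, 1), (1, 0), (1, 1)}"
    by (auto simp: carZ2)
  have carZ4: "carrier (integer_mod_group 4) = {0, 1, 2, 3}"
    by (auto simp: carrier_integer_mod_group)
  show ?thesis
  proof (cases "\<exists>j\<in>{2, 3, 4}. \<forall>h\<in>H. pairing4 j (list4 h)")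
    case True
    then obtain j where j: "j \<in> {2, 3, 4}" and pair: "\<And>h. h \<in> H \<Longrightarrow> pairing4 j (list4 h)"
      by blast
    have odd_comp: "odd4 (list4 (g \<circ> h)) = (odd4 (list4 g) \<noteq> odd4 (list4 h))"
      if "g \<in> H" "h \<in> H" for g h
      using comp(2)[OF that] odd4_mult4 mem that by simp
    have swaps_comp: "swaps4 i (list4 (g \<circ> h)) = (swaps4 i (list4 g) \<noteq> swaps4 i (list4 h))"
      if "g \<in> H" "h \<in> H" "i \<in> {2, 3, 4}" "\<forall>h\<in>H. pairing4 i (list4 h)" for g h i
      using comp(2)[OF that(1,2)] swaps4_mult4 mem that by auto
    \<comment> \<open>Transitivity moves 1 out of its block \<open>{1, j}\<close>.\<close>
    obtain h1 where h1: "h1 \<in> H" "swaps4 j (list4 h1)"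
    proof -
      obtain x where x: "x \<in> {1..4}" "x \<noteq> 1" "x \<noteq> j"
        using that[of 2] that[of 3] j by (cases "j = 2") (auto intro: that[of 3] that[of 2])
      with trans[of 1 x] show thesis
        using that by (force simp: swaps4_def app1)
    qed
    show ?thesis
    proof (cases "\<exists>h2\<in>H. (odd4 (list4 h2), swaps4 j (list4 h2)) \<noteq> (False, False) \<and>
        (odd4 (list4 h2), swaps4 j (list4 h2)) \<noteq> (odd4 (list4 h1), swaps4 j (list4 h1))")
      case True
      then obtain h2 where h2: "h2 \<in> H" "(odd4 (list4 h2), swaps4 j (list4 h2)) \<noteq> (False, False)"
        "(odd4 (list4 h2), swaps4 j (list4 h2)) \<noteq> (odd4 (list4 h1), swaps4 j (list4 h1))"
        by blast
      define f where "f h = (bit (odd4 (list4 h)), bit (swaps4 j (list4 h)))" for h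
      have fc: "f (g \<circ> h) = ((fst (f g) + fst (f h)) mod 2, (snd (f g) + snd (f h)) mod 2)"
        if "g \<in> H" "h \<in> H" for g h
        using that odd_comp swaps_comp j pair by (simp add: f_def bit_add)
      have hom: "f \<in> hom S (integer_mod_group 2 \<times>\<times> integer_mod_group 2)"
        by (rule homI) (auto simp: S fc mult_DirProd' Z2, auto simp: f_def Z2)
      \<comment> \<open>Two distinct nonzero elements of C2 x C2, their sum, and zero (the value at
        \<open>h1 \<circ> h1\<close>) exhaust the group.\<close>
      have "{(0, 0), (0, 1), (1, 0), (1, 1)} \<subseteq> {f h1, f h2, f (h1 \<circ> h2), f (h1 \<circ> h1)}"
        unfolding fc[OF h1(1) h2(1)] fc[OF h1(1) h1(1)] using h1(2) h2(2,3)
        by (cases "odd4 (list4 h1)"; cases "odd4 (list4 h2)"; cases "swaps4 j (list4 h2)")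
          (simp_all add: f_def bit_def)
      moreover have "{f h1, f h2, f (h1 \<circ> h2), f (h1 \<circ> h1)} \<subseteq> f ` H"
        using h1(1) h2(1) comp(1) by (intro insert_subsetI empty_subsetI imageI)
      ultimately have "{(0, 0), (0, 1), (1, 0), (1, 1)} \<subseteq> f ` H" by (rule subset_trans)
      then have "f \<in> epi S (integer_mod_group 2 \<times>\<times> integer_mod_group 2)"
        by (intro epiI hom) (simp only: S carZ22)
      then show ?thesis by blast
    next
      case False
      show ?thesis
      proof (cases "odd4 (list4 h1)")
        case True
        with False h1 have eq: "odd4 (list4 h) = swaps4 j (list4 h)" if "h \<in> H" for h
          using that by auto
        define f where "f h = rot4 j (list4 h)" for h
        have "f \<in> hom S (integer_mod_group 4)"
        proof (rule homI)
          fix g h assume "g \<in> carrier S" "h \<in> carrier S"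
          then have gh: "g \<in> H" "h \<in> H" by (simp_all add: S)
          then show "f (g \<otimes>\<^bsub>S\<^esub> h) = f g \<otimes>\<^bsub>integer_mod_group 4\<^esub> f h"
            using rot4_mult4[rule_format, of j "list4 g" "list4 h"] mem pair eq j
            by (simp add: S f_def comp(2))
        qed (auto simp: f_def carZ4 rot4_def Let_def)
        moreover have "x \<in> f ` H" if x: "x \<in> {0, 1, 2, 3}" for x
        proof -
          \<comment> \<open>\<open>rot4\<close> reads only the image of 1, so a one-element list
            stands for any permutation with that image.\<close>
          obtain y where y: "y \<in> {1..4}" "rot4 j [y] = x"
          proof -
            have "\<forall>j\<in>set [2, 3, 4]. \<forall>x\<in>set [0, 1, 2, 3]. \<exists>y\<in>set [1, 2, 3, 4]. rot4 j [y] = x"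
              by code_simp
            then have "\<exists>y\<in>{1, 2, 3, 4}. rot4 j [y] = x"
              using j x unfolding set_simps by blast
            then show thesis using that atLeastAtMost_1_4 by blast
          qed
          obtain h where "h \<in> H" "h 1 = y" using trans[of 1 y] y by auto
          then have "f h = x" using y(2) by (simp add: f_def rot4_def app1 app4_def[of "[y]"])
          then show ?thesis using \<open>h \<in> H\<close> by blast
        qed
        ultimately have "f \<in> epi S (integer_mod_group 4)"
          by (intro epiI subsetI) (simp_all add: S carZ4)
        then show ?thesis by blast
      next
        case even1: False
        with False h1 have even: "\<not> odd4 (list4 h)" if "h \<in> H" for h
          using that by auto
        \<comment> \<open>Now \<open>H\<close> lies in the Klein four-group; the exchange bits for
          two pairings are its coordinates.\<close>
        have pair2: "\<forall>h\<in>H. pairing4 2 (list4 h)" and pair3: "\<forall>h\<in>H. pairing4 3 (list4 h)"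
          using pairing4_even even pair mem j by auto
        define f where "f h = (bit (swaps4 2 (list4 h)), bit (swaps4 3 (list4 h)))" for h
        have "f \<in> hom S (integer_mod_group 2 \<times>\<times> integer_mod_group 2)"
          by (rule homI)
            (auto simp: S f_def swaps_comp pair2 pair3 bit_add mult_DirProd' Z2)
        moreover have "x \<in> f ` H" if x: "x \<in> {(0, 0), (0, 1), (1, 0), (1, 1)}" for x
        proof -
          \<comment> \<open>The images 1, 2, 3, 4 of the letter 1 give the bit pairs (0,0), (0,1),
            (1,0), (1,1).\<close>
          obtain y :: nat where y: "y \<in> {1..4}" "x = (bit (\<not> (y = 1 \<or> y = 2)), bit (\<not> (y = 1 \<or> y = 3)))"
            using x that[of 1] that[of 2] that[of 3] that[of 4] by (auto simp: bit_def)
          obtain h where "h \<in> H" "h 1 = y" using trans[of 1 y] y by auto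
          then show ?thesis using y(2) by (force simp: f_def swaps4_def app1)
        qed
        ultimately have "f \<in> epi S (integer_mod_group 2 \<times>\<times> integer_mod_group 2)"
          by (intro epiI subsetI) (simp_all only: S carZ22)
        then show ?thesis by blast
      qed
    qed
  next
    case False
    \<comment> \<open>Take \<open>p\<close> moving the pairing of 1 with 2, a pairing
      \<open>j\<close> that \<open>p\<close> keeps, and \<open>q\<close> moving \<open>j\<close>. If
      neither is a 3-cycle, then their product is.\<close>
    have "\<exists>c\<in>H. three4 (list4 c)"
    proof (rule ccontr)
      assume no: "\<not> (\<exists>c\<in>H. three4 (list4 c))"
      obtain p where p: "p \<in> H" "\<not> pairing4 2 (list4 p)" using False by auto
      obtain j where j: "j \<in> {3, 4}" "pairing4 j (list4 p)"
        using bspec[OF three4_or_pairing4 mem[OF p(1)]] no p by blast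
      obtain q where q: "q \<in> H" "\<not> pairing4 j (list4 q)" using False j by auto
      have "three4 (mult4 (list4 p) (list4 q))"
        using three4_mult4[rule_format, of j "list4 p" "list4 q"] p q j no mem by auto
      then show False using no comp[OF p(1) q(1)] by auto
    qed
    then obtain c where c: "c \<in> H" "three4 (list4 c)" by blast
    obtain i where i: "i \<in> {1..4}" "app4 (list4 c) i = i"
      using three4_fixes[rule_format, OF mem[OF c(1)] c(2)] unfolding atLeastAtMost_1_4 by auto
    \<comment> \<open>Transitivity carries the letter fixed by \<open>c\<close> to the one fixed by
      \<open>d\<close>. The conjugate of \<open>c\<close> is then \<open>d\<close> or
      \<open>d \<circ> d\<close>, and \<open>d\<close> is the square of the latter.\<close>
    have three: "d \<in> H" if d: "d permutes {1..4}" "three4 (list4 d)" for d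
    proof -
      have dm: "list4 d \<in> set perms4" using d list4_in_perms4 by blast
      obtain j where j: "j \<in> {1..4}" "app4 (list4 d) j = j"
        using three4_fixes[rule_format, OF dm d(2)] unfolding atLeastAtMost_1_4 by auto
      obtain h where h: "h \<in> H" "h i = j" using trans[OF i(1) j(1)] by blast
      have "app4 (list4 h) i = j" using h i app4_list4 by simp
      then have "mult4 (list4 h) (list4 c) = mult4 (list4 d) (list4 h) \<or>
          mult4 (list4 h) (list4 c) = mult4 (mult4 (list4 d) (list4 d)) (list4 h)"
        using three4_conj[rule_format, of "list4 c" i "list4 d" j "list4 h"] c d dm mem h i j
        unfolding atLeastAtMost_1_4 by simp
      then have "list4 (h \<circ> c) = list4 (d \<circ> h) \<or> list4 (h \<circ> c) = list4 (d \<circ> d \<circ> h)"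
        using perm[OF h(1)] perm[OF c(1)] d by (simp add: list4_comp)
      then have "h \<circ> c = d \<circ> h \<or> h \<circ> c = d \<circ> d \<circ> h"
        by (elim disj_forward list4_inj[rotated 2])
          (intro permutes_compose perm h(1) c(1) d(1))+
      then have "h \<circ> c \<circ> inv' h = d \<circ> (h \<circ> inv' h) \<or> h \<circ> c \<circ> inv' h = d \<circ> d \<circ> (h \<circ> inv' h)"
        by (elim disj_forward) (simp_all only: comp_assoc[symmetric])
      then have "h \<circ> c \<circ> inv' h = d \<or> h \<circ> c \<circ> inv' h = d \<circ> d"
        by (simp only: permutes_inv_o(1)[OF perm[OF h(1)]] comp_id)
      moreover have "h \<circ> c \<circ> inv' h \<in> H"
        using comp(1) h(1) c(1) H.m_inv_closed[OF h(1)] H.subset h(1)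
        by (auto simp: sym_group_inv_equality[of h 4])
      moreover have "d \<circ> d \<circ> (d \<circ> d) = d"
        by (rule list4_inj) (use d three4_power dm in \<open>auto simp: list4_comp permutes_compose\<close>)
      ultimately show ?thesis using comp(1) by metis
    qed
    have "three_cycles 4 \<subseteq> H"
    proof clarify
      fix cs :: "nat list" assume cs: "cycle cs" "length cs = 3" "set cs \<subseteq> {1..4}"
      then obtain x y z where xyz: "cs = [x, y, z]"
        by (auto simp: length_Suc_conv numeral_3_eq_3)
      have "cycle_of_list cs \<in> carrier (alt_group 4)"
        using cs by (intro subsetD[OF three_cycles_incl]) blast
      then have "cycle_of_list cs permutes {1..4}" by (simp only: alt_group_carrier)
      moreover have "three4 (list4 (cycle_of_list cs))"
      proof -
        have "x \<in> set [1, 2, 3, 4]" "y \<in> set [1, 2, 3, 4]" "z \<in> set [1, 2, 3, 4]"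
          using cs(3) unfolding xyz atLeastAtMost_1_4 by simp_all
        moreover have "x \<noteq> y \<and> x \<noteq> z \<and> y \<noteq> z" using cs(1) unfolding xyz by simp
        ultimately show ?thesis using three4_cycle unfolding xyz by blast
      qed
      ultimately show "cycle_of_list cs \<in> H" by (rule three)
    qed
    then have alt: "carrier (alt_group 4) \<subseteq> H"
    proof -
      have "generate (alt_group 4) (three_cycles 4) \<subseteq> H"
      proof
        fix x assume "x \<in> generate (alt_group 4) (three_cycles 4)"
        then show "x \<in> H"
        proof induction
          case (inv h)
          have "h \<in> H" using inv \<open>three_cycles 4 \<subseteq> H\<close> by blast
          have hc: "h \<in> carrier (alt_group 4)" using inv three_cycles_incl by blast
          have "inv\<^bsub>alt_group 4\<^esub> h = inv\<^bsub>sym_group 4\<^esub> h"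
            unfolding alt_group_def
            by (rule group.m_inv_consistent[OF sym_group_is_group])
              (use alt_group_is_subgroup[of 4] hc in \<open>auto simp: alt_group_def\<close>)
          then show ?case using H.m_inv_closed[OF \<open>h \<in> H\<close>] by simp
        next
          case (incl h)
          then show ?case using \<open>three_cycles 4 \<subseteq> H\<close> by blast
        next
          case one
          then show ?case using H.one_closed by (simp only: alt_group_one sym_group_one)
        next
          case (eng g h)
          then show ?case using comp(1) by (simp only: alt_group_mult)
        qed
      qed
      then show ?thesis using alt_group_carrier_as_three_cycles by metis
    qed
    show ?thesis
    proof (cases "H = carrier (alt_group 4)")
      case True
      then have "S = alt_group 4" by (simp add: S_def alt_group_def)
      then have "(\<lambda>x. x) \<in> epi S (alt_group 4)" by (auto simp: epi_def hom_def)
      then show ?thesis by blast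
    next
      case False
      then obtain p where p: "p \<in> H" "\<not> evenperm p"
        using alt perm alt_group_carrier by blast
      have "q \<in> H" if q: "q permutes {1..4}" for q
      proof (cases "evenperm q")
        case True
        then show ?thesis using q alt alt_group_carrier by blast
      next
        case False
        have fin: "permutation p" "permutation q"
          using perm[OF p(1)] q by (auto simp: permutation_permutes)
        \<comment> \<open>An odd \<open>q\<close> is \<open>p\<close> followed on the right by the
          even permutation \<open>inv' p \<circ> q\<close>.\<close>
        have "inv' p \<circ> q permutes {1..4}"
          using perm[OF p(1)] q by (intro permutes_compose permutes_inv)
        moreover have "evenperm (inv' p \<circ> q)"
          using fin False p(2) by (simp add: evenperm_comp permutation_inverse evenperm_inv)
        ultimately have "inv' p \<circ> q \<in> H" using alt alt_group_carrier by blast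
        then have "p \<circ> (inv' p \<circ> q) \<in> H" by (rule comp(1)[OF p(1)])
        then show ?thesis
          using permutes_inv_o(1)[OF perm[OF p(1)]] by (simp flip: comp_assoc)
      qed
      then have "H = carrier (sym_group 4)"
        using H.subset sym_group_carrier by blast
      then have "S = sym_group 4" by (simp add: S_def)
      then have "(\<lambda>x. x) \<in> epi S (sym_group 4)" by (auto simp: epi_def hom_def)
      then show ?thesis by blast
    qed
  qed
qed

section \<open>Walking around an edge\<close>

text \<open>Conjugating by a power of \<open>\<beta> \<circ> \<alpha>\<close> reduces the claim to the exponents 0 and 1.\<close>

lemma dihedral_power_neq:
  assumes closed: "\<And>x. x \<in> X \<Longrightarrow> \<alpha> x \<in> X" "\<And>x. x \<in> X \<Longrightarrow> \<beta> x \<in> X"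
    and invol: "\<And>x. x \<in> X \<Longrightarrow> \<alpha> (\<alpha> x) = x" "\<And>x. x \<in> X \<Longrightarrow> \<beta> (\<beta> x) = x"
    and comm: "\<And>x. x \<in> X \<Longrightarrow> \<tau> (\<alpha> x) = \<alpha> (\<tau> x)" "\<And>x. x \<in> X \<Longrightarrow> \<tau> (\<beta> x) = \<beta> (\<tau> x)"
    and \<tau>: "\<And>x. x \<in> X \<Longrightarrow> \<tau> x \<in> X"
    and neq: "\<And>x. x \<in> X \<Longrightarrow> \<tau> (\<beta> x) \<noteq> x" "\<And>x. x \<in> X \<Longrightarrow> \<alpha> x \<noteq> \<tau> x"
    and x: "x \<in> X"
  shows "((\<beta> \<circ> \<alpha>) ^^ k) x \<noteq> \<tau> (\<beta> x)"
  using x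
proof (induction k arbitrary: x rule: less_induct)
  case (less k)
  consider "k = 0" | "k = 1" | l where "k = Suc (Suc l)"
    by (metis One_nat_def not0_implies_Suc)
  then show ?case
  proof cases
    case 1
    then show ?thesis using neq(1)[OF less.prems] by auto
  next
    case 2
    show ?thesis
    proof
      assume "((\<beta> \<circ> \<alpha>) ^^ k) x = \<tau> (\<beta> x)"
      then have "\<beta> (\<beta> (\<alpha> x)) = \<beta> (\<beta> (\<tau> x))" using 2 less.prems comm by simp
      then show False using neq(2) invol closed \<tau> less.prems by simp
    qed
  next
    case (3 l)
    define y where "y = \<beta> (\<alpha> x)"
    have y: "y \<in> X" using less.prems closed by (simp add: y_def)
    have pw: "((\<beta> \<circ> \<alpha>) ^^ n) z \<in> X" if "z \<in> X" for n z
      using that by (induction n) (auto simp: closed)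
    show ?thesis
    proof
      assume *: "((\<beta> \<circ> \<alpha>) ^^ k) x = \<tau> (\<beta> x)"
      define z where "z = ((\<beta> \<circ> \<alpha>) ^^ l) y"
      have z: "z \<in> X" using pw y by (simp add: z_def)
      have "((\<beta> \<circ> \<alpha>) ^^ k) x = (\<beta> \<circ> \<alpha>) z"
        unfolding z_def y_def 3 by (simp add: funpow_swap1)
      then have "\<beta> (\<beta> (\<alpha> z)) = \<beta> (\<beta> (\<tau> x))" using * comm less.prems by simp
      then have "\<alpha> z = \<tau> x" using invol closed \<tau> z less.prems by simp
      then have "\<alpha> (\<alpha> z) = \<alpha> (\<tau> x)" by simp
      then have "z = \<tau> (\<alpha> x)" using invol z comm less.prems by simp
      \<comment> \<open>\<open>\<beta> y = \<alpha> x\<close> by the choice of \<open>y\<close>, so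
        \<open>z\<close> is the forbidden value for \<open>y\<close>, with the exponent lowered by
        two.\<close>
      also have "\<dots> = \<tau> (\<beta> y)" using invol closed less.prems by (simp add: y_def)
      finally show False using less.IH[OF _ y, of l] 3 by (simp add: z_def)
    qed
  qed
qed

text \<open>By injectivity the orbit is purely periodic and its size is the least period
  \<open>d\<close>. Exponents reaching the same point agree modulo \<open>d\<close>, hence modulo 2
  when \<open>d\<close> is even.\<close>

lemma funpow_eq_imp_parity:
  assumes X: "finite X" "x \<in> X" "\<And>y. y \<in> X \<Longrightarrow> f y \<in> X" "inj_on f X"
    and ev: "even (card (range (\<lambda>n. (f ^^ n) x)))" and eq: "(f ^^ k) x = (f ^^ l) x"
  shows "even k \<longleftrightarrow> even l"
proof -
  have in_X: "(f ^^ n) x \<in> X" for n by (induction n) (auto simp: X)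
  have cancel: "(f ^^ n) x = x" if "(f ^^ (m + n)) x = (f ^^ m) x" for m n
    using that by (induction m) (use in_X X(4) in \<open>auto simp: inj_on_eq_iff\<close>)
  have "\<not> inj (\<lambda>n. (f ^^ n) x)"
    using finite_subset[of "range (\<lambda>n. (f ^^ n) x)" X] in_X X(1) finite_imageD
    by (auto simp: image_subset_iff)
  then obtain a b where "a < b" "(f ^^ a) x = (f ^^ b) x"
    unfolding inj_def by (metis linorder_neqE_nat)
  then have "\<exists>n>0. (f ^^ n) x = x"
    using cancel[of a "b - a"] by (intro exI[of _ "b - a"]) auto
  define d where "d = (LEAST n. n > 0 \<and> (f ^^ n) x = x)"
  have d: "d > 0" "(f ^^ d) x = x"
    using LeastI_ex[OF \<open>\<exists>n>0. (f ^^ n) x = x\<close>] by (auto simp: d_def)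
  have least: "d \<le> n" if "n > 0" "(f ^^ n) x = x" for n
    unfolding d_def by (rule Least_le) (use that in auto)
  have mod: "(f ^^ n) x = (f ^^ (n mod d)) x" for n
  proof -
    have mult: "(f ^^ (d * q)) x = x" for q
      by (induction q) (auto simp: funpow_add d)
    have "(f ^^ (n mod d + d * (n div d))) x = (f ^^ (n mod d)) x"
      by (simp only: funpow_add o_apply mult)
    then show ?thesis by simp
  qed
  have inj: "i = j" if "(f ^^ i) x = (f ^^ j) x" "i < d" "j < d" for i j
  proof (rule ccontr)
    have False if "(f ^^ i) x = (f ^^ j) x" "i < j" "j < d" for i j
      using cancel[of i "j - i"] least[of "j - i"] that by auto
    moreover assume "i \<noteq> j"
    ultimately show False using that by (metis linorder_neqE_nat)
  qed
  have "range (\<lambda>n. (f ^^ n) x) = (\<lambda>n. (f ^^ n) x) ` {..<d}"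
    using mod d(1) by (auto simp: image_iff) (metis lessThan_iff mod_less_divisor)
  moreover have "inj_on (\<lambda>n. (f ^^ n) x) {..<d}"
    using inj by (auto simp: inj_on_def)
  ultimately have "even d" using ev by (simp add: card_image)
  moreover have "k mod d = l mod d"
    using inj[of "k mod d" "l mod d"] mod[of k] mod[of l] eq d(1) by simp
  ultimately show ?thesis
    by (metis dvd_mod_iff)
qed

text \<open>The combinatorics of a triangulation with the geometry removed. \<open>gp t i\<close>
  extends the gluing of the face opposite to \<open>i\<close> to all four labels, so
  \<open>gp t i i\<close> is the label of the same face seen from the neighbour. \<open>pos\<close>
  is the sign of an ordered frame of corners: crossing a face acts like a reflection and reverses
  it, as do the exchanges of the first two and of the last two corners.\<close>

locale face_pairing =
  fixes T :: "'t set" and nb :: "'t \<Rightarrow> nat \<Rightarrow> 't" and gp :: "'t \<Rightarrow> nat \<Rightarrow> nat \<Rightarrow> nat"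
    and pos :: "'t \<Rightarrow> (nat \<Rightarrow> nat) \<Rightarrow> bool"
  assumes finite_T: "finite T"
    and nb_closed: "t \<in> T \<Longrightarrow> i \<in> {1..4} \<Longrightarrow> nb t i \<in> T"
    and gp_permutes: "t \<in> T \<Longrightarrow> i \<in> {1..4} \<Longrightarrow> gp t i permutes {1..4}"
    and nb_nb: "t \<in> T \<Longrightarrow> i \<in> {1..4} \<Longrightarrow> nb (nb t i) (gp t i i) = t"
    and gp_gp: "t \<in> T \<Longrightarrow> i \<in> {1..4} \<Longrightarrow> gp (nb t i) (gp t i i) = inv' (gp t i)"
    and nb_neq: "t \<in> T \<Longrightarrow> i \<in> {1..4} \<Longrightarrow> (nb t i, gp t i i) \<noteq> (t, i)"
    and pos_gp: "t \<in> T \<Longrightarrow> \<rho> permutes {1..4} \<Longrightarrow> pos (nb t (\<rho> 3)) (gp t (\<rho> 3) \<circ> \<rho>) \<longleftrightarrow> \<not> pos t \<rho>"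
    and pos_12: "t \<in> T \<Longrightarrow> \<rho> permutes {1..4} \<Longrightarrow> pos t (\<rho> \<circ> Transposition.transpose 1 2) \<longleftrightarrow> \<not> pos t \<rho>"
    and pos_34: "t \<in> T \<Longrightarrow> \<rho> permutes {1..4} \<Longrightarrow> pos t (\<rho> \<circ> Transposition.transpose 3 4) \<longleftrightarrow> \<not> pos t \<rho>"
begin

text \<open>A state \<open>(t, \<rho>)\<close> is the edge of \<open>t\<close> from corner \<open>\<rho> 1\<close> to corner \<open>\<rho> 2\<close>, about to leave \<open>t\<close>
  through the face opposite to \<open>\<rho> 3\<close>; \<open>turn\<close> walks around the edge into the next tetrahedron.\<close>

definition states :: "('t \<times> (nat \<Rightarrow> nat)) set" where
  "states = T \<times> {\<rho>. \<rho> permutes {1..4}}"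

definition cross :: "'t \<times> (nat \<Rightarrow> nat) \<Rightarrow> 't \<times> (nat \<Rightarrow> nat)" where
  "cross = (\<lambda>(t, \<rho>). (nb t (\<rho> 3), gp t (\<rho> 3) \<circ> \<rho>))"

definition swap34 :: "'t \<times> (nat \<Rightarrow> nat) \<Rightarrow> 't \<times> (nat \<Rightarrow> nat)" where
  "swap34 = (\<lambda>(t, \<rho>). (t, \<rho> \<circ> Transposition.transpose 3 4))"

definition swap12 :: "'t \<times> (nat \<Rightarrow> nat) \<Rightarrow> 't \<times> (nat \<Rightarrow> nat)" where
  "swap12 = (\<lambda>(t, \<rho>). (t, \<rho> \<circ> Transposition.transpose 1 2))"

text \<open>After \<open>cross\<close> the third label is opposite to the face just crossed, and
  leaving there would lead back. \<open>swap34\<close> makes the other face at the edge the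
  exit.\<close>

definition turn :: "'t \<times> (nat \<Rightarrow> nat) \<Rightarrow> 't \<times> (nat \<Rightarrow> nat)" where
  "turn = swap34 \<circ> cross"

lemma permutes_in_1_4: "\<rho> permutes {1..4} \<Longrightarrow> i \<in> {1..4} \<Longrightarrow> \<rho> i \<in> {1..4::nat}"
  by (simp only: permutes_in_image)

lemma transpose_permutes: "Transposition.transpose 1 2 permutes {1..4::nat}" "Transposition.transpose 3 4 permutes {1..4::nat}"
  by (rule permutes_swap_id; simp)+

lemma finite_states: "finite states"
  unfolding states_def using finite_T finite_permutations by blast

lemma states_iff: "(t, \<rho>) \<in> states \<longleftrightarrow> t \<in> T \<and> \<rho> permutes {1..4}"
  by (auto simp: states_def)

lemma statesE:
  assumes "\<omega> \<in> states"
  obtains t \<rho> where "\<omega> = (t, \<rho>)" "t \<in> T" "\<rho> permutes {1..4}"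
  using assms unfolding states_def by blast

lemma cross_closed:
  assumes "\<omega> \<in> states"
  shows "cross \<omega> \<in> states"
  using assms
proof (rule statesE)
  fix t \<rho> assume t: "\<omega> = (t, \<rho>)" "t \<in> T" "\<rho> permutes {1..4}"
  have "\<rho> 3 \<in> {1..4}" by (rule permutes_in_1_4[OF t(3)]) simp
  with t show "cross \<omega> \<in> states"
    unfolding t(1) cross_def prod.case states_iff
    by (intro conjI nb_closed permutes_compose gp_permutes)
qed

lemma swap_closed: "\<omega> \<in> states \<Longrightarrow> swap34 \<omega> \<in> states" "\<omega> \<in> states \<Longrightarrow> swap12 \<omega> \<in> states"
proof -
  obtain t \<rho> where \<omega>: "\<omega> = (t, \<rho>)" by force
  show "\<omega> \<in> states \<Longrightarrow> swap34 \<omega> \<in> states" "\<omega> \<in> states \<Longrightarrow> swap12 \<omega> \<in> states"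
    unfolding \<omega> swap34_def swap12_def prod.case states_iff
    by (elim conjE, intro conjI permutes_compose[OF transpose_permutes(2)], assumption+,
      elim conjE, intro conjI permutes_compose[OF transpose_permutes(1)], assumption+)
qed

lemma cross_cross:
  assumes "\<omega> \<in> states"
  shows "cross (cross \<omega>) = \<omega>"
proof -
  obtain t \<rho> where \<omega>: "\<omega> = (t, \<rho>)" "t \<in> T" "\<rho> permutes {1..4}"
    using assms by (rule statesE)
  have 3: "\<rho> 3 \<in> {1..4}" using \<omega> permutes_in_1_4[of \<rho> 3] by simp
  have "inv' (gp t (\<rho> 3)) \<circ> (gp t (\<rho> 3) \<circ> \<rho>) = \<rho>"
    using permutes_inv_o(2)[OF gp_permutes[OF \<omega>(2) 3]] by (simp flip: comp_assoc)
  then show ?thesis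
    using nb_nb[OF \<omega>(2) 3] gp_gp[OF \<omega>(2) 3] by (simp add: cross_def \<omega>(1))
qed

lemma swap_swap: "swap34 (swap34 \<omega>) = \<omega>" "swap12 (swap12 \<omega>) = \<omega>"
  by (cases \<omega>; simp add: swap34_def swap12_def comp_assoc)+

lemma swap12_comm: "swap12 (cross \<omega>) = cross (swap12 \<omega>)" "swap12 (swap34 \<omega>) = swap34 (swap12 \<omega>)"
proof -
  show "swap12 (cross \<omega>) = cross (swap12 \<omega>)"
    by (cases \<omega>) (simp add: swap12_def cross_def comp_assoc)
  have "Transposition.transpose 3 4 \<circ> Transposition.transpose 1 2 = Transposition.transpose 1 2 \<circ> Transposition.transpose 3 (4::nat)"
    by (auto simp: Transposition.transpose_def fun_eq_iff)
  then show "swap12 (swap34 \<omega>) = swap34 (swap12 \<omega>)"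
    by (cases \<omega>) (simp add: swap34_def swap12_def comp_assoc)
qed

lemma turn_closed: "\<omega> \<in> states \<Longrightarrow> turn \<omega> \<in> states"
  by (simp add: turn_def cross_closed swap_closed)

lemma turn_power_closed: "\<omega> \<in> states \<Longrightarrow> (turn ^^ n) \<omega> \<in> states"
  by (induction n) (auto simp: turn_closed)

lemma inj_turn: "inj_on turn states"
proof (rule inj_on_inverseI)
  show "(cross \<circ> swap34) (turn \<omega>) = \<omega>" if "\<omega> \<in> states" for \<omega>
    using that by (simp add: turn_def swap_swap cross_cross)
qed

text \<open>This is the exchange that \<open>pos\<close> cannot detect. The involutions
  \<open>cross\<close> and \<open>swap34\<close> generate a dihedral action; its two basic cases say
  that a nontrivial relabelling moves every frame and that no face is glued to itself.\<close>

lemma turn_power_neq: "\<omega> \<in> states \<Longrightarrow> (turn ^^ k) \<omega> \<noteq> swap12 (swap34 \<omega>)"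
  unfolding turn_def
proof (rule dihedral_power_neq[where X = states])
  fix \<omega> assume \<omega>: "\<omega> \<in> states"
  then obtain t \<rho> where eq: "\<omega> = (t, \<rho>)" "t \<in> T" "\<rho> permutes {1..4}"
    by (rule statesE)
  have inj: "\<rho> i = \<rho> j \<longleftrightarrow> i = j" for i j
    using permutes_inj[OF eq(3)] by (auto dest: injD)
  show "swap12 (swap34 \<omega>) \<noteq> \<omega>"
    using inj[of 4 3] by (auto simp: eq(1) swap12_def swap34_def dest!: fun_cong[of _ _ 3])
  show "cross \<omega> \<noteq> swap12 \<omega>"
  proof
    assume "cross \<omega> = swap12 \<omega>"
    \<comment> \<open>At the label 3, which \<open>swap12\<close> leaves alone, the equality says
      that the face is its own partner.\<close>
    then have "nb t (\<rho> 3) = t" "gp t (\<rho> 3) (\<rho> 3) = \<rho> 3"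
      by (auto simp: cross_def swap12_def eq(1) dest!: fun_cong[of _ _ 3])
    then show False using nb_neq[OF eq(2), of "\<rho> 3"] permutes_in_1_4[OF eq(3), of 3] by simp
  qed
qed (auto simp: cross_closed swap_closed cross_cross swap_swap swap12_comm)

text \<open>\<open>cross\<close> and \<open>swap34\<close> each reverse the sign.\<close>

lemma pos_turn:
  assumes "\<omega> \<in> states"
  shows "case_prod pos ((turn ^^ n) \<omega>) = case_prod pos \<omega>"
proof (induction n)
  case (Suc n)
  have "(turn ^^ n) \<omega> \<in> states" using assms by (rule turn_power_closed)
  then obtain t \<rho> where eq: "(turn ^^ n) \<omega> = (t, \<rho>)" "t \<in> T" "\<rho> permutes {1..4}"
    by (rule statesE)
  have "cross (t, \<rho>) \<in> states" using cross_closed eq states_iff by blast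
  then show ?case
    using Suc pos_gp[OF eq(2,3)] pos_34[of "nb t (\<rho> 3)" "gp t (\<rho> 3) \<circ> \<rho>"]
    by (simp add: cross_def states_iff eq(1)) (simp add: turn_def cross_def swap34_def)
qed simp

lemma permutes_same_edge:
  assumes "\<rho> permutes {1..4::nat}" "\<rho>' permutes {1..4}" "{\<rho>' 1, \<rho>' 2} = {\<rho> 1, \<rho> 2}"
  shows "\<rho>' \<in> {\<rho>, \<rho> \<circ> Transposition.transpose 1 2, \<rho> \<circ> Transposition.transpose 3 4, \<rho> \<circ> Transposition.transpose 3 4 \<circ> Transposition.transpose 1 2}"
proof -
  have U: "{1..4::nat} = {1, 2, 3, 4}" by auto
  have inj: "\<rho> i = \<rho> j \<longleftrightarrow> i = j" "\<rho>' i = \<rho>' j \<longleftrightarrow> i = j" for i j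
    using assms permutes_inj by (auto dest: injD)
  have im: "{\<rho> 1, \<rho> 2, \<rho> 3, \<rho> 4} = {1..4}" "{\<rho>' 1, \<rho>' 2, \<rho>' 3, \<rho>' 4} = {1..4}"
    using permutes_image[OF assms(1)] permutes_image[OF assms(2)] unfolding U by simp_all
  have "{\<rho>' 3, \<rho>' 4} = {1..4} - {\<rho>' 1, \<rho>' 2}" unfolding im(2)[symmetric] using inj(2) by auto
  also have "\<dots> = {1..4} - {\<rho> 1, \<rho> 2}" using assms(3) by simp
  also have "\<dots> = {\<rho> 3, \<rho> 4}" unfolding im(1)[symmetric] using inj(1) by auto
  finally have 34: "{\<rho>' 3, \<rho>' 4} = {\<rho> 3, \<rho> 4}" .
  have ext: "\<rho>' = q" if "q permutes {1..4}" "\<rho>' 1 = q 1" "\<rho>' 2 = q 2" "\<rho>' 3 = q 3" "\<rho>' 4 = q 4" for q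
  proof
    fix i
    show "\<rho>' i = q i"
    proof (cases "i \<in> {1..4}")
      case True
      then show ?thesis using that unfolding U by blast
    next
      case False
      then show ?thesis by (simp only: permutes_not_in[OF that(1) False] permutes_not_in[OF assms(2) False])
    qed
  qed
  have perms: "\<rho> \<circ> Transposition.transpose 1 2 permutes {1..4}" "\<rho> \<circ> Transposition.transpose 3 4 permutes {1..4}"
    "\<rho> \<circ> Transposition.transpose 3 4 \<circ> Transposition.transpose 1 2 permutes {1..4}"
    by (intro permutes_compose transpose_permutes assms(1))+
  have c1: "\<rho>' 1 = \<rho> 1 \<and> \<rho>' 2 = \<rho> 2 \<or> \<rho>' 1 = \<rho> 2 \<and> \<rho>' 2 = \<rho> 1"
    using assms(3) by (simp add: doubleton_eq_iff)
  have c2: "\<rho>' 3 = \<rho> 3 \<and> \<rho>' 4 = \<rho> 4 \<or> \<rho>' 3 = \<rho> 4 \<and> \<rho>' 4 = \<rho> 3"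
    using 34 by (simp add: doubleton_eq_iff)
  show ?thesis
    using c1 c2 ext[OF assms(1)] ext[OF perms(1)] ext[OF perms(2)] ext[OF perms(3)]
    by (simp add: Transposition.transpose_def) blast
qed

text \<open>An edge is never glued to itself with its ends exchanged: orientation and
  \<open>dihedral_power_neq\<close> exclude the three nontrivial possibilities.\<close>

lemma turn_orbit_inj:
  assumes \<omega>: "\<omega> \<in> states" and mem: "(t, \<rho>) \<in> range (\<lambda>n. (turn ^^ n) \<omega>)" "(t, \<rho>') \<in> range (\<lambda>n. (turn ^^ n) \<omega>)"
    and eq: "{\<rho>' 1, \<rho>' 2} = {\<rho> 1, \<rho> 2}"
  shows "\<rho>' = \<rho>"
proof -
  have step: "\<rho>' = \<rho>" if s: "(t, \<rho>) \<in> states" and t: "(turn ^^ k) (t, \<rho>) = (t, \<rho>')" and eq: "{\<rho>' 1, \<rho>' 2} = {\<rho> 1, \<rho> 2}"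
    for \<rho> \<rho>' k
  proof -
    have tT: "t \<in> T" "\<rho> permutes {1..4}" "\<rho>' permutes {1..4}"
      using s turn_power_closed[OF s, of k] unfolding t states_iff by blast+
    \<comment> \<open>The two single exchanges reverse \<open>pos\<close> and are ruled out by it;
      the double exchange preserves it and is left to \<open>turn_power_neq\<close>.\<close>
    have "pos t \<rho>' = pos t \<rho>" using pos_turn[OF s, of k] unfolding t by simp
    then have "\<rho>' \<noteq> \<rho> \<circ> Transposition.transpose 1 2" "\<rho>' \<noteq> \<rho> \<circ> Transposition.transpose 3 4"
      using pos_12[OF tT(1,2)] pos_34[OF tT(1,2)] by auto
    moreover have "\<rho>' \<noteq> \<rho> \<circ> Transposition.transpose 3 4 \<circ> Transposition.transpose 1 2"
      using turn_power_neq[OF s, of k] unfolding t by (simp add: swap12_def swap34_def)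
    ultimately show ?thesis using permutes_same_edge[OF tT(2,3) eq] by blast
  qed
  obtain m n where mn: "(turn ^^ m) \<omega> = (t, \<rho>)" "(turn ^^ n) \<omega> = (t, \<rho>')" using mem by force
  have st: "(t, \<rho>) \<in> states" "(t, \<rho>') \<in> states"
    using turn_power_closed[OF \<omega>] mn by metis+
  show ?thesis
  proof (cases "m \<le> n")
    case True
    then have "(turn ^^ (n - m)) (t, \<rho>) = (t, \<rho>')"
      using mn by (metis funpow_add le_add_diff_inverse2 comp_apply)
    from step[OF st(1) this eq] show ?thesis .
  next
    case False
    then have "(turn ^^ (m - n)) (t, \<rho>') = (t, \<rho>)"
      using mn by (metis funpow_add le_add_diff_inverse2 nat_le_linear comp_apply)
    from step[OF st(2) this eq[symmetric]] show ?thesis ..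
  qed
qed

text \<open>An injective map of a finite set into itself is onto. This allows walking backwards
  without leaving the orbit.\<close>

lemma turn_orbit_pred:
  assumes "\<omega> \<in> states"
  shows "\<exists>\<omega>'\<in>range (\<lambda>n. (turn ^^ n) \<omega>). turn \<omega>' = (turn ^^ k) \<omega>"
proof -
  let ?O = "range (\<lambda>n. (turn ^^ n) \<omega>)"
  have sub: "?O \<subseteq> states" using turn_power_closed[OF assms] by blast
  have "turn ` ?O \<subseteq> ?O"
  proof (rule image_subsetI)
    fix \<nu> assume "\<nu> \<in> ?O"
    then obtain n where "\<nu> = (turn ^^ n) \<omega>" by blast
    then show "turn \<nu> \<in> ?O" by (intro range_eqI[of _ _ "Suc n"]) simp
  qed
  then have "turn ` ?O = ?O"
    by (intro endo_inj_surj finite_subset[OF sub finite_states] inj_on_subset[OF inj_turn sub])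
  then show ?thesis by (metis (no_types, lifting) imageE rangeI)
qed

text \<open>In the frame \<open>\<rho>\<close> carried by the walk, the ends of the edge keep the
  colours 1 and 2, while the other two corners have the colours 3 and 4, exchanged at every turn. As
  the orbit has even length, the parity of the number of turns is a function of the state.\<close>

lemma turn_orbit_colouring:
  assumes \<omega>: "\<omega> \<in> states" and ev: "even (card (range (\<lambda>n. (turn ^^ n) \<omega>)))"
  shows "\<exists>c. \<forall>(t, \<rho>) \<in> range (\<lambda>n. (turn ^^ n) \<omega>). c (t, \<rho>) permutes {1..4} \<and>
    c (turn (t, \<rho>)) = c (t, \<rho>) \<circ> inv' (gp t (\<rho> 3))"
proof -
  define s34 :: "nat \<Rightarrow> nat \<Rightarrow> nat" where "s34 k = (if even k then id else Transposition.transpose 3 4)" for k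
  define c where "c \<nu> = s34 (SOME k. (turn ^^ k) \<omega> = \<nu>) \<circ> inv' (snd \<nu>)" for \<nu>
  have c_eq: "c ((turn ^^ k) \<omega>) = s34 k \<circ> inv' (snd ((turn ^^ k) \<omega>))" for k
  proof -
    have "(turn ^^ (SOME l. (turn ^^ l) \<omega> = (turn ^^ k) \<omega>)) \<omega> = (turn ^^ k) \<omega>"
      by (rule someI[where x = k]) simp
    from funpow_eq_imp_parity[OF finite_states \<omega> turn_closed inj_turn ev this]
    show ?thesis by (simp add: c_def s34_def)
  qed
  show ?thesis
  proof (intro exI[of _ c] ballI)
    fix \<nu> assume "\<nu> \<in> range (\<lambda>n. (turn ^^ n) \<omega>)"
    then obtain n where "\<nu> = (turn ^^ n) \<omega>" by blast
    moreover obtain t \<rho> where \<nu>: "\<nu> = (t, \<rho>)" by (cases \<nu>)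
    ultimately have n: "(t, \<rho>) = (turn ^^ n) \<omega>" by simp
    have st: "(t, \<rho>) \<in> states" unfolding n by (rule turn_power_closed[OF \<omega>])
    then have t: "t \<in> T" "\<rho> permutes {1..4}" unfolding states_iff by blast+
    then have 3: "\<rho> 3 \<in> {1..4}" using permutes_in_1_4[of \<rho> 3] by simp
    note g = gp_permutes[OF t(1) 3]
    have c: "c (t, \<rho>) = s34 n \<circ> inv' \<rho>" using c_eq[of n] unfolding n[symmetric] by simp
    have s: "s34 n permutes {1..4}" unfolding s34_def using permutes_id transpose_permutes(2) by auto
    have "c (turn (t, \<rho>)) = s34 (Suc n) \<circ> inv' (gp t (\<rho> 3) \<circ> \<rho> \<circ> Transposition.transpose 3 4)"
      using c_eq[of "Suc n"] by (simp add: n[symmetric]) (simp add: turn_def cross_def swap34_def)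
    also have "inv' (gp t (\<rho> 3) \<circ> \<rho> \<circ> Transposition.transpose 3 4) = Transposition.transpose 3 4 \<circ> (inv' \<rho> \<circ> inv' (gp t (\<rho> 3)))"
      using permutes_bij[OF t(2)] permutes_bij[OF g]
      by (simp add: o_inv_distrib bij_comp inv_swap_id)
    \<comment> \<open>The transposition contributed by \<open>turn\<close> cancels against the
      change of parity in \<open>s34\<close>.\<close>
    also have "s34 (Suc n) \<circ> \<dots> = s34 n \<circ> inv' \<rho> \<circ> inv' (gp t (\<rho> 3))"
      by (auto simp: s34_def fun_eq_iff)
    finally show "case \<nu> of (t, \<rho>) \<Rightarrow> c (t, \<rho>) permutes {1..4} \<and>
        c (turn (t, \<rho>)) = c (t, \<rho>) \<circ> inv' (gp t (\<rho> 3))"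
      unfolding \<nu> prod.case c by (intro conjI permutes_compose permutes_inv t s)
  qed
qed

end

section \<open>Barycentric coordinates\<close>

text \<open>The value 0 outside 1..4 makes the coordinates of a point unique as functions.\<close>

definition bary :: "(nat \<Rightarrow> real) set" where
  "bary = {\<mu>. (\<forall>j\<in>{1..4}. 0 \<le> \<mu> j) \<and> (\<forall>j. j \<notin> {1..4} \<longrightarrow> \<mu> j = 0) \<and> sum \<mu> {1..4} = 1}"

definition bpoint :: "(nat \<Rightarrow> 'v::real_vector) \<Rightarrow> (nat \<Rightarrow> real) \<Rightarrow> 'v" where
  "bpoint c \<mu> = (\<Sum>j\<in>{1..4}. \<mu> j *\<^sub>R c j)"

definition vertex_coord :: "nat \<Rightarrow> nat \<Rightarrow> real" where
  "vertex_coord j = (\<lambda>i. if i = j then 1 else 0)"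

lemma sum_1_4: "sum f {1..4::nat} = f 1 + f 2 + f 3 + f 4"
  by (simp add: eval_nat_numeral)

lemma sum_permute_1_4:
  assumes "\<rho> permutes {1..4::nat}"
  shows "sum f {1..4} = f (\<rho> 1) + f (\<rho> 2) + f (\<rho> 3) + f (\<rho> 4)"
  using sum.permute[OF assms, of f] unfolding sum_1_4 by simp

lemma vertex_coord_bary: "j \<in> {1..4} \<Longrightarrow> vertex_coord j \<in> bary"
  by (auto simp: bary_def vertex_coord_def sum.delta)

lemma bpoint_vertex_coord:
  assumes "j \<in> {1..4}" shows "bpoint c (vertex_coord j) = c j"
proof -
  have "bpoint c (vertex_coord j) = (\<Sum>i\<in>{1..4}. if i = j then c i else 0)"
    unfolding bpoint_def vertex_coord_def by (rule sum.cong) auto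
  then show ?thesis using assms by (simp add: sum.delta)
qed

lemma bary_permute:
  assumes \<mu>: "\<mu> \<in> bary" and p: "p permutes {1..4}"
  shows "\<mu> \<circ> p \<in> bary"
proof -
  have "sum (\<mu> \<circ> p) {1..4} = sum \<mu> {1..4}"
    using sum.permute[OF p, of \<mu>] by simp
  then show ?thesis
    using \<mu> permutes_in_image[OF p] unfolding bary_def mem_Collect_eq o_def by metis
qed

text \<open>Relabelling corners by \<open>p\<close> moves the coordinate at \<open>j\<close> to
  \<open>p j\<close>, whence the inverse.\<close>

lemma bpoint_permute:
  assumes p: "p permutes {1..4}"
  shows "bpoint c (\<mu> \<circ> inv' p) = bpoint (c \<circ> p) \<mu>"
proof -
  have "bpoint c (\<mu> \<circ> inv' p) = (\<Sum>j\<in>{1..4}. \<mu> (inv' p (p j)) *\<^sub>R c (p j))"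
    unfolding bpoint_def using sum.permute[OF p, of "\<lambda>j. \<mu> (inv' p j) *\<^sub>R c j"] by (simp add: o_def)
  then show ?thesis
    using permutes_inj[OF p] by (simp add: bpoint_def o_def)
qed

section \<open>Affinely independent corners and their convex hulls\<close>

definition affinely_free :: "(nat \<Rightarrow> 'v::euclidean_space) \<Rightarrow> bool" where
  "affinely_free c \<longleftrightarrow> inj_on c {1..4} \<and> \<not> affine_dependent (c ` {1..4})"

lemma affinely_free_zero:
  assumes c: "affinely_free c" and k: "sum \<kappa> {1..4} = 0" "bpoint c \<kappa> = 0" and j: "j \<in> {1..4}"
  shows "\<kappa> j = 0"
proof (rule ccontr)
  assume nz: "\<kappa> j \<noteq> 0"
  have inj: "inj_on c {1..4}" using c by (simp add: affinely_free_def)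
  define U where "U x = \<kappa> (the_inv_into {1..4} c x)" for x
  have U: "U (c i) = \<kappa> i" if "i \<in> {1..4}" for i
    using the_inv_into_f_f[OF inj that] by (simp add: U_def)
  have "sum U (c ` {1..4}) = 0" "(\<Sum>v\<in>c ` {1..4}. U v *\<^sub>R v) = 0"
    using k sum.cong[OF refl U, of "{1..4}" "\<lambda>x. x"] sum.cong[of "{1..4}" "{1..4}" "\<lambda>i. U (c i) *\<^sub>R c i" "\<lambda>i. \<kappa> i *\<^sub>R c i"]
    unfolding sum.reindex[OF inj] o_def bpoint_def by (simp_all add: U del: atLeastAtMost_iff One_nat_def)
  moreover have "\<exists>v\<in>c ` {1..4}. U v \<noteq> 0" using U nz j by auto
  ultimately have "affine_dependent (c ` {1..4})"
    by (subst affine_dependent_explicit_finite) auto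
  then show False using c by (simp add: affinely_free_def)
qed

lemma bpoint_inj:
  assumes c: "affinely_free c" and "\<mu> \<in> bary" "\<nu> \<in> bary" "bpoint c \<mu> = bpoint c \<nu>"
  shows "\<mu> = \<nu>"
proof
  fix j
  show "\<mu> j = \<nu> j"
  proof (cases "j \<in> {1..4}")
    case True
    have "(\<lambda>i. \<mu> i - \<nu> i) j = 0"
      by (rule affinely_free_zero[OF c _ _ True])
        (use assms in \<open>simp_all add: bary_def bpoint_def sum_subtractf scaleR_left_diff_distrib\<close>)
    then show ?thesis by simp
  qed (use assms in \<open>auto simp: bary_def\<close>)
qed

text \<open>One statement for cells, faces and edges: \<open>J\<close> is the set of corners
  spanning the piece.\<close>

lemma convex_hull_corners:
  assumes inj: "inj_on c {1..4}" and J: "J \<subseteq> {1..4}"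
  shows "convex hull (c ` J) = bpoint c ` {\<mu> \<in> bary. \<forall>k\<in>{1..4} - J. \<mu> k = 0}"
proof -
  have fin: "finite J" using J finite_subset by blast
  have injJ: "inj_on c J" using inj J by (rule inj_on_subset)
  have split: "sum f {1..4} = sum f J" if "\<And>k. k \<in> {1..4} - J \<Longrightarrow> f k = 0" for f :: "nat \<Rightarrow> 'b::comm_monoid_add"
    using sum.mono_neutral_right[OF _ J, of f] that by auto
  show ?thesis
  proof (intro equalityI subsetI)
    fix x assume "x \<in> convex hull (c ` J)"
    then obtain u where u: "\<forall>x\<in>c ` J. 0 \<le> u x" "sum u (c ` J) = 1" "(\<Sum>x\<in>c ` J. u x *\<^sub>R x) = x"
      using convex_hull_finite[of "c ` J"] fin by blast
    define \<mu> where "\<mu> j = (if j \<in> J then u (c j) else 0)" for j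
    have "sum \<mu> {1..4} = sum u (c ` J)"
      by (subst split) (auto simp: \<mu>_def sum.reindex[OF injJ] intro: sum.cong)
    moreover have "bpoint c \<mu> = x"
      unfolding bpoint_def u(3)[symmetric]
      by (subst split) (auto simp: \<mu>_def sum.reindex[OF injJ] intro: sum.cong)
    ultimately show "x \<in> bpoint c ` {\<mu> \<in> bary. \<forall>k\<in>{1..4} - J. \<mu> k = 0}"
      using u(1,2) J by (intro image_eqI[of _ _ \<mu>]) (auto simp: bary_def \<mu>_def)
  next
    fix x assume "x \<in> bpoint c ` {\<mu> \<in> bary. \<forall>k\<in>{1..4} - J. \<mu> k = 0}"
    then obtain \<mu> where \<mu>: "\<mu> \<in> bary" "\<And>k. k \<in> {1..4} - J \<Longrightarrow> \<mu> k = 0" "x = bpoint c \<mu>" by blast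
    have "sum \<mu> J = 1" using split[of \<mu>] \<mu> by (simp add: bary_def)
    moreover have "x = (\<Sum>j\<in>J. \<mu> j *\<^sub>R c j)" unfolding \<mu>(3) bpoint_def by (rule split) (simp add: \<mu>(2))
    ultimately show "x \<in> convex hull (c ` J)"
      using \<mu>(1) J
      by (simp only:) (rule convex_sum[OF fin convex_convex_hull], auto simp: bary_def intro: hull_inc)
  qed
qed

text \<open>All points of \<open>C'\<close> are extreme in the target hull, so they lie in the image
  of \<open>C\<close>, which also spans it; counting leaves no room for others.\<close>

lemma affine_bij_convex_hull:
  fixes f :: "'v::euclidean_space \<Rightarrow> 'v"
  assumes f: "linear L" "\<And>x. x \<in> convex hull C \<Longrightarrow> f x = L x + b"
    and bij: "f ` (convex hull C) = convex hull C'"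
    and C: "finite C" "card C \<le> card C'" "\<not> affine_dependent C'"
  shows "f ` C = C'"
proof -
  have "f ` (convex hull C) = (\<lambda>x. b + x) ` L ` (convex hull C)"
    unfolding image_image using f(2) by (intro image_cong) (auto simp: add.commute)
  also have "\<dots> = convex hull ((\<lambda>x. b + x) ` L ` C)"
    by (simp only: convex_hull_linear_image[OF f(1)] convex_hull_translation)
  also have "(\<lambda>x. b + x) ` L ` C = f ` C"
    unfolding image_image using f(2) hull_inc by (intro image_cong) (auto simp: add.commute hull_inc)
  finally have "convex hull (f ` C) = convex hull C'" using bij by simp
  then have "C' \<subseteq> f ` C"
    using extreme_point_of_convex_hull_affine_independent[OF C(3)] extreme_point_of_convex_hull[of _ "f ` C"]
    by (auto simp: subset_iff)
  moreover have "card (f ` C) \<le> card C'" using card_image_le[OF C(1), of f] C(2) by simp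
  ultimately show ?thesis
    using C(1) by (metis card_seteq finite_imageI)
qed

text \<open>Six times the signed volume of the tetrahedron \<open>p q a b\<close>.\<close>

definition vol :: "real^3 \<Rightarrow> real^3 \<Rightarrow> real^3 \<Rightarrow> real^3 \<Rightarrow> real" where
  "vol p q a b = det (vector [q - p, a - p, b - p] :: real^3^3)"

lemma det_vector_3:
  "det (vector [u, v, w] :: real^3^3) =
     u$1 * v$2 * w$3 + u$2 * v$3 * w$1 + u$3 * v$1 * w$2 - u$1 * v$3 * w$2 - u$2 * v$1 * w$3 - u$3 * v$2 * w$1"
  by (simp add: det_3 vector_3)

lemma vol_swap: "vol q p a b = - vol p q a b" "vol p q b a = - vol p q a b"
  by (simp_all add: vol_def det_vector_3 algebra_simps)

lemma affinely_free_vol: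
  fixes c :: "nat \<Rightarrow> real^3"
  assumes c: "affinely_free c" and \<rho>: "\<rho> permutes {1..4}"
  shows "vol (c (\<rho> 1)) (c (\<rho> 2)) (c (\<rho> 3)) (c (\<rho> 4)) \<noteq> 0"
proof -
  let ?A = "vector [c (\<rho> 2) - c (\<rho> 1), c (\<rho> 3) - c (\<rho> 1), c (\<rho> 4) - c (\<rho> 1)] :: real^3^3"
  have "\<forall>i. k i = 0" if k: "(\<Sum>i\<in>UNIV. k i *s row i ?A) = 0" for k
  proof -
    have k0: "k 1 *\<^sub>R (c (\<rho> 2) - c (\<rho> 1)) + k 2 *\<^sub>R (c (\<rho> 3) - c (\<rho> 1)) + k 3 *\<^sub>R (c (\<rho> 4) - c (\<rho> 1)) = 0"
      using k by (simp add: sum_3 row_def scalar_mult_eq_scaleR vec_eq_iff)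
    have neq: "\<rho> i = \<rho> j \<longleftrightarrow> i = j" for i j
      using permutes_inj[OF \<rho>] by (auto dest: injD)
    \<comment> \<open>A linear relation among the edge vectors at \<open>c (\<rho> 1)\<close>
      becomes an affine relation among the corners; the coefficient of \<open>\<rho> 1\<close> is
      chosen to make the sum zero.\<close>
    define \<kappa> where "\<kappa> j = (if j = \<rho> 1 then - (k 1 + k 2 + k 3) else if j = \<rho> 2 then k 1
      else if j = \<rho> 3 then k 2 else if j = \<rho> 4 then k 3 else 0)" for j
    have \<kappa>: "\<kappa> (\<rho> 1) = - (k 1 + k 2 + k 3)" "\<kappa> (\<rho> 2) = k 1" "\<kappa> (\<rho> 3) = k 2" "\<kappa> (\<rho> 4) = k 3"
      by (simp_all add: \<kappa>_def neq)
    have "sum \<kappa> {1..4} = 0" unfolding sum_permute_1_4[OF \<rho>] \<kappa> by simp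
    moreover have "bpoint c \<kappa> = 0"
      unfolding bpoint_def sum_permute_1_4[OF \<rho>] \<kappa> k0[symmetric] by (simp add: algebra_simps)
    ultimately have "\<kappa> (\<rho> j) = 0" if "j \<in> {1..4}" for j
      using affinely_free_zero[OF c] permutes_in_image[OF \<rho>, of j] that by blast
    from this[of 2] this[of 3] this[of 4] show ?thesis by (simp add: \<kappa> forall_3)
  qed
  then have "\<exists>B. ?A ** B = mat 1" unfolding matrix_right_invertible_independent_rows by blast
  then have "invertible ?A" unfolding invertible_def using matrix_left_right_inverse by blast
  then show ?thesis by (simp add: vol_def invertible_det_nz)
qed

lemma interior_convex_hull_corners:
  fixes c :: "nat \<Rightarrow> real^3"
  assumes c: "affinely_free c"
  shows "interior (convex hull (c ` {1..4})) = bpoint c ` {\<mu> \<in> bary. \<forall>j\<in>{1..4}. 0 < \<mu> j}"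
proof -
  have inj: "inj_on c {1..4}" and nd: "\<not> affine_dependent (c ` {1..4})"
    using c by (auto simp: affinely_free_def)
  have card: "\<not> card (c ` {1..4}) \<le> DIM(real^3)" using inj by (simp add: card_image)
  show ?thesis
    unfolding interior_convex_hull_explicit_minimal[OF nd] if_not_P[OF card]
  proof (intro equalityI subsetI)
    fix x assume "x \<in> {y. \<exists>u. (\<forall>x\<in>c ` {1..4}. 0 < u x) \<and> sum u (c ` {1..4}) = 1 \<and> (\<Sum>x\<in>c ` {1..4}. u x *\<^sub>R x) = y}"
    then obtain u where u: "\<forall>x\<in>c ` {1..4}. 0 < u x" "sum u (c ` {1..4}) = 1" "(\<Sum>x\<in>c ` {1..4}. u x *\<^sub>R x) = x"
      by blast
    define \<mu> where "\<mu> j = (if j \<in> {1..4} then u (c j) else 0)" for j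
    have "sum \<mu> {1..4} = sum u (c ` {1..4})"
      unfolding sum.reindex[OF inj] by (rule sum.cong) (auto simp: \<mu>_def)
    moreover have "bpoint c \<mu> = x"
      unfolding bpoint_def u(3)[symmetric] sum.reindex[OF inj] by (rule sum.cong) (auto simp: \<mu>_def)
    ultimately show "x \<in> bpoint c ` {\<mu> \<in> bary. \<forall>j\<in>{1..4}. 0 < \<mu> j}"
      using u(1,2) by (intro image_eqI[of _ _ \<mu>]) (auto simp: bary_def \<mu>_def intro: less_imp_le)
  next
    fix x assume "x \<in> bpoint c ` {\<mu> \<in> bary. \<forall>j\<in>{1..4}. 0 < \<mu> j}"
    then obtain \<mu> where \<mu>: "\<mu> \<in> bary" "\<forall>j\<in>{1..4}. 0 < \<mu> j" "x = bpoint c \<mu>" by blast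
    define u where "u x = \<mu> (the_inv_into {1..4} c x)" for x
    have u: "u (c j) = \<mu> j" if "j \<in> {1..4}" for j
      using the_inv_into_f_f[OF inj that] by (simp add: u_def)
    have "sum u (c ` {1..4}) = 1"
      using \<mu>(1) u unfolding sum.reindex[OF inj] o_def bary_def sum_1_4 by simp
    moreover have "(\<Sum>x\<in>c ` {1..4}. u x *\<^sub>R x) = x"
      unfolding sum.reindex[OF inj] o_def \<mu>(3) bpoint_def by (rule sum.cong) (auto simp: u)
    moreover have "\<forall>x\<in>c ` {1..4}. 0 < u x" using \<mu>(2) u by auto
    ultimately show "x \<in> {y. \<exists>u. (\<forall>x\<in>c ` {1..4}. 0 < u x) \<and> sum u (c ` {1..4}) = 1 \<and> (\<Sum>x\<in>c ` {1..4}. u x *\<^sub>R x) = y}"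
      by blast
  qed
qed

text \<open>Expand the first row in the edge vectors at \<open>c (\<rho> 1)\<close>. Modulo the
  other two rows only its component \<open>- \<mu> (\<rho> 3)\<close> along \<open>v\<close>
  survives, and one exchange of rows turns the sign.\<close>

lemma det_bpoint:
  fixes c :: "nat \<Rightarrow> real^3"
  assumes \<rho>: "\<rho> permutes {1..4}" and \<mu>: "\<mu> \<in> bary"
  shows "det (vector [c (\<rho> 1) - bpoint c \<mu>, c (\<rho> 2) - c (\<rho> 1), c (\<rho> 4) - c (\<rho> 1)] :: real^3^3) =
    \<mu> (\<rho> 3) * vol (c (\<rho> 1)) (c (\<rho> 2)) (c (\<rho> 3)) (c (\<rho> 4))"
proof -
  define u v w where "u = c (\<rho> 2) - c (\<rho> 1)" and "v = c (\<rho> 3) - c (\<rho> 1)" and "w = c (\<rho> 4) - c (\<rho> 1)"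
  have 1: "\<mu> (\<rho> 1) = 1 - \<mu> (\<rho> 2) - \<mu> (\<rho> 3) - \<mu> (\<rho> 4)"
    using \<mu> sum_permute_1_4[OF \<rho>, of \<mu>] unfolding bary_def by auto
  have "c (\<rho> 1) - bpoint c \<mu> = - (\<mu> (\<rho> 2) *\<^sub>R u + \<mu> (\<rho> 3) *\<^sub>R v + \<mu> (\<rho> 4) *\<^sub>R w)"
    unfolding bpoint_def sum_permute_1_4[OF \<rho>] 1 u_def v_def w_def by (simp add: algebra_simps)
  then have "det (vector [c (\<rho> 1) - bpoint c \<mu>, u, w] :: real^3^3)
      = det (vector [- (\<mu> (\<rho> 2) *\<^sub>R u + \<mu> (\<rho> 3) *\<^sub>R v + \<mu> (\<rho> 4) *\<^sub>R w), u, w] :: real^3^3)"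
    by simp
  also have "\<dots> = \<mu> (\<rho> 3) * det (vector [u, v, w] :: real^3^3)"
    by (simp add: det_vector_3 algebra_simps)
  finally show ?thesis by (simp only: vol_def u_def v_def w_def)
qed

text \<open>By \<open>det_bpoint\<close> the determinant is the volume times
  \<open>\<mu> (\<rho> 3)\<close>, which is positive at every interior point, so the sign is the
  same for all of them.\<close>

lemma boundary_positive_iff:
  fixes c :: "nat \<Rightarrow> real^3"
  assumes c: "affinely_free c" and \<rho>: "\<rho> permutes {1..4}" and S: "S = convex hull (c ` {1..4})"
  shows "boundary_positive S \<epsilon> (c (\<rho> 1)) (c (\<rho> 2)) (c (\<rho> 4)) \<longleftrightarrow>
    \<epsilon> * vol (c (\<rho> 1)) (c (\<rho> 2)) (c (\<rho> 3)) (c (\<rho> 4)) > 0"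
proof -
  let ?I = "{\<mu> \<in> bary. \<forall>j\<in>{1..4}. 0 < \<mu> j}"
  have "\<rho> 3 \<in> {1..4}" using permutes_in_image[OF \<rho>, of 3] by simp
  then have pos: "0 < \<mu> (\<rho> 3)" if "\<mu> \<in> ?I" for \<mu> using that by blast
  \<comment> \<open>The barycentre, so that the quantifier over interior points is not
    vacuous.\<close>
  have "(\<lambda>j. if j \<in> {1..4} then 1 / 4 else 0) \<in> ?I"
    by (auto simp: bary_def)
  then obtain \<nu> where \<nu>: "\<nu> \<in> ?I" by blast
  have "boundary_positive S \<epsilon> (c (\<rho> 1)) (c (\<rho> 2)) (c (\<rho> 4)) \<longleftrightarrow>
      (\<forall>\<mu>\<in>?I. \<epsilon> * (\<mu> (\<rho> 3) * vol (c (\<rho> 1)) (c (\<rho> 2)) (c (\<rho> 3)) (c (\<rho> 4))) > 0)"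
    unfolding boundary_positive_def S interior_convex_hull_corners[OF c] ball_simps(9)
    using det_bpoint[OF \<rho>] by auto
  also have "\<dots> \<longleftrightarrow> (\<forall>\<mu>\<in>?I. \<epsilon> * vol (c (\<rho> 1)) (c (\<rho> 2)) (c (\<rho> 3)) (c (\<rho> 4)) > 0)"
  proof (intro ball_cong refl)
    fix \<mu> assume "\<mu> \<in> ?I"
    from pos[OF this] show "\<epsilon> * (\<mu> (\<rho> 3) * vol (c (\<rho> 1)) (c (\<rho> 2)) (c (\<rho> 3)) (c (\<rho> 4))) > 0 \<longleftrightarrow>
        \<epsilon> * vol (c (\<rho> 1)) (c (\<rho> 2)) (c (\<rho> 3)) (c (\<rho> 4)) > 0"
      by (metis mult.left_commute mult_pos_pos zero_less_mult_pos)
  qed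
  also have "\<dots> \<longleftrightarrow> \<epsilon> * vol (c (\<rho> 1)) (c (\<rho> 2)) (c (\<rho> 3)) (c (\<rho> 4)) > 0"
    using \<nu> by blast
  finally show ?thesis .
qed

section \<open>Face pairings of a triangulation\<close>

definition corner :: "('t, 'a) triangulation_data \<Rightarrow> 't \<Rightarrow> nat \<Rightarrow> real^3" where
  "corner \<T> t = (SOME c. affinely_free c \<and> cell \<T> t = convex hull (c ` {1..4}))"

definition face :: "('t, 'a) triangulation_data \<Rightarrow> 't \<Rightarrow> nat \<Rightarrow> (real^3) set" where
  "face \<T> t i = convex hull (corner \<T> t ` ({1..4} - {i}))"

text \<open>The gluing of the face opposite to corner \<open>i\<close> of \<open>t\<close>, extended to a permutation of the
  corner labels by matching the two opposite corners.\<close>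

definition nbr :: "('t, 'a) triangulation_data \<Rightarrow> 't \<Rightarrow> nat \<Rightarrow> 't \<times> (nat \<Rightarrow> nat)" where
  "nbr \<T> t i = (SOME (t', p). t' \<in> tets \<T> \<and> p permutes {1..4} \<and>
     partner \<T> (t, face \<T> t i) = (t', face \<T> t' (p i)) \<and>
     (\<forall>\<mu>\<in>bary. \<mu> i = 0 \<longrightarrow>
        glue \<T> (t, face \<T> t i) (bpoint (corner \<T> t) \<mu>) = bpoint (corner \<T> t') (\<mu> \<circ> inv' p)))"

locale triangulated =
  fixes X :: "'a topology" and \<T> :: "('t, 'a) triangulation_data"
  assumes sing: "singular_triangulation X \<T>"
begin

abbreviation "T \<equiv> tets \<T>"
abbreviation "cr \<equiv> corner \<T>"
abbreviation "nb t i \<equiv> fst (nbr \<T> t i)"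
abbreviation "gp t i \<equiv> snd (nbr \<T> t i)"

lemma corner:
  assumes "t \<in> T"
  shows "affinely_free (cr t)" "cell \<T> t = convex hull (cr t ` {1..4})"
proof -
  have "3 simplex cell \<T> t" using sing assms by (auto simp: singular_triangulation_def)
  then obtain C where C: "finite C" "\<not> affine_dependent C" "card C = 4" "cell \<T> t = convex hull C"
    unfolding simplex by force
  have "card {1..4::nat} = card C" using C by simp
  then obtain c where "bij_betw c {1..4::nat} C"
    using C(1) finite_same_card_bij[of "{1..4::nat}" C] by blast
  then have "affinely_free c \<and> cell \<T> t = convex hull (c ` {1..4})"
    using C by (simp add: bij_betw_def affinely_free_def)
  from someI[of "\<lambda>c. affinely_free c \<and> cell \<T> t = convex hull (c ` {1..4})", OF this]
  show "affinely_free (cr t)" "cell \<T> t = convex hull (cr t ` {1..4})"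
    by (auto simp: corner_def)
qed

lemma corner_inj: "t \<in> T \<Longrightarrow> inj_on (cr t) {1..4}"
  and corner_indep: "t \<in> T \<Longrightarrow> \<not> affine_dependent (cr t ` {1..4})"
  using corner by (auto simp: affinely_free_def)

lemma orient_cases: "t \<in> T \<Longrightarrow> orient \<T> t \<in> {-1, 1}"
  using sing by (auto simp: singular_triangulation_def)

lemma cell_eq: "t \<in> T \<Longrightarrow> cell \<T> t = bpoint (cr t) ` bary"
  using convex_hull_corners[OF corner_inj, of t "{1..4}"] corner(2) by simp

lemma face_eq: "t \<in> T \<Longrightarrow> i \<in> {1..4} \<Longrightarrow> face \<T> t i = bpoint (cr t) ` {\<mu> \<in> bary. \<mu> i = 0}"
  unfolding face_def by (subst convex_hull_corners[OF corner_inj]) auto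

lemma bp_inj: "t \<in> T \<Longrightarrow> \<mu> \<in> bary \<Longrightarrow> \<nu> \<in> bary \<Longrightarrow> bpoint (cr t) \<mu> = bpoint (cr t) \<nu> \<longleftrightarrow> \<mu> = \<nu>"
  using bpoint_inj[OF corner(1)] by blast

lemma face_eq_iff:
  assumes "t \<in> T" "i \<in> {1..4}" "j \<in> {1..4}"
  shows "face \<T> t i = face \<T> t j \<longleftrightarrow> i = j"
proof
  assume eq: "face \<T> t i = face \<T> t j"
  show "i = j"
  proof (rule ccontr)
    assume "i \<noteq> j"
    then have "bpoint (cr t) (vertex_coord i) \<in> face \<T> t j"
      using assms vertex_coord_bary face_eq by (auto simp: vertex_coord_def)
    then have "bpoint (cr t) (vertex_coord i) \<in> face \<T> t i" using eq by simp
    then obtain \<mu> where "\<mu> \<in> bary" "\<mu> i = 0" "bpoint (cr t) (vertex_coord i) = bpoint (cr t) \<mu>"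
      unfolding face_eq[OF assms(1,2)] by blast
    then have "vertex_coord i i = 0" using bp_inj assms(1,2) vertex_coord_bary by metis
    then show False by (simp add: vertex_coord_def)
  qed
qed simp

lemma faces2_eq: "faces2 \<T> = {(t, face \<T> t i) |t i. t \<in> T \<and> i \<in> {1..4}}"
proof -
  have "F facet_of cell \<T> t \<longleftrightarrow> (\<exists>i\<in>{1..4}. F = face \<T> t i)" if "t \<in> T" for t F
  proof -
    have "cr t ` {1..4} - {cr t i} = cr t ` ({1..4} - {i})" if "i \<in> {1..4}" for i
      using inj_on_image_set_diff[OF corner_inj[OF \<open>t \<in> T\<close>], of "{1..4}" "{i}"] that by simp
    moreover have "card (cr t ` {1..4}) = 4" using corner_inj[OF that] by (simp add: card_image)
    ultimately show ?thesis
      unfolding corner(2)[OF that] facet_of_convex_hull_affine_independent_alt[OF corner_indep[OF that]] face_def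
      by auto
  qed
  then show ?thesis unfolding faces2_def by blast
qed

lemma face_in_faces2: "t \<in> T \<Longrightarrow> i \<in> {1..4} \<Longrightarrow> (t, face \<T> t i) \<in> faces2 \<T>"
  by (auto simp: faces2_eq)

text \<open>An affine isomorphism of faces sends corners to corners, and therefore only permutes
  barycentric coordinates. This is the existence behind the choice in \<open>nbr\<close>.\<close>

lemma nbr:
  assumes t: "t \<in> T" and i: "i \<in> {1..4}"
  shows "nb t i \<in> T" "gp t i permutes {1..4}"
    "partner \<T> (t, face \<T> t i) = (nb t i, face \<T> (nb t i) (gp t i i))"
    "\<mu> \<in> bary \<Longrightarrow> \<mu> i = 0 \<Longrightarrow> glue \<T> (t, face \<T> t i) (bpoint (cr t) \<mu>)
       = bpoint (cr (nb t i)) (\<mu> \<circ> inv' (gp t i))"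
proof -
  let ?P = "\<lambda>(t', p). t' \<in> tets \<T> \<and> p permutes {1..4} \<and>
     partner \<T> (t, face \<T> t i) = (t', face \<T> t' (p i)) \<and>
     (\<forall>\<mu>\<in>bary. \<mu> i = 0 \<longrightarrow>
        glue \<T> (t, face \<T> t i) (bpoint (corner \<T> t) \<mu>) = bpoint (corner \<T> t') (\<mu> \<circ> inv' p))"
  have "\<exists>q. ?P q"
  proof -
    have "partner \<T> (t, face \<T> t i) \<in> faces2 \<T>"
      using sing face_in_faces2[OF t i] by (auto simp: singular_triangulation_def)
    then obtain t' i' where t': "t' \<in> T" "i' \<in> {1..4}" "partner \<T> (t, face \<T> t i) = (t', face \<T> t' i')"
      unfolding faces2_eq by blast
    define f where "f = glue \<T> (t, face \<T> t i)"
    have "affine_iso (face \<T> t i) (face \<T> t' i') f"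
      using sing face_in_faces2[OF t i] t'(3) unfolding singular_triangulation_def f_def by blast
    then obtain L b where L: "linear L" "\<And>x. x \<in> face \<T> t i \<Longrightarrow> f x = L x + b"
      and bij: "bij_betw f (face \<T> t i) (face \<T> t' i')"
      unfolding affine_iso_def by blast
    let ?J = "{1..4} - {i}" and ?J' = "{1..4} - {i'}"
    have sub: "cr t ` ?J \<subseteq> face \<T> t i" unfolding face_def by (rule hull_subset)
    have inj: "inj_on (cr t) ?J" "inj_on (cr t') ?J'"
      using corner_inj[OF t] corner_inj[OF t'(1)] by (auto intro: inj_on_subset)
    have card: "card (cr t ` ?J) = 3" "card (cr t' ` ?J') = 3"
      using inj i t'(2) by (simp_all add: card_image)
    have "f ` (cr t ` ?J) = cr t' ` ?J'"
    proof (rule affine_bij_convex_hull[OF L(1)])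
      show "f ` (convex hull cr t ` ?J) = convex hull cr t' ` ?J'"
        using bij by (simp add: bij_betw_def face_def)
      show "\<not> affine_dependent (cr t' ` ?J')"
        by (rule affine_independent_subset[OF corner_indep[OF t'(1)]]) blast
    qed (use L(2) card in \<open>auto simp: face_def\<close>)
    moreover have "inj_on f (cr t ` ?J)"
      using bij sub unfolding bij_betw_def by (blast intro: inj_on_subset)
    ultimately have bijf: "bij_betw (f \<circ> cr t) ?J (cr t' ` ?J')"
      using inj by (auto simp: bij_betw_def comp_inj_on image_comp)
    define q where "q = the_inv_into ?J' (cr t') \<circ> (f \<circ> cr t)"
    have bq: "bij_betw q ?J ?J'"
      unfolding q_def
      by (rule bij_betw_trans[OF bijf bij_betw_the_inv_into]) (use inj in \<open>simp add: bij_betw_def\<close>)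
    have q: "cr t' (q j) = f (cr t j)" if "j \<in> ?J" for j
    proof -
      have "f (cr t j) \<in> cr t' ` ?J'" using bij_betwE[OF bijf] that by simp
      then show ?thesis using f_the_inv_into_f[OF inj(2)] by (simp add: q_def)
    qed
    \<comment> \<open>The labels \<open>i\<close> and \<open>i'\<close> of the opposite corners are
      matched with each other; outside 1..4 the identity, as \<open>permutes\<close>
      demands.\<close>
    define p where "p j = (if j = i then i' else if j \<in> {1..4} then q j else j)" for j
    have bp: "bij_betw p {1..4} {1..4}"
    proof -
      have "bij_betw p ?J ?J'"
        by (rule bij_betw_cong[THEN iffD1, OF _ bq]) (auto simp: p_def)
      moreover have "bij_betw p {i} {i'}" by (simp add: p_def)
      ultimately have "bij_betw p (?J \<union> {i}) (?J' \<union> {i'})"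
        by (rule bij_betw_combine) auto
      moreover have "?J \<union> {i} = {1..4}" "?J' \<union> {i'} = {1..4}" using i t'(2) by auto
      ultimately show ?thesis by simp
    qed
    have perm: "p permutes {1..4}"
      by (rule bij_imp_permutes[OF bp]) (use i in \<open>auto simp: p_def\<close>)
    have "f (bpoint (cr t) \<mu>) = bpoint (cr t') (\<mu> \<circ> inv' p)" if \<mu>: "\<mu> \<in> bary" "\<mu> i = 0" for \<mu>
    proof -
      have s1: "sum \<mu> {1..4} = 1" using \<mu> by (simp add: bary_def)
      have "f (bpoint (cr t) \<mu>) = L (bpoint (cr t) \<mu>) + b"
        using \<mu> face_eq[OF t i] by (intro L(2)) blast
      \<comment> \<open>The translation \<open>b\<close> is distributed over the corners with
        weights of total 1.\<close>
      also have "\<dots> = (\<Sum>j\<in>{1..4}. \<mu> j *\<^sub>R L (cr t j)) + (\<Sum>j\<in>{1..4}. \<mu> j) *\<^sub>R b"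
        unfolding bpoint_def s1 by (simp add: linear_sum[OF L(1)] linear_cmul[OF L(1)])
      also have "\<dots> = (\<Sum>j\<in>{1..4}. \<mu> j *\<^sub>R (L (cr t j) + b))"
        by (simp add: scaleR_sum_left scaleR_right_distrib sum.distrib)
      also have "\<dots> = bpoint (cr t' \<circ> p) \<mu>"
        unfolding bpoint_def
      proof (rule sum.cong[OF refl])
        fix j assume j: "j \<in> {1..4::nat}"
        show "\<mu> j *\<^sub>R (L (cr t j) + b) = \<mu> j *\<^sub>R (cr t' \<circ> p) j"
        proof (cases "j = i")
          case False
          then have "L (cr t j) + b = cr t' (p j)"
            using L(2)[of "cr t j", symmetric] subsetD[OF sub imageI, of j] q[of j] j by (simp add: p_def)
          then show ?thesis by simp
        qed (use \<mu> in simp)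
      qed
      also have "\<dots> = bpoint (cr t') (\<mu> \<circ> inv' p)" by (rule bpoint_permute[OF perm, symmetric])
      finally show ?thesis .
    qed
    then have "?P (t', p)" using t' perm by (simp add: f_def p_def)
    then show ?thesis ..
  qed
  then have P: "?P (nbr \<T> t i)" unfolding nbr_def by (rule someI_ex)
  show "nb t i \<in> T" "gp t i permutes {1..4}"
    "partner \<T> (t, face \<T> t i) = (nb t i, face \<T> (nb t i) (gp t i i))"
    "\<mu> \<in> bary \<Longrightarrow> \<mu> i = 0 \<Longrightarrow> glue \<T> (t, face \<T> t i) (bpoint (cr t) \<mu>)
       = bpoint (cr (nb t i)) (\<mu> \<circ> inv' (gp t i))"
    using P by (auto simp: case_prod_beta)
qed

lemma gp_in: "t \<in> T \<Longrightarrow> i \<in> {1..4} \<Longrightarrow> j \<in> {1..4} \<Longrightarrow> gp t i j \<in> {1..4}"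
  using permutes_in_image[OF nbr(2)] by blast

lemma vertex_coord_permute:
  assumes "p permutes {1..4::nat}"
  shows "vertex_coord j \<circ> inv' p = vertex_coord (p j)"
  using permutes_inverses[OF assms] by (fastforce simp: vertex_coord_def fun_eq_iff)

lemma glue_corner:
  assumes "t \<in> T" "i \<in> {1..4}" "j \<in> {1..4}" "j \<noteq> i"
  shows "glue \<T> (t, face \<T> t i) (cr t j) = cr (nb t i) (gp t i j)"
proof -
  have "glue \<T> (t, face \<T> t i) (bpoint (cr t) (vertex_coord j))
      = bpoint (cr (nb t i)) (vertex_coord j \<circ> inv' (gp t i))"
    using assms by (intro nbr(4) vertex_coord_bary) (auto simp: vertex_coord_def)
  then show ?thesis
    unfolding vertex_coord_permute[OF nbr(2)[OF assms(1,2)]]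
    using assms gp_in by (simp add: bpoint_vertex_coord)
qed

text \<open>The partner map is an involution and a face determines its label, which settles the
  opposite corner. The other corners are compared through the two gluing maps, inverse to each
  other.\<close>

lemma nbr_nbr:
  assumes t: "t \<in> T" and i: "i \<in> {1..4}"
  shows "nb (nb t i) (gp t i i) = t" "gp (nb t i) (gp t i i) = inv' (gp t i)"
proof -
  let ?t' = "nb t i" and ?i' = "gp t i i"
  have t': "?t' \<in> T" "?i' \<in> {1..4}" using nbr(1)[OF t i] gp_in[OF t i i] by auto
  have "partner \<T> (partner \<T> (t, face \<T> t i)) = (t, face \<T> t i)"
    using sing face_in_faces2[OF t i] by (auto simp: singular_triangulation_def)
  then have p: "partner \<T> (?t', face \<T> ?t' ?i') = (t, face \<T> t i)" by (simp add: nbr(3)[OF t i])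
  then show nbnb: "nb ?t' ?i' = t" using nbr(3)[OF t'] by simp
  have "face \<T> t (gp ?t' ?i' ?i') = face \<T> t i" using p nbr(3)[OF t'] nbnb by simp
  then have ii: "gp ?t' ?i' ?i' = i"
    using face_eq_iff[OF t] gp_in[OF t' t'(2)] i by blast
  have gpgp: "gp ?t' ?i' (gp t i j) = j" if j: "j \<in> {1..4}" for j
  proof (cases "j = i")
    case False
    have "gp t i j \<noteq> ?i'" using permutes_inj[OF nbr(2)[OF t i]] False by (auto dest: injD)
    then have "glue \<T> (?t', face \<T> ?t' ?i') (cr ?t' (gp t i j)) = cr t (gp ?t' ?i' (gp t i j))"
      using glue_corner[OF t' gp_in[OF t i j]] nbnb by simp
    moreover have "glue \<T> (?t', face \<T> ?t' ?i') (glue \<T> (t, face \<T> t i) (cr t j)) = cr t j"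
    proof -
      have "cr t j \<in> face \<T> t i" unfolding face_def using j False by (intro hull_inc) auto
      then show ?thesis
        using sing face_in_faces2[OF t i] nbr(3)[OF t i] unfolding singular_triangulation_def by blast
    qed
    ultimately have "cr t (gp ?t' ?i' (gp t i j)) = cr t j"
      using glue_corner[OF t i j False] by simp
    then show ?thesis
      using corner_inj[OF t] gp_in[OF t' gp_in[OF t i j]] j by (auto dest: inj_onD)
  qed (simp add: ii)
  show "gp ?t' ?i' = inv' (gp t i)"
  proof
    fix j
    show "gp ?t' ?i' j = inv' (gp t i) j"
    proof (cases "j \<in> {1..4}")
      case True
      then have "inv' (gp t i) j \<in> {1..4}"
        using permutes_in_image[OF permutes_inv[OF nbr(2)[OF t i]]] by blast
      from gpgp[OF this] show ?thesis
        using permutes_inverses(1)[OF nbr(2)[OF t i]] by simp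
    next
      case False
      then show ?thesis
        using permutes_not_in[OF nbr(2)[OF t'] False]
          permutes_not_in[OF permutes_inv[OF nbr(2)[OF t i]] False] by simp
    qed
  qed
qed

lemma nbr_neq: "t \<in> T \<Longrightarrow> i \<in> {1..4} \<Longrightarrow> (nb t i, gp t i i) \<noteq> (t, i)"
  using nbr(3)[of t i] sing face_in_faces2[of t i] by (auto simp: singular_triangulation_def)

definition pos :: "'t \<Rightarrow> (nat \<Rightarrow> nat) \<Rightarrow> bool" where
  "pos t \<rho> \<longleftrightarrow> orient \<T> t * vol (cr t (\<rho> 1)) (cr t (\<rho> 2)) (cr t (\<rho> 3)) (cr t (\<rho> 4)) > 0"

lemma orient_vol_nonzero:
  "t \<in> T \<Longrightarrow> \<rho> permutes {1..4} \<Longrightarrow>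
    orient \<T> t * vol (cr t (\<rho> 1)) (cr t (\<rho> 2)) (cr t (\<rho> 3)) (cr t (\<rho> 4)) \<noteq> 0"
  using orient_cases affinely_free_vol[OF corner(1)] by fastforce

text \<open>The orientation condition is tested on the corners 1, 2, 4 of the frame, which span the
  face opposite to the third. \<open>boundary_positive_iff\<close> reads it as a statement on
  volumes on both sides, since \<open>gp\<close> matches the two opposite corners.\<close>

lemma pos_nbr:
  assumes t: "t \<in> T" and \<rho>: "\<rho> permutes {1..4}"
  shows "pos (nb t (\<rho> 3)) (gp t (\<rho> 3) \<circ> \<rho>) \<longleftrightarrow> \<not> pos t \<rho>"
proof -
  have in14: "\<rho> j \<in> {1..4}" if "j \<in> {1..4}" for j using permutes_in_image[OF \<rho>] that by blast
  have \<rho>j: "\<rho> 1 \<in> {1..4}" "\<rho> 2 \<in> {1..4}" "\<rho> 3 \<in> {1..4}" "\<rho> 4 \<in> {1..4}" by (rule in14; simp)+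
  have neq: "\<rho> i = \<rho> j \<longleftrightarrow> i = j" for i j using permutes_inj[OF \<rho>] by (auto dest: injD)
  have neq134: "\<rho> 1 \<noteq> \<rho> 3" "\<rho> 2 \<noteq> \<rho> 3" "\<rho> 4 \<noteq> \<rho> 3" by (simp_all add: neq)
  let ?i = "\<rho> 3" and ?F = "face \<T> t (\<rho> 3)"
  let ?t' = "nb t ?i" and ?p = "gp t ?i"
  note n = nbr[OF t \<rho>j(3)]
  have mem: "cr t (\<rho> 1) \<in> ?F" "cr t (\<rho> 2) \<in> ?F" "cr t (\<rho> 4) \<in> ?F"
    unfolding face_def using \<rho>j neq by (auto intro!: hull_inc imageI)
  have "cr t (\<rho> 1) \<noteq> cr t (\<rho> 2)" "cr t (\<rho> 1) \<noteq> cr t (\<rho> 4)" "cr t (\<rho> 2) \<noteq> cr t (\<rho> 4)"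
    by (simp_all add: inj_on_eq_iff[OF corner_inj[OF t]] \<rho>j neq del: atLeastAtMost_iff One_nat_def)
  moreover have "\<not> affine_dependent {cr t (\<rho> 1), cr t (\<rho> 2), cr t (\<rho> 4)}"
    by (rule affine_independent_subset[OF corner_indep[OF t]]) (use \<rho>j in auto)
  ultimately have ncol: "\<not> collinear {cr t (\<rho> 1), cr t (\<rho> 2), cr t (\<rho> 4)}"
    by (simp add: collinear_3_eq_affine_dependent)
  have "orientation_reversing (cell \<T> t) (orient \<T> t) ?F (cell \<T> ?t') (orient \<T> ?t') (glue \<T> (t, ?F))"
    using sing face_in_faces2[OF t \<rho>j(3)] n(3) unfolding singular_triangulation_def by blast
  then have "boundary_positive (cell \<T> t) (orient \<T> t) (cr t (\<rho> 1)) (cr t (\<rho> 2)) (cr t (\<rho> 4)) \<longleftrightarrow>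
     \<not> boundary_positive (cell \<T> ?t') (orient \<T> ?t') (cr ?t' ((?p \<circ> \<rho>) 1)) (cr ?t' ((?p \<circ> \<rho>) 2)) (cr ?t' ((?p \<circ> \<rho>) 4))"
    unfolding orientation_reversing_def o_apply
      glue_corner[OF t \<rho>j(3) \<rho>j(1) neq134(1), symmetric] glue_corner[OF t \<rho>j(3) \<rho>j(2) neq134(2), symmetric]
      glue_corner[OF t \<rho>j(3) \<rho>j(4) neq134(3), symmetric]
    using mem ncol by blast
  then show ?thesis
    using boundary_positive_iff[OF corner(1)[OF t] \<rho> corner(2)[OF t]]
      boundary_positive_iff[OF corner(1)[OF n(1)] permutes_compose[OF \<rho> n(2)] corner(2)[OF n(1)]]
    unfolding pos_def by blast
qed

lemma pos_12_34:
  assumes t: "t \<in> T" and \<rho>: "\<rho> permutes {1..4}"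
  shows "pos t (\<rho> \<circ> Transposition.transpose 1 2) \<longleftrightarrow> \<not> pos t \<rho>"
    "pos t (\<rho> \<circ> Transposition.transpose 3 4) \<longleftrightarrow> \<not> pos t \<rho>"
proof -
  define x where "x = orient \<T> t * vol (cr t (\<rho> 1)) (cr t (\<rho> 2)) (cr t (\<rho> 3)) (cr t (\<rho> 4))"
  have "x \<noteq> 0" unfolding x_def by (rule orient_vol_nonzero[OF t \<rho>])
  moreover have "pos t \<rho> \<longleftrightarrow> x > 0" by (simp add: pos_def x_def)
  moreover have "pos t (\<rho> \<circ> Transposition.transpose 1 2) \<longleftrightarrow> - x > 0"
    using vol_swap(1)[of "cr t (\<rho> 2)" "cr t (\<rho> 1)" "cr t (\<rho> 3)" "cr t (\<rho> 4)"]
    by (simp add: pos_def x_def Transposition.transpose_def)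
  moreover have "pos t (\<rho> \<circ> Transposition.transpose 3 4) \<longleftrightarrow> - x > 0"
    using vol_swap(2)[of "cr t (\<rho> 1)" "cr t (\<rho> 2)" "cr t (\<rho> 4)" "cr t (\<rho> 3)"]
    by (simp add: pos_def x_def Transposition.transpose_def)
  ultimately show "pos t (\<rho> \<circ> Transposition.transpose 1 2) \<longleftrightarrow> \<not> pos t \<rho>"
    "pos t (\<rho> \<circ> Transposition.transpose 3 4) \<longleftrightarrow> \<not> pos t \<rho>"
    by linarith+
qed

sublocale face_pairing T "\<lambda>t i. nb t i" "\<lambda>t i. gp t i" pos
proof
  show "finite T" using sing by (simp add: singular_triangulation_def)
qed (rule nbr(1) nbr(2) nbr_nbr(1) nbr_nbr(2) nbr_neq pos_nbr pos_12_34(1) pos_12_34(2); assumption)+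

text \<open>In barycentric coordinates a gluing permutes the coordinates, the vanishing one marking
  the face.\<close>

lemma glued_iff: "glued \<T> u v \<longleftrightarrow> (\<exists>t\<in>T. \<exists>i\<in>{1..4}. \<exists>\<mu>\<in>bary. \<mu> i = 0 \<and>
    u = (t, bpoint (cr t) \<mu>) \<and> v = (nb t i, bpoint (cr (nb t i)) (\<mu> \<circ> inv' (gp t i))))"
    (is "_ \<longleftrightarrow> ?R")
proof
  assume "glued \<T> u v"
  then obtain t i x where ti: "t \<in> T" "i \<in> {1..4}" "x \<in> face \<T> t i"
    and uv: "u = (t, x)" "v = (fst (partner \<T> (t, face \<T> t i)), glue \<T> (t, face \<T> t i) x)"
    unfolding glued_def faces2_eq by blast
  then obtain \<mu> where \<mu>: "\<mu> \<in> bary" "\<mu> i = 0" "x = bpoint (cr t) \<mu>" unfolding face_eq[OF ti(1,2)] by blast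
  show ?R
    using ti \<mu> uv nbr(3)[OF ti(1,2)] nbr(4)[OF ti(1,2) \<mu>(1,2)]
    by (intro bexI[of _ t] bexI[of _ i] bexI[of _ \<mu>]) simp_all
next
  assume ?R
  then obtain t i \<mu> where ti: "t \<in> T" "i \<in> {1..4}" and \<mu>: "\<mu> \<in> bary" "\<mu> i = 0"
    and uv: "u = (t, bpoint (cr t) \<mu>)" "v = (nb t i, bpoint (cr (nb t i)) (\<mu> \<circ> inv' (gp t i)))"
    by blast
  have "bpoint (cr t) \<mu> \<in> face \<T> t i" using \<mu> face_eq[OF ti] by blast
  moreover have "v = (fst (partner \<T> (t, face \<T> t i)), glue \<T> (t, face \<T> t i) (bpoint (cr t) \<mu>))"
    using nbr(3)[OF ti] nbr(4)[OF ti \<mu>] uv by simp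
  ultimately show "glued \<T> u v"
    unfolding glued_def using face_in_faces2[OF ti] uv(1) by blast
qed

end

section \<open>Colourings of a fibre\<close>

lemma finite_uniform_bound:
  fixes Q :: "'b \<Rightarrow> real \<Rightarrow> bool"
  assumes "finite A" "\<And>a. a \<in> A \<Longrightarrow> \<exists>d>0. Q a d" "\<And>a d e. Q a d \<Longrightarrow> 0 < e \<Longrightarrow> e \<le> d \<Longrightarrow> Q a e"
  shows "\<exists>d>0. \<forall>a\<in>A. Q a d"
  using assms(1,2)
proof (induction A)
  case (insert a A)
  then obtain d where "d > 0" "\<forall>a\<in>A. Q a d" by auto
  moreover obtain e where "e > 0" "Q a e" using insert.prems by blast
  ultimately show ?case using assms(3) by (intro exI[of _ "min d e"]) (auto intro: assms(3))
qed (auto intro: exI[of _ 1])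

context triangulated
begin

definition pre :: "'a set \<Rightarrow> ('t \<times> (real^3)) set" where
  "pre U = {(t, y). t \<in> T \<and> y \<in> cell \<T> t \<and> proj \<T> (t, y) \<in> U}"

text \<open>\<open>C (t, y)\<close> colours the corner labels of \<open>t\<close>, as seen from its point \<open>y\<close>; reflection through
  a face acts on colourings by the extended gluing permutation.\<close>

definition compat :: "('t \<times> (real^3)) set \<Rightarrow> ('t \<times> (real^3) \<Rightarrow> nat \<Rightarrow> nat) \<Rightarrow> bool" where
  "compat W C \<longleftrightarrow> (\<forall>u\<in>W. C u permutes {1..4}) \<and>
     (\<forall>t\<in>T. \<forall>i\<in>{1..4}. \<forall>\<mu>\<in>bary. \<mu> i = 0 \<longrightarrow> (t, bpoint (cr t) \<mu>) \<in> W \<longrightarrow>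
        C (nb t i, bpoint (cr (nb t i)) (\<mu> \<circ> inv' (gp t i))) = C (t, bpoint (cr t) \<mu>) \<circ> inv' (gp t i))"

lemma compat_subset: "compat W C \<Longrightarrow> W' \<subseteq> W \<Longrightarrow> compat W' C"
  unfolding compat_def by blast

lemma compatD:
  assumes "compat W C"
  shows "u \<in> W \<Longrightarrow> C u permutes {1..4}"
    "t \<in> T \<Longrightarrow> i \<in> {1..4} \<Longrightarrow> \<mu> \<in> bary \<Longrightarrow> \<mu> i = 0 \<Longrightarrow> (t, bpoint (cr t) \<mu>) \<in> W \<Longrightarrow>
      C (nb t i, bpoint (cr (nb t i)) (\<mu> \<circ> inv' (gp t i))) = C (t, bpoint (cr t) \<mu>) \<circ> inv' (gp t i)"
  using assms unfolding compat_def by blast+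

lemma topspace_disjoint_union: "topspace (disjoint_union \<T>) = pre UNIV"
  by (auto simp: disjoint_union_def pre_def)

lemma bpoint_in_cell: "t \<in> T \<Longrightarrow> \<mu> \<in> bary \<Longrightarrow> bpoint (cr t) \<mu> \<in> cell \<T> t"
  by (simp add: cell_eq)

lemma pre_cases:
  assumes "u \<in> pre U"
  obtains t \<mu> where "u = (t, bpoint (cr t) \<mu>)" "t \<in> T" "\<mu> \<in> bary" "proj \<T> u \<in> U"
  using assms cell_eq unfolding pre_def by blast

lemma glued_sym:
  assumes "glued \<T> u v" shows "glued \<T> v u"
proof -
  obtain t i \<mu> where ti: "t \<in> T" "i \<in> {1..4}" and \<mu>: "\<mu> \<in> bary" "\<mu> i = 0"
    and uv: "u = (t, bpoint (cr t) \<mu>)" "v = (nb t i, bpoint (cr (nb t i)) (\<mu> \<circ> inv' (gp t i)))"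
    using assms unfolding glued_iff by blast
  note n = nbr[OF ti] nbr_nbr[OF ti]
  have "\<mu> \<circ> inv' (gp t i) \<circ> inv' (inv' (gp t i)) = \<mu>"
    using permutes_inv_o(2)[OF n(2)] permutes_inv_inv[OF n(2)] by (simp add: comp_assoc)
  moreover have "(\<mu> \<circ> inv' (gp t i)) (gp t i i) = 0"
    using \<mu>(2) permutes_inverses(2)[OF n(2)] by simp
  ultimately show ?thesis
    unfolding glued_iff uv using n ti \<mu> gp_in[OF ti ti(2)] bary_permute[OF \<mu>(1) permutes_inv[OF n(2)]]
    by (intro bexI[of _ "nb t i"] bexI[of _ "gp t i i"] bexI[of _ "\<mu> \<circ> inv' (gp t i)"]) simp_all
qed

lemma proj_eq_iff:
  "u \<in> pre UNIV \<Longrightarrow> v \<in> pre UNIV \<Longrightarrow> proj \<T> u = proj \<T> v \<longleftrightarrow> equivclp (glued \<T>) u v"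
  using sing unfolding singular_triangulation_def topspace_disjoint_union by blast

lemma glued_pre:
  assumes "glued \<T> u v"
  shows "u \<in> pre UNIV" "v \<in> pre UNIV" "proj \<T> u = proj \<T> v"
proof -
  obtain t i \<mu> where ti: "t \<in> T" "i \<in> {1..4}" and \<mu>: "\<mu> \<in> bary" "\<mu> i = 0"
    and uv: "u = (t, bpoint (cr t) \<mu>)" "v = (nb t i, bpoint (cr (nb t i)) (\<mu> \<circ> inv' (gp t i)))"
    using assms unfolding glued_iff by blast
  show uv': "u \<in> pre UNIV" "v \<in> pre UNIV"
    using uv ti \<mu> nbr(1,2)[OF ti] by (auto simp: pre_def bpoint_in_cell bary_permute permutes_inv)
  then show "proj \<T> u = proj \<T> v" using assms proj_eq_iff by blast
qed

text \<open>Induction along a fibre; since gluing is symmetric, one kind of step suffices.\<close>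

lemma fibre_induct:
  assumes uv: "u \<in> pre UNIV" "v \<in> pre UNIV" "proj \<T> u = proj \<T> v"
    and base: "Q u"
    and step: "\<And>t i \<mu>. t \<in> T \<Longrightarrow> i \<in> {1..4} \<Longrightarrow> \<mu> \<in> bary \<Longrightarrow> \<mu> i = 0 \<Longrightarrow>
      proj \<T> (t, bpoint (cr t) \<mu>) = proj \<T> u \<Longrightarrow> Q (t, bpoint (cr t) \<mu>) \<Longrightarrow>
      Q (nb t i, bpoint (cr (nb t i)) (\<mu> \<circ> inv' (gp t i)))"
  shows "Q v"
proof -
  have "equivclp (glued \<T>) u v" using uv proj_eq_iff by blast
  then have "Q v \<and> proj \<T> v = proj \<T> u"
  proof (induction rule: equivclp_induct)
    case (step y z)
    then have "glued \<T> y z" using glued_sym by blast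
    then show ?case
      using step.IH glued_pre(3)[OF \<open>glued \<T> y z\<close>] assms(5) unfolding glued_iff by metis
  qed (simp add: base)
  then show ?thesis ..
qed

text \<open>Gluings only permute coordinates. Hence fibres are finite, and the number of vanishing
  coordinates is the same at all points of a fibre.\<close>

lemma fibre_coords:
  assumes u: "t \<in> T" "\<mu> \<in> bary" and v: "v \<in> pre UNIV" "proj \<T> v = proj \<T> (t, bpoint (cr t) \<mu>)"
  shows "\<exists>t'\<in>T. \<exists>\<rho>. \<rho> permutes {1..4} \<and> v = (t', bpoint (cr t') (\<mu> \<circ> \<rho>))"
proof (rule fibre_induct[OF _ v(1) v(2)[symmetric]])
  show "(t, bpoint (cr t) \<mu>) \<in> pre UNIV" using u by (simp add: pre_def bpoint_in_cell)
  show "\<exists>t'\<in>T. \<exists>\<rho>. \<rho> permutes {1..4} \<and> (t, bpoint (cr t) \<mu>) = (t', bpoint (cr t') (\<mu> \<circ> \<rho>))"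
    using u permutes_id by (intro bexI[of _ t] exI[of _ id]) auto
next
  fix s and i :: nat and \<nu> :: "nat \<Rightarrow> real" assume s: "s \<in> T" "i \<in> {1..4}" "\<nu> \<in> bary"
    and "\<exists>t'\<in>T. \<exists>\<rho>. \<rho> permutes {1..4} \<and> (s, bpoint (cr s) \<nu>) = (t', bpoint (cr t') (\<mu> \<circ> \<rho>))"
  then obtain \<rho> where \<rho>: "\<rho> permutes {1..4}" "bpoint (cr s) \<nu> = bpoint (cr s) (\<mu> \<circ> \<rho>)" by blast
  then have "\<nu> = \<mu> \<circ> \<rho>" using bp_inj[OF s(1,3)] bary_permute[OF u(2)] by blast
  then show "\<exists>t'\<in>T. \<exists>\<rho>. \<rho> permutes {1..4} \<and>
      (nb s i, bpoint (cr (nb s i)) (\<nu> \<circ> inv' (gp s i))) = (t', bpoint (cr t') (\<mu> \<circ> \<rho>))"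
    using nbr(1,2)[OF s(1,2)] \<rho>(1)
    by (intro bexI[of _ "nb s i"] exI[of _ "\<rho> \<circ> inv' (gp s i)"] conjI permutes_compose permutes_inv)
      (auto simp: comp_assoc)
qed

lemma fibre_coords':
  assumes u: "t \<in> T" "\<mu> \<in> bary" and v: "s \<in> T" "\<nu> \<in> bary"
    and "proj \<T> (s, bpoint (cr s) \<nu>) = proj \<T> (t, bpoint (cr t) \<mu>)"
  shows "\<exists>\<rho>. \<rho> permutes {1..4} \<and> \<nu> = \<mu> \<circ> \<rho>"
proof -
  have "(s, bpoint (cr s) \<nu>) \<in> pre UNIV" using v by (simp add: pre_def bpoint_in_cell)
  from fibre_coords[OF u this assms(5)] obtain \<rho> where
    "\<rho> permutes {1..4}" "bpoint (cr s) \<nu> = bpoint (cr s) (\<mu> \<circ> \<rho>)" by blast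
  then show ?thesis using bp_inj[OF v] bary_permute[OF u(2)] by blast
qed

lemma finite_fibre: "finite (pre {x})"
proof (cases "pre {x} = {}")
  case False
  then obtain t \<mu> where u: "t \<in> T" "\<mu> \<in> bary" "proj \<T> (t, bpoint (cr t) \<mu>) = x"
    using that by (blast elim: pre_cases)
  have "pre {x} \<subseteq> (\<lambda>(t', \<rho>). (t', bpoint (cr t') (\<mu> \<circ> \<rho>))) ` (T \<times> {\<rho>. \<rho> permutes {1..4}})"
  proof
    fix v assume "v \<in> pre {x}"
    then have "v \<in> pre UNIV" "proj \<T> v = proj \<T> (t, bpoint (cr t) \<mu>)" using u by (auto simp: pre_def)
    from fibre_coords[OF u(1,2) this]
    show "v \<in> (\<lambda>(t', \<rho>). (t', bpoint (cr t') (\<mu> \<circ> \<rho>))) ` (T \<times> {\<rho>. \<rho> permutes {1..4}})"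
      by (force simp: image_iff)
  qed
  moreover have "finite (T \<times> {\<rho>. \<rho> permutes {1..4::nat}})"
    using finite_T finite_permutations by blast
  ultimately show ?thesis using finite_subset by blast
qed simp

text \<open>Gluing multiplies both colourings on the right by the same permutation, which cancels in
  the ratio. So two colourings of a fibre differ by a recolouring on the left.\<close>

lemma compat_ratio:
  assumes C: "compat W C" "compat W C'" and W: "pre {x} \<subseteq> W" and uv: "u \<in> pre {x}" "v \<in> pre {x}"
  shows "C' v \<circ> inv' (C v) = C' u \<circ> inv' (C u)"
proof (rule fibre_induct[of u v])
  show "u \<in> pre UNIV" "v \<in> pre UNIV" "proj \<T> u = proj \<T> v" using uv by (auto simp: pre_def)
next
  fix t i \<mu> assume t: "t \<in> T" "i \<in> {1..4}" "\<mu> \<in> bary" "\<mu> i = 0"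
    and pr: "proj \<T> (t, bpoint (cr t) \<mu>) = proj \<T> u"
    and IH: "C' (t, bpoint (cr t) \<mu>) \<circ> inv' (C (t, bpoint (cr t) \<mu>)) = C' u \<circ> inv' (C u)"
  let ?w = "(t, bpoint (cr t) \<mu>)"
  have w: "?w \<in> W" using pr uv(1) t W bpoint_in_cell by (auto simp: pre_def subset_iff)
  note p = compatD(1)[OF C(1) w] nbr(2)[OF t(1,2)]
  have "C' (nb t i, bpoint (cr (nb t i)) (\<mu> \<circ> inv' (gp t i)))
      \<circ> inv' (C (nb t i, bpoint (cr (nb t i)) (\<mu> \<circ> inv' (gp t i))))
    = C' ?w \<circ> inv' (gp t i) \<circ> inv' (C ?w \<circ> inv' (gp t i))"
    unfolding compatD(2)[OF C(1) t w] compatD(2)[OF C(2) t w] ..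
  also have "inv' (C ?w \<circ> inv' (gp t i)) = gp t i \<circ> inv' (C ?w)"
    using o_inv_distrib[OF permutes_bij[OF p(1)] permutes_bij[OF permutes_inv[OF p(2)]]]
      permutes_inv_inv[OF p(2)] by simp
  also have "C' ?w \<circ> inv' (gp t i) \<circ> (gp t i \<circ> inv' (C ?w)) = C' ?w \<circ> (inv' (gp t i) \<circ> gp t i) \<circ> inv' (C ?w)"
    by (simp add: comp_assoc)
  also have "\<dots> = C' u \<circ> inv' (C u)" using IH permutes_inv_o(2)[OF p(2)] by simp
  finally show "C' (nb t i, bpoint (cr (nb t i)) (\<mu> \<circ> inv' (gp t i)))
      \<circ> inv' (C (nb t i, bpoint (cr (nb t i)) (\<mu> \<circ> inv' (gp t i)))) = C' u \<circ> inv' (C u)" .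
qed simp

lemma continuous_glue:
  assumes "t \<in> T" "i \<in> {1..4}"
  shows "continuous_on (face \<T> t i) (glue \<T> (t, face \<T> t i))"
proof -
  have "affine_iso (face \<T> t i) (face \<T> (nb t i) (gp t i i)) (glue \<T> (t, face \<T> t i))"
    using sing face_in_faces2[OF assms] nbr(3)[OF assms] unfolding singular_triangulation_def by blast
  then obtain L b where L: "linear L" "\<And>x. x \<in> face \<T> t i \<Longrightarrow> glue \<T> (t, face \<T> t i) x = L x + b"
    unfolding affine_iso_def by blast
  have "continuous_on (face \<T> t i) (\<lambda>x. L x + b)"
    using L(1) by (intro continuous_intros linear_continuous_on) (simp add: linear_linear)
  then show ?thesis using L(2) by (simp cong: continuous_on_cong)
qed

text \<open>The number of vanishing barycentric coordinates (none, one, two) tells whether a point lies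
  inside a tetrahedron, a face or an edge.\<close>

lemma compat_interior:
  assumes u: "t \<in> T" "\<mu> \<in> bary" "proj \<T> (t, bpoint (cr t) \<mu>) = x" and nz: "\<And>i. i \<in> {1..4} \<Longrightarrow> \<mu> i \<noteq> 0"
  shows "compat (pre {x}) (\<lambda>_. id)"
  unfolding compat_def
proof (intro conjI ballI impI)
  fix s i \<nu> assume s: "s \<in> T" "i \<in> {1..4}" "\<nu> \<in> bary" "\<nu> i = 0" "(s, bpoint (cr s) \<nu>) \<in> pre {x}"
  then obtain \<rho> where "\<rho> permutes {1..4}" "\<nu> = \<mu> \<circ> \<rho>"
    using fibre_coords'[OF u(1,2) s(1,3)] u(3) by (auto simp: pre_def)
  \<comment> \<open>A gluing needs a vanishing coordinate, and none vanishes at any point of this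
    fibre.\<close>
  then have False using nz[of "\<rho> i"] s(2,4) permutes_in_image by fastforce
  then show "id = id \<circ> inv' (gp s i)" ..
qed (rule permutes_id)

text \<open>The fibre has exactly two points, distinct because no face is glued to itself. The
  colouring of one determines that of the other, consistently since crossing back undoes the
  crossing.\<close>

lemma compat_face:
  assumes u: "t \<in> T" "\<mu> \<in> bary" "proj \<T> (t, bpoint (cr t) \<mu>) = x"
    and i: "i \<in> {1..4}" and zero: "\<And>j. j \<in> {1..4} \<Longrightarrow> \<mu> j = 0 \<longleftrightarrow> j = i"
  shows "\<exists>C. compat (pre {x}) C"
proof -
  let ?t' = "nb t i" and ?g = "gp t i"
  let ?\<mu>' = "\<mu> \<circ> inv' ?g"
  let ?u = "(t, bpoint (cr t) \<mu>)" and ?u' = "(?t', bpoint (cr ?t') ?\<mu>')"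
  note n = nbr(1,2)[OF u(1) i] and nn = nbr_nbr[OF u(1) i]
  note g_inv = permutes_inverses[OF n(2)]
  have \<mu>': "?\<mu>' \<in> bary" by (rule bary_permute[OF u(2) permutes_inv[OF n(2)]])
  have zero': "?\<mu>' j = 0 \<longleftrightarrow> j = ?g i" if "j \<in> {1..4}" for j
    using zero[of "inv' ?g j"] permutes_in_image[OF permutes_inv[OF n(2)], of j] that g_inv unfolding o_apply by metis
  have \<mu>'': "?\<mu>' \<circ> inv' (gp ?t' (?g i)) = \<mu>"
    unfolding nn using permutes_inv_o(2)[OF n(2)] permutes_inv_inv[OF n(2)] by (simp add: comp_assoc)
  have neq: "?u' \<noteq> ?u"
  proof
    assume "?u' = ?u"
    then have "?t' = t" "?\<mu>' = \<mu>" using bp_inj[OF u(1) \<mu>' u(2)] by auto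
    then have "?g i = i" using zero[of "?g i"] zero'[of "?g i"] gp_in[OF u(1) i i] by auto
    then show False using nbr_neq[OF u(1) i] \<open>?t' = t\<close> by simp
  qed
  have fib: "v \<in> {?u, ?u'}" if v: "v \<in> pre {x}" for v
  proof (rule fibre_induct[of ?u v])
    show "?u \<in> pre UNIV" "v \<in> pre UNIV" "proj \<T> ?u = proj \<T> v"
      using u v by (auto simp: pre_def bpoint_in_cell)
  next
    fix s j \<nu> assume s: "s \<in> T" "j \<in> {1..4}" "\<nu> \<in> bary" "\<nu> j = 0" "(s, bpoint (cr s) \<nu>) \<in> {?u, ?u'}"
    then consider "s = t" "\<nu> = \<mu>" | "s = ?t'" "\<nu> = ?\<mu>'"
      using bp_inj[OF u(1) _ u(2)] bp_inj[OF n(1) _ \<mu>'] by auto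
    then show "(nb s j, bpoint (cr (nb s j)) (\<nu> \<circ> inv' (gp s j))) \<in> {?u, ?u'}"
    proof cases
      case 1
      then show ?thesis using zero s by simp
    next
      case 2
      then have "j = ?g i" using zero' s by simp
      then show ?thesis using 2 nn \<mu>'' by simp
    qed
  qed simp
  define C where "C v = (if v = ?u then id else inv' ?g)" for v
  have "compat (pre {x}) C"
    unfolding compat_def
  proof (intro conjI ballI impI)
    show "C v permutes {1..4}" for v
      unfolding C_def using permutes_id permutes_inv[OF n(2)] by auto
    fix s j \<nu> assume s: "s \<in> T" "j \<in> {1..4}" "\<nu> \<in> bary" "\<nu> j = 0" "(s, bpoint (cr s) \<nu>) \<in> pre {x}"
    from fib[OF s(5)] consider "s = t" "\<nu> = \<mu>" | "s = ?t'" "\<nu> = ?\<mu>'"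
      using bp_inj[OF u(1) s(3) u(2)] bp_inj[OF n(1) s(3) \<mu>'] by auto
    then show "C (nb s j, bpoint (cr (nb s j)) (\<nu> \<circ> inv' (gp s j))) = C (s, bpoint (cr s) \<nu>) \<circ> inv' (gp s j)"
    proof cases
      case 1
      then have j: "j = i" using zero s by simp
      show ?thesis unfolding 1 j C_def if_not_P[OF neq] by simp
    next
      case 2
      then have "j = ?g i" using zero' s by simp
      then have e: "(nb s j, bpoint (cr (nb s j)) (\<nu> \<circ> inv' (gp s j))) = ?u" "gp s j = inv' ?g"
        using 2 nn \<mu>'' by simp_all
      have Cu: "C ?u = id" "C ?u' = inv' ?g" unfolding C_def if_not_P[OF neq] by simp_all
      have "C (nb s j, bpoint (cr (nb s j)) (\<nu> \<circ> inv' (gp s j))) = id" by (simp only: e(1) Cu(1))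
      also have "id = inv' ?g \<circ> inv' (inv' ?g)"
        using permutes_inv_inv[OF n(2)] permutes_inv_o(2)[OF n(2)] by simp
      also have "\<dots> = C (s, bpoint (cr s) \<nu>) \<circ> inv' (gp s j)" unfolding e(2) by (simp only: 2 Cu(2))
      finally show ?thesis .
    qed
  qed
  then show ?thesis by blast
qed

section \<open>Fibres over points inside an edge\<close>

lemma edge_of_cell_iff:
  assumes t: "t \<in> T"
  shows "e edge_of cell \<T> t \<longleftrightarrow> (\<exists>i\<in>{1..4}. \<exists>j\<in>{1..4}. i \<noteq> j \<and> e = convex hull {cr t i, cr t j})"
proof -
  have inj: "cr t i = cr t j \<longleftrightarrow> i = j" if "i \<in> {1..4}" "j \<in> {1..4}" for i j
    using corner_inj[OF t] that by (simp only: inj_on_eq_iff)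
  note face = face_of_convex_hull_affine_independent[OF corner_indep[OF t], folded corner(2)[OF t]]
  show ?thesis
  proof
    assume "e edge_of cell \<T> t"
    then obtain c where c: "c \<subseteq> cr t ` {1..4}" "e = convex hull c" "aff_dim e = 1"
      unfolding edge_of_def face by blast
    have "\<not> affine_dependent c" by (rule affine_independent_subset[OF corner_indep[OF t] c(1)])
    then have "card c = 2" using aff_dim_affine_independent[of c] c(2,3) by (simp add: aff_dim_convex_hull)
    then obtain y z where yz: "c = {y, z}" "y \<noteq> z" by (auto simp: card_2_iff)
    then obtain i j where ij: "i \<in> {1..4}" "j \<in> {1..4}" "y = cr t i" "z = cr t j" using c(1) by blast
    show "\<exists>i\<in>{1..4}. \<exists>j\<in>{1..4}. i \<noteq> j \<and> e = convex hull {cr t i, cr t j}"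
      using yz c(2) ij(3,4) by (intro bexI[OF _ ij(1)] bexI[OF _ ij(2)]) auto
  next
    assume "\<exists>i\<in>{1..4}. \<exists>j\<in>{1..4}. i \<noteq> j \<and> e = convex hull {cr t i, cr t j}"
    then obtain i j where ij: "i \<in> {1..4}" "j \<in> {1..4}" "i \<noteq> j" "e = convex hull {cr t i, cr t j}" by blast
    then have "e face_of cell \<T> t" unfolding face by (intro exI[of _ "{cr t i, cr t j}"]) blast
    moreover have "aff_dim e = 1" using ij inj by (simp add: aff_dim_convex_hull del: atLeastAtMost_iff)
    ultimately show "e edge_of cell \<T> t" by (simp add: edge_of_def)
  qed
qed

text \<open>Coordinates are taken relative to the frame, the corner \<open>\<rho> j\<close> carrying
  \<open>n j\<close>; thus \<open>n\<close> stays fixed while the walk changes the state.\<close>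

definition at_state :: "(nat \<Rightarrow> real) \<Rightarrow> 't \<times> (nat \<Rightarrow> nat) \<Rightarrow> 't \<times> (real^3)" where
  "at_state n = (\<lambda>(t, \<rho>). (t, bpoint (cr t) (n \<circ> inv' \<rho>)))"

definition edge_at :: "'t \<times> (nat \<Rightarrow> nat) \<Rightarrow> 't \<times> (real^3) set" where
  "edge_at = (\<lambda>(t, \<rho>). (t, convex hull {cr t (\<rho> 1), cr t (\<rho> 2)}))"

text \<open>When the third and fourth coordinates agree, \<open>swap34\<close> leaves the point
  alone, so a turn moves it exactly as the gluing does.\<close>

lemma turn_coords:
  assumes st: "(t, \<rho>) \<in> states" and n: "n 3 = n 4"
  shows "fst (turn (t, \<rho>)) = nb t (\<rho> 3)"
    "n \<circ> inv' (snd (turn (t, \<rho>))) = n \<circ> inv' \<rho> \<circ> inv' (gp t (\<rho> 3))"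
proof -
  have t: "t \<in> T" "\<rho> permutes {1..4}" using st unfolding states_iff by blast+
  have 3: "\<rho> 3 \<in> {1..4}" using permutes_in_1_4[OF t(2), of 3] by simp
  show "fst (turn (t, \<rho>)) = nb t (\<rho> 3)" by (simp add: turn_def cross_def swap34_def)
  have "inv' (gp t (\<rho> 3) \<circ> \<rho> \<circ> Transposition.transpose 3 4)
      = Transposition.transpose 3 4 \<circ> (inv' \<rho> \<circ> inv' (gp t (\<rho> 3)))"
    using permutes_bij[OF t(2)] permutes_bij[OF nbr(2)[OF t(1) 3]]
    by (simp add: o_inv_distrib bij_comp inv_swap_id)
  moreover have "n \<circ> Transposition.transpose 3 4 = n"
    using n by (auto simp: fun_eq_iff Transposition.transpose_def)
  ultimately show "n \<circ> inv' (snd (turn (t, \<rho>))) = n \<circ> inv' \<rho> \<circ> inv' (gp t (\<rho> 3))"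
    by (simp add: turn_def cross_def swap34_def flip: comp_assoc)
qed

lemma at_state_turn:
  assumes st: "(t, \<rho>) \<in> states" and n: "n 3 = n 4"
  shows "at_state n (turn (t, \<rho>)) = (nb t (\<rho> 3), bpoint (cr (nb t (\<rho> 3))) (n \<circ> inv' \<rho> \<circ> inv' (gp t (\<rho> 3))))"
  unfolding at_state_def case_prod_beta turn_coords(1)[OF st n] turn_coords(2)[OF st n] ..

lemma proj_at_state_turn:
  assumes st: "\<omega> \<in> states" and n: "n \<in> bary" "n 3 = 0" "n 4 = 0"
  shows "proj \<T> (at_state n (turn \<omega>)) = proj \<T> (at_state n \<omega>)"
proof -
  obtain t \<rho> where \<omega>: "\<omega> = (t, \<rho>)" "t \<in> T" "\<rho> permutes {1..4}" using st by (rule statesE)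
  have "glued \<T> (at_state n \<omega>) (at_state n (turn \<omega>))"
    unfolding \<omega>(1) at_state_turn[OF st[unfolded \<omega>(1)] n(2)[folded n(3)]] glued_iff
    using \<omega>(2) permutes_in_1_4[OF \<omega>(3), of 3] bary_permute[OF n(1) permutes_inv[OF \<omega>(3)]]
      n(2) permutes_inverses(2)[OF \<omega>(3)]
    by (intro bexI[of _ t] bexI[of _ "\<rho> 3"] bexI[of _ "n \<circ> inv' \<rho>"]) (simp_all add: at_state_def)
  then show ?thesis using glued_pre(3) by simp
qed

lemma edge_at_eq:
  assumes t: "t \<in> T" and \<rho>: "\<rho> permutes {1..4}"
  shows "{t} \<times> snd (edge_at (t, \<rho>)) = (\<lambda>n. at_state n (t, \<rho>)) ` {n \<in> bary. n 3 = 0 \<and> n 4 = 0}"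
proof -
  have U: "{1..4} = {1, 2, 3, 4::nat}" by auto
  have "{1..4} = \<rho> ` {1, 2, 3, 4}" using permutes_image[OF \<rho>] unfolding U by simp
  moreover have neq: "\<rho> i = \<rho> j \<longleftrightarrow> i = j" for i j using permutes_inj[OF \<rho>] by (auto dest: injD)
  ultimately have diff: "{1..4} - {\<rho> 1, \<rho> 2} = {\<rho> 3, \<rho> 4}" and sub: "{\<rho> 1, \<rho> 2} \<subseteq> {1..4}"
    by (auto simp: neq simp del: atLeastAtMost_iff)
  have "snd (edge_at (t, \<rho>)) = bpoint (cr t) ` {\<mu> \<in> bary. \<forall>k\<in>{\<rho> 3, \<rho> 4}. \<mu> k = 0}"
    using convex_hull_corners[OF corner_inj[OF t] sub] unfolding diff by (simp add: edge_at_def)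
  also have "{\<mu> \<in> bary. \<forall>k\<in>{\<rho> 3, \<rho> 4}. \<mu> k = 0} = (\<lambda>n. n \<circ> inv' \<rho>) ` {n \<in> bary. n 3 = 0 \<and> n 4 = 0}"
  proof (intro equalityI subsetI)
    fix \<mu> assume "\<mu> \<in> {\<mu> \<in> bary. \<forall>k\<in>{\<rho> 3, \<rho> 4}. \<mu> k = 0}"
    then show "\<mu> \<in> (\<lambda>n. n \<circ> inv' \<rho>) ` {n \<in> bary. n 3 = 0 \<and> n 4 = 0}"
      using bary_permute[OF _ \<rho>] permutes_inv_o(1)[OF \<rho>]
      by (intro image_eqI[of _ _ "\<mu> \<circ> \<rho>"]) (auto simp: comp_assoc)
  next
    fix \<mu> assume "\<mu> \<in> (\<lambda>n. n \<circ> inv' \<rho>) ` {n \<in> bary. n 3 = 0 \<and> n 4 = 0}"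
    then show "\<mu> \<in> {\<mu> \<in> bary. \<forall>k\<in>{\<rho> 3, \<rho> 4}. \<mu> k = 0}"
      using bary_permute[OF _ permutes_inv[OF \<rho>]] permutes_inverses(2)[OF \<rho>] by auto
  qed
  finally show ?thesis by (auto simp: at_state_def image_image)
qed

lemma edge_at_simplex_edges:
  assumes "\<omega> \<in> states" shows "edge_at \<omega> \<in> simplex_edges \<T>"
proof -
  obtain t \<rho> where \<omega>: "\<omega> = (t, \<rho>)" "t \<in> T" "\<rho> permutes {1..4}" using assms by (rule statesE)
  have "\<rho> 1 \<in> {1..4}" "\<rho> 2 \<in> {1..4}" "\<rho> 1 \<noteq> \<rho> 2"
    using permutes_in_1_4[OF \<omega>(3)] permutes_inj[OF \<omega>(3)] by (auto dest: injD)
  then show ?thesis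
    unfolding simplex_edges_def edge_at_def \<omega>(1) prod.case mem_Collect_eq edge_of_cell_iff[OF \<omega>(2)]
    by (intro conjI \<omega>(2) bexI[of _ "\<rho> 1"] bexI[of _ "\<rho> 2"]) auto
qed

lemma edge_image_turn:
  assumes "\<omega> \<in> states"
  shows "edge_image \<T> (edge_at (turn \<omega>)) = edge_image \<T> (edge_at \<omega>)"
proof -
  have *: "edge_image \<T> (edge_at \<omega>) = (\<lambda>n. proj \<T> (at_state n \<omega>)) ` {n \<in> bary. n 3 = 0 \<and> n 4 = 0}"
    if "\<omega> \<in> states" for \<omega>
  proof -
    obtain t \<rho> where \<omega>: "\<omega> = (t, \<rho>)" "t \<in> T" "\<rho> permutes {1..4}" using \<open>\<omega> \<in> states\<close> by (rule statesE)
    have "edge_image \<T> (edge_at \<omega>) = proj \<T> ` ({t} \<times> snd (edge_at (t, \<rho>)))"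
      by (simp add: edge_image_def edge_at_def \<omega>(1))
    then show ?thesis unfolding edge_at_eq[OF \<omega>(2,3)] image_image \<omega>(1) .
  qed
  show ?thesis
    unfolding *[OF assms] *[OF turn_closed[OF assms]]
    by (intro image_cong refl) (use proj_at_state_turn[OF assms] in auto)
qed

text \<open>The walk around the edge reaches every point of the fibre. Its states correspond
  bijectively both to these points and to the simplex edges lying over the edge, so the walk has
  length \<open>edge_degree\<close>, and evenness supplies the colouring.\<close>

lemma compat_edge:
  assumes ev: "even_triangulation \<T>"
    and u: "t \<in> T" "\<mu> \<in> bary" "proj \<T> (t, bpoint (cr t) \<mu>) = x"
    and ab: "a \<in> {1..4}" "b \<in> {1..4}" "a \<noteq> b"
    and zero: "\<And>j. j \<in> {1..4} \<Longrightarrow> \<mu> j = 0 \<longleftrightarrow> j = a \<or> j = b"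
  shows "\<exists>C. compat (pre {x}) C"
proof -
  obtain \<rho>0 where \<rho>0: "\<rho>0 permutes {1..4}" "\<rho>0 3 = a" "\<rho>0 4 = b"
  proof
    \<comment> \<open>\<open>?q\<close> brings 3 to \<open>a\<close>; the second transposition moves
      the image of 4 to \<open>b\<close> and leaves \<open>a\<close> alone.\<close>
    let ?q = "Transposition.transpose 3 a"
    show "Transposition.transpose (?q 4) b \<circ> ?q permutes {1..4}"
      by (intro permutes_compose permutes_swap_id) (use ab in \<open>auto simp: Transposition.transpose_def\<close>)
  qed (use ab in \<open>auto simp: Transposition.transpose_def\<close>)
  define m where "m = \<mu> \<circ> \<rho>0"
  have m: "m \<in> bary" unfolding m_def by (rule bary_permute[OF u(2) \<rho>0(1)])
  have m0: "m j = 0 \<longleftrightarrow> j = 3 \<or> j = 4" if "j \<in> {1..4}" for j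
    using zero[of "\<rho>0 j"] permutes_in_image[OF \<rho>0(1), of j] that injD[OF permutes_inj[OF \<rho>0(1)]] \<rho>0(2,3)
    unfolding m_def o_apply by metis
  have m34: "m 3 = 0" "m 4 = 0" "m 3 = m 4" using m0[of 3] m0[of 4] by simp_all
  let ?\<omega> = "(t, \<rho>0)"
  define Orb where "Orb = range (\<lambda>n. (turn ^^ n) ?\<omega>)"
  have \<omega>: "?\<omega> \<in> states" using u(1) \<rho>0(1) unfolding states_iff by blast
  have Orb: "\<nu> \<in> states" if "\<nu> \<in> Orb" for \<nu>
    using turn_power_closed[OF \<omega>] that unfolding Orb_def by blast
  have turn_Orb: "turn \<nu> \<in> Orb" if "\<nu> \<in> Orb" for \<nu>
  proof -
    from that obtain n where "\<nu> = (turn ^^ n) ?\<omega>" unfolding Orb_def by blast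
    then show ?thesis unfolding Orb_def by (intro range_eqI[of _ _ "Suc n"]) simp
  qed
  have at0: "at_state m ?\<omega> = (t, bpoint (cr t) \<mu>)"
    using permutes_inv_o(1)[OF \<rho>0(1)] by (simp add: at_state_def m_def comp_assoc)
  have zero_at: "(m \<circ> inv' \<rho>) j = 0 \<longleftrightarrow> j = \<rho> 3 \<or> j = \<rho> 4" if "\<rho> permutes {1..4}" "j \<in> {1..4}" for \<rho> j
    using m0[of "inv' \<rho> j"] permutes_in_image[OF permutes_inv[OF that(1)], of j] that(2)
      permutes_inverses[OF that(1)] unfolding o_apply by metis
  \<comment> \<open>The point lies on just the two faces of its cell that contain the edge. Leaving
    through the one opposite to \<open>\<rho> 3\<close> is a turn, through the one opposite to
    \<open>\<rho> 4\<close> a turn undone.\<close>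
  have step: "\<exists>\<omega>'\<in>Orb. at_state m \<omega>' = (nb s j, bpoint (cr (nb s j)) (m \<circ> inv' \<rho> \<circ> inv' (gp s j))) \<and>
      (turn (s, \<rho>) = \<omega>' \<and> j = \<rho> 3 \<or> turn \<omega>' = (s, \<rho>) \<and> fst \<omega>' \<in> T \<and> snd \<omega>' 3 \<in> {1..4} \<and>
        gp s j = inv' (gp (fst \<omega>') (snd \<omega>' 3)))"
    if s: "(s, \<rho>) \<in> Orb" and j: "j \<in> {1..4}" "(m \<circ> inv' \<rho>) j = 0" for s \<rho> j
  proof -
    have st: "(s, \<rho>) \<in> states" by (rule Orb[OF s])
    then have sT: "s \<in> T" "\<rho> permutes {1..4}" unfolding states_iff by blast+
    consider "j = \<rho> 3" | "j = \<rho> 4" using zero_at[OF sT(2) j(1)] j(2) by blast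
    then show ?thesis
    proof cases
      case 1
      then show ?thesis using at_state_turn[OF st m34(3)] turn_Orb[OF s] by blast
    next
      case 2
      obtain \<omega>' where \<omega>': "\<omega>' \<in> Orb" "turn \<omega>' = (s, \<rho>)"
        using s turn_orbit_pred[OF \<omega>] unfolding Orb_def by (metis (no_types, lifting) imageE)
      obtain s' \<rho>' where eq: "\<omega>' = (s', \<rho>')" "s' \<in> T" "\<rho>' permutes {1..4}"
        using Orb[OF \<omega>'(1)] by (rule statesE)
      have 3: "\<rho>' 3 \<in> {1..4}" using permutes_in_1_4[OF eq(3), of 3] by simp
      have "s = nb s' (\<rho>' 3)" "\<rho> = gp s' (\<rho>' 3) \<circ> \<rho>' \<circ> Transposition.transpose 3 4"
        using \<omega>'(2) by (simp_all add: eq(1) turn_def cross_def swap34_def)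
      then have bk: "nb s j = s'" "gp s j = inv' (gp s' (\<rho>' 3))"
        using nbr_nbr[OF eq(2) 3] 2 by simp_all
      have "m \<circ> inv' \<rho> = m \<circ> inv' \<rho>' \<circ> inv' (gp s' (\<rho>' 3))"
        using turn_coords(2)[OF Orb[OF \<omega>'(1), unfolded eq(1)] m34(3)] \<omega>'(2) by (simp add: eq(1))
      then have "m \<circ> inv' \<rho> \<circ> inv' (gp s j) = m \<circ> inv' \<rho>'"
        using permutes_inv_inv[OF nbr(2)[OF eq(2) 3]] permutes_inv_o(2)[OF nbr(2)[OF eq(2) 3]]
        by (simp add: bk comp_assoc)
      then have "at_state m \<omega>' = (nb s j, bpoint (cr (nb s j)) (m \<circ> inv' \<rho> \<circ> inv' (gp s j)))"
        by (simp add: at_state_def eq(1) bk)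
      then show ?thesis using \<omega>' eq 3 bk(2) by (intro bexI[of _ \<omega>']) auto
    qed
  qed
  have fib: "v \<in> at_state m ` Orb" if v: "v \<in> pre {x}" for v
  proof (rule fibre_induct[of "(t, bpoint (cr t) \<mu>)" v])
    show "(t, bpoint (cr t) \<mu>) \<in> pre UNIV" "v \<in> pre UNIV" "proj \<T> (t, bpoint (cr t) \<mu>) = proj \<T> v"
      using u v by (auto simp: pre_def bpoint_in_cell)
    show "(t, bpoint (cr t) \<mu>) \<in> at_state m ` Orb"
      unfolding at0[symmetric] Orb_def by (intro imageI range_eqI[of _ _ 0]) simp
  next
    fix s j \<nu> assume s: "s \<in> T" "j \<in> {1..4}" "\<nu> \<in> bary" "\<nu> j = 0" "(s, bpoint (cr s) \<nu>) \<in> at_state m ` Orb"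
    then obtain \<rho> where \<rho>: "(s, \<rho>) \<in> Orb" "bpoint (cr s) \<nu> = bpoint (cr s) (m \<circ> inv' \<rho>)"
      by (auto simp: at_state_def)
    have "\<rho> permutes {1..4}" using Orb[OF \<rho>(1)] unfolding states_iff by blast
    then have "\<nu> = m \<circ> inv' \<rho>" using bp_inj[OF s(1,3)] \<rho>(2) bary_permute[OF m] permutes_inv by blast
    then show "(nb s j, bpoint (cr (nb s j)) (\<nu> \<circ> inv' (gp s j))) \<in> at_state m ` Orb"
      using step[OF \<rho>(1) s(2)] s(4) by (metis imageI)
  qed
  have at_inj: "\<omega>1 = \<omega>2" if "\<omega>1 \<in> Orb" "\<omega>2 \<in> Orb" "fst \<omega>1 = fst \<omega>2"
    "{snd \<omega>2 1, snd \<omega>2 2} = {snd \<omega>1 1, snd \<omega>1 2}" for \<omega>1 \<omega>2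
    using turn_orbit_inj[OF \<omega>, of "fst \<omega>1" "snd \<omega>1" "snd \<omega>2"] that
    unfolding Orb_def by (metis prod.collapse)
  \<comment> \<open>The nonvanishing coordinates recover the edge of a state from its point, so that
    \<open>turn_orbit_inj\<close> applies to points.\<close>
  have nz: "{j \<in> {1..4}. (m \<circ> inv' \<rho>) j \<noteq> 0} = {\<rho> 1, \<rho> 2}" if "\<rho> permutes {1..4}" for \<rho>
  proof -
    have U: "{1..4} = {1, 2, 3, 4::nat}" by auto
    have im: "{1..4} = {\<rho> 1, \<rho> 2, \<rho> 3, \<rho> 4}" using permutes_image[OF that] unfolding U by auto
    have neq: "\<rho> i = \<rho> j \<longleftrightarrow> i = j" for i j using permutes_inj[OF that] by (auto dest: injD)
    have "{j \<in> {1..4}. (m \<circ> inv' \<rho>) j \<noteq> 0} = {j \<in> {1..4}. j \<noteq> \<rho> 3 \<and> j \<noteq> \<rho> 4}"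
      using zero_at[OF that] by blast
    also have "\<dots> = {\<rho> 1, \<rho> 2}" unfolding im by (auto simp: neq)
    finally show ?thesis .
  qed
  have at_state_inj: "inj_on (at_state m) Orb"
  proof (rule inj_onI)
    fix \<omega>1 \<omega>2 assume o: "\<omega>1 \<in> Orb" "\<omega>2 \<in> Orb" "at_state m \<omega>1 = at_state m \<omega>2"
    obtain t1 \<rho>1 where 1: "\<omega>1 = (t1, \<rho>1)" "t1 \<in> T" "\<rho>1 permutes {1..4}" using Orb[OF o(1)] by (rule statesE)
    obtain t2 \<rho>2 where 2: "\<omega>2 = (t2, \<rho>2)" "t2 \<in> T" "\<rho>2 permutes {1..4}" using Orb[OF o(2)] by (rule statesE)
    have "t1 = t2" "bpoint (cr t1) (m \<circ> inv' \<rho>1) = bpoint (cr t1) (m \<circ> inv' \<rho>2)"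
      using o(3) by (auto simp: at_state_def 1 2)
    then have "m \<circ> inv' \<rho>1 = m \<circ> inv' \<rho>2"
      using bp_inj[OF 1(2)] bary_permute[OF m] permutes_inv 1(3) 2(3) by blast
    then have "{\<rho>1 1, \<rho>1 2} = {\<rho>2 1, \<rho>2 2}" using nz[OF 1(3)] nz[OF 2(3)] by simp
    then show "\<omega>1 = \<omega>2" using at_inj[OF o(1,2)] \<open>t1 = t2\<close> by (simp add: 1 2)
  qed
  define E where "E = edge_image \<T> (edge_at ?\<omega>)"
  have "bij_betw edge_at Orb {\<eta> \<in> simplex_edges \<T>. edge_image \<T> \<eta> = E}"
    unfolding bij_betw_def
  proof (intro conjI equalityI subsetI inj_onI)
    fix \<omega>1 \<omega>2 assume o: "\<omega>1 \<in> Orb" "\<omega>2 \<in> Orb" "edge_at \<omega>1 = edge_at \<omega>2"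
    obtain t1 \<rho>1 where 1: "\<omega>1 = (t1, \<rho>1)" "t1 \<in> T" "\<rho>1 permutes {1..4}" using Orb[OF o(1)] by (rule statesE)
    obtain t2 \<rho>2 where 2: "\<omega>2 = (t2, \<rho>2)" "t2 \<in> T" "\<rho>2 permutes {1..4}" using Orb[OF o(2)] by (rule statesE)
    have eq: "t1 = t2" "convex hull {cr t1 (\<rho>1 1), cr t1 (\<rho>1 2)} = convex hull {cr t1 (\<rho>2 1), cr t1 (\<rho>2 2)}"
      using o(3) by (auto simp: edge_at_def 1 2)
    have ext: "y extreme_point_of convex hull {cr t1 (\<rho> 1), cr t1 (\<rho> 2)} \<longleftrightarrow> y \<in> {cr t1 (\<rho> 1), cr t1 (\<rho> 2)}"
      for y and \<rho> :: "nat \<Rightarrow> nat"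
      by (rule extreme_point_of_convex_hull_affine_independent) (rule affine_independent_2)
    have "cr t1 ` {\<rho>1 1, \<rho>1 2} = cr t1 ` {\<rho>2 1, \<rho>2 2}"
      using ext[of _ \<rho>1] ext[of _ \<rho>2] eq(2) by auto
    moreover have "{\<rho>1 1, \<rho>1 2} \<subseteq> {1..4}" "{\<rho>2 1, \<rho>2 2} \<subseteq> {1..4}"
      using permutes_in_1_4[OF 1(3)] permutes_in_1_4[OF 2(3)] by auto
    ultimately have "{\<rho>1 1, \<rho>1 2} = {\<rho>2 1, \<rho>2 2}"
      using inj_on_image_eq_iff[OF corner_inj[OF 1(2)]] by blast
    then show "\<omega>1 = \<omega>2" using at_inj[OF o(1,2)] \<open>t1 = t2\<close> by (simp add: 1 2)
  next
    fix \<eta> assume "\<eta> \<in> edge_at ` Orb"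
    then obtain n where n: "\<eta> = edge_at ((turn ^^ n) ?\<omega>)" unfolding Orb_def by blast
    have "edge_image \<T> (edge_at ((turn ^^ n) ?\<omega>)) = E"
      by (induction n) (simp_all add: E_def edge_image_turn turn_power_closed[OF \<omega>])
    then show "\<eta> \<in> {\<eta> \<in> simplex_edges \<T>. edge_image \<T> \<eta> = E}"
      unfolding n using edge_at_simplex_edges[OF turn_power_closed[OF \<omega>]] by blast
  next
    fix \<eta> assume "\<eta> \<in> {\<eta> \<in> simplex_edges \<T>. edge_image \<T> \<eta> = E}"
    then obtain s e where \<eta>: "\<eta> = (s, e)" "s \<in> T" "e edge_of cell \<T> s" "proj \<T> ` ({s} \<times> e) = E"
      by (auto simp: simplex_edges_def edge_image_def)
    obtain i j where ij: "i \<in> {1..4}" "j \<in> {1..4}" "i \<noteq> j" "e = convex hull (cr s ` {i, j})"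
      using \<eta>(3) unfolding edge_of_cell_iff[OF \<eta>(2)] by auto
    have e: "e = bpoint (cr s) ` {\<mu> \<in> bary. \<forall>k\<in>{1..4} - {i, j}. \<mu> k = 0}"
      unfolding ij(4) by (rule convex_hull_corners[OF corner_inj[OF \<eta>(2)]]) (use ij in auto)
    \<comment> \<open>Hence every simplex edge over \<open>E\<close> contains a point over
      \<open>x\<close>. That point comes from a state of the orbit, and its two nonzero coordinates
      identify the edge.\<close>
    have "x \<in> E"
    proof -
      have "at_state m ?\<omega> \<in> {t} \<times> snd (edge_at ?\<omega>)"
        unfolding edge_at_eq[OF u(1) \<rho>0(1)] using m m34 by blast
      then have "proj \<T> (t, bpoint (cr t) \<mu>) \<in> E"
        unfolding E_def edge_image_def at0 by (auto simp: edge_at_def)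
      then show ?thesis using u(3) by simp
    qed
    then obtain \<nu> where \<nu>: "\<nu> \<in> bary" "\<forall>k\<in>{1..4} - {i, j}. \<nu> k = 0" "proj \<T> (s, bpoint (cr s) \<nu>) = x"
      unfolding \<eta>(4)[symmetric] e by blast
    then have "(s, bpoint (cr s) \<nu>) \<in> pre {x}" using \<eta>(2) by (simp add: pre_def bpoint_in_cell)
    then have "(s, bpoint (cr s) \<nu>) \<in> at_state m ` Orb" by (rule fib)
    then obtain \<rho> where \<rho>: "(s, \<rho>) \<in> Orb" "bpoint (cr s) \<nu> = bpoint (cr s) (m \<circ> inv' \<rho>)"
      by (auto simp: at_state_def)
    have \<rho>p: "\<rho> permutes {1..4}" using Orb[OF \<rho>(1)] unfolding states_iff by blast
    then have eq: "m \<circ> inv' \<rho> = \<nu>" using bp_inj[OF \<eta>(2) \<nu>(1)] \<rho>(2) bary_permute[OF m] permutes_inv by blast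
    have "{k \<in> {1..4}. (m \<circ> inv' \<rho>) k \<noteq> 0} \<subseteq> {i, j}" unfolding eq using \<nu>(2) by blast
    then have "{\<rho> 1, \<rho> 2} \<subseteq> {i, j}" unfolding nz[OF \<rho>p] .
    moreover have "\<rho> 1 \<noteq> \<rho> 2" using inj_eq[OF permutes_inj[OF \<rho>p], of 1 2] by simp
    ultimately have "{\<rho> 1, \<rho> 2} = {i, j}" unfolding doubleton_eq_iff insert_subset insert_iff empty_iff by metis
    then have "cr s ` {\<rho> 1, \<rho> 2} = cr s ` {i, j}" by simp
    then have "\<eta> = edge_at (s, \<rho>)" unfolding \<eta>(1) ij(4) by (simp add: edge_at_def)
    then show "\<eta> \<in> edge_at ` Orb" using \<rho>(1) by blast
  qed
  then have "card Orb = edge_degree \<T> E" unfolding edge_degree_def by (rule bij_betw_same_card)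
  moreover have "E \<in> edges \<T>" unfolding E_def edges_def using edge_at_simplex_edges[OF \<omega>] by blast
  ultimately have "even (card Orb)" using ev by (simp add: even_triangulation_def)
  then obtain c where c: "\<forall>(t, \<rho>) \<in> Orb. c (t, \<rho>) permutes {1..4} \<and>
      c (turn (t, \<rho>)) = c (t, \<rho>) \<circ> inv' (gp t (\<rho> 3))"
    using turn_orbit_colouring[OF \<omega>] unfolding Orb_def by blast
  define C where "C v = c (the_inv_into Orb (at_state m) v)" for v
  have C: "C (at_state m \<nu>) = c \<nu>" if "\<nu> \<in> Orb" for \<nu>
    using the_inv_into_f_f[OF at_state_inj that] by (simp add: C_def)
  have "compat (pre {x}) C"
    unfolding compat_def
  proof (intro conjI ballI impI)
    fix v assume "v \<in> pre {x}"
    then obtain \<nu> where "\<nu> \<in> Orb" "v = at_state m \<nu>" using fib by blast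
    then show "C v permutes {1..4}" using c C by (cases \<nu>) auto
  next
    fix s j \<nu> assume s: "s \<in> T" "j \<in> {1..4}" "\<nu> \<in> bary" "\<nu> j = 0" "(s, bpoint (cr s) \<nu>) \<in> pre {x}"
    obtain \<rho> where \<rho>: "(s, \<rho>) \<in> Orb" "bpoint (cr s) \<nu> = bpoint (cr s) (m \<circ> inv' \<rho>)"
      using fib[OF s(5)] by (auto simp: at_state_def)
    have \<rho>p: "\<rho> permutes {1..4}" using Orb[OF \<rho>(1)] unfolding states_iff by blast
    then have \<nu>: "\<nu> = m \<circ> inv' \<rho>" using bp_inj[OF s(1,3)] \<rho>(2) bary_permute[OF m] permutes_inv by blast
    have at: "(s, bpoint (cr s) \<nu>) = at_state m (s, \<rho>)" by (simp add: at_state_def \<nu>)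
    obtain \<omega>' where \<omega>': "\<omega>' \<in> Orb"
      "at_state m \<omega>' = (nb s j, bpoint (cr (nb s j)) (\<nu> \<circ> inv' (gp s j)))"
      "turn (s, \<rho>) = \<omega>' \<and> j = \<rho> 3 \<or> turn \<omega>' = (s, \<rho>) \<and> fst \<omega>' \<in> T \<and> snd \<omega>' 3 \<in> {1..4} \<and>
        gp s j = inv' (gp (fst \<omega>') (snd \<omega>' 3))"
      using step[OF \<rho>(1) s(2)] s(4) unfolding \<nu> by blast
    have "c \<omega>' = c (s, \<rho>) \<circ> inv' (gp s j)"
      using \<omega>'(3)
    proof (elim disjE conjE)
      assume "turn (s, \<rho>) = \<omega>'" "j = \<rho> 3"
      then show ?thesis using c \<rho>(1) by auto
    next
      assume *: "turn \<omega>' = (s, \<rho>)" "fst \<omega>' \<in> T" "snd \<omega>' 3 \<in> {1..4}" "gp s j = inv' (gp (fst \<omega>') (snd \<omega>' 3))"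
      \<comment> \<open>Walking backwards, the relation for the turn from \<open>\<omega>'\<close>
        to \<open>(s, \<rho>)\<close> is solved for \<open>c \<omega>'\<close>.\<close>
      have "c (s, \<rho>) = c \<omega>' \<circ> inv' (gp (fst \<omega>') (snd \<omega>' 3))"
        using c \<omega>'(1) *(1) by (cases \<omega>') auto
      then show ?thesis
        unfolding *(4) using permutes_inv_inv[OF nbr(2)[OF *(2,3)]] permutes_inv_o(2)[OF nbr(2)[OF *(2,3)]]
        by (simp add: comp_assoc)
    qed
    then show "C (nb s j, bpoint (cr (nb s j)) (\<nu> \<circ> inv' (gp s j))) = C (s, bpoint (cr s) \<nu>) \<circ> inv' (gp s j)"
      unfolding at \<omega>'(2)[symmetric] C[OF \<omega>'(1)] C[OF \<rho>(1)] .
  qed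
  then show ?thesis by blast
qed

end

section \<open>Local sections\<close>

context triangulated
begin

text \<open>A section of the covering by colourings. Local constancy is asked in each cell
  separately; \<open>compat\<close> ties the cells together.\<close>

definition sec :: "'a set \<Rightarrow> ('t \<times> (real^3) \<Rightarrow> nat \<Rightarrow> nat) \<Rightarrow> bool" where
  "sec U S \<longleftrightarrow> openin X U \<and> compat (pre U) S \<and>
     (\<forall>(t, y)\<in>pre U. \<forall>\<^sub>F y' in at y within cell \<T> t. S (t, y') = S (t, y))"

lemma secD:
  assumes "sec U S"
  shows "openin X U" "compat (pre U) S"
    "(t, y) \<in> pre U \<Longrightarrow> \<forall>\<^sub>F y' in at y within cell \<T> t. S (t, y') = S (t, y)"
  using assms unfolding sec_def by blast+

lemma pre_mono: "U \<subseteq> V \<Longrightarrow> pre U \<subseteq> pre V"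
  by (auto simp: pre_def)

lemma sec_subset:
  assumes "sec U S" "openin X V" "V \<subseteq> U"
  shows "sec V S"
  unfolding sec_def using secD(2,3)[OF assms(1)] assms(2) pre_mono[OF assms(3)] compat_subset by blast

lemma quotient_map_proj: "quotient_map (disjoint_union \<T>) X (proj \<T>)"
  using sing by (simp add: singular_triangulation_def)

lemma compact_cell: "t \<in> T \<Longrightarrow> compact (cell \<T> t)"
  using sing compact_simplex by (auto simp: singular_triangulation_def)

lemma openin_disjoint_union:
  "openin (disjoint_union \<T>) W \<longleftrightarrow> W \<subseteq> pre UNIV \<and> (\<forall>t\<in>T. openin (top_of_set (cell \<T> t)) {y. (t, y) \<in> W})"
  using topspace_disjoint_union by (auto simp: disjoint_union_def openin_sum_topology)

lemma compact_space_disjoint_union: "compact_space (disjoint_union \<T>)"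
proof -
  have "compactin (disjoint_union \<T>) (Pair t ` cell \<T> t)" if "t \<in> T" for t
  proof (rule image_compactin)
    show "compactin (top_of_set (cell \<T> t)) (cell \<T> t)"
      using compact_cell[OF that] by (simp add: compactin_subtopology)
    show "continuous_map (top_of_set (cell \<T> t)) (disjoint_union \<T>) (Pair t)"
      unfolding disjoint_union_def using that by (rule continuous_map_component_injection)
  qed
  then have "compactin (disjoint_union \<T>) (\<Union>t\<in>T. Pair t ` cell \<T> t)"
    using finite_T by (intro compactin_Union) auto
  moreover have "(\<Union>t\<in>T. Pair t ` cell \<T> t) = topspace (disjoint_union \<T>)"
    unfolding topspace_disjoint_union by (auto simp: pre_def)
  ultimately show ?thesis by (simp add: compact_space_def)
qed

text \<open>\<open>proj\<close> is closed, being a continuous map from a compact space to a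
  Hausdorff one, so a neighbourhood of a fibre contains a saturated one.\<close>

lemma fibre_neighbourhood:
  assumes haus: "Hausdorff_space X" and W: "openin (disjoint_union \<T>) W" "pre {x} \<subseteq> W" and x: "x \<in> topspace X"
  shows "\<exists>U. openin X U \<and> x \<in> U \<and> pre U \<subseteq> W"
proof -
  have "closed_map (disjoint_union \<T>) X (proj \<T>)"
    by (rule continuous_imp_closed_map[OF quotient_imp_continuous_map[OF quotient_map_proj]
          compact_space_disjoint_union haus])
  then have *: "\<And>U y. openin (disjoint_union \<T>) U \<and> y \<in> topspace X \<and>
      {x \<in> topspace (disjoint_union \<T>). proj \<T> x = y} \<subseteq> U \<Longrightarrow>
      \<exists>V. openin X V \<and> y \<in> V \<and> {x \<in> topspace (disjoint_union \<T>). proj \<T> x \<in> V} \<subseteq> U"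
    unfolding closed_map_fibre_neighbourhood by blast
  have eq: "{u \<in> topspace (disjoint_union \<T>). proj \<T> u \<in> V} = pre V" for V
    unfolding topspace_disjoint_union by (auto simp: pre_def)
  have "{u \<in> topspace (disjoint_union \<T>). proj \<T> u = x} = pre {x}" using eq[of "{x}"] by simp
  with *[of W x] W x show ?thesis unfolding eq by auto
qed

lemma proj_in: "u \<in> pre UNIV \<Longrightarrow> proj \<T> u \<in> topspace X"
  using quotient_imp_surjective_map[OF quotient_map_proj] unfolding topspace_disjoint_union by blast

lemma fibre_nonempty: "x \<in> topspace X \<Longrightarrow> pre {x} \<noteq> {}"
  using quotient_imp_surjective_map[OF quotient_map_proj] unfolding topspace_disjoint_union
  by (force simp: pre_def)

lemma continuous_on_proj:
  assumes "t \<in> T" "openin X U"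
  shows "openin (top_of_set (cell \<T> t)) {y. (t, y) \<in> pre U}"
proof -
  have "openin (disjoint_union \<T>) {u \<in> topspace (disjoint_union \<T>). proj \<T> u \<in> U}"
    using quotient_imp_continuous_map[OF quotient_map_proj] assms(2) openin_continuous_map_preimage by blast
  then have "openin (disjoint_union \<T>) (pre U)"
    unfolding topspace_disjoint_union by (simp add: pre_def case_prod_beta' conj_assoc)
  then show ?thesis using assms(1) unfolding openin_disjoint_union by blast
qed

text \<open>A compatible colouring of one fibre extends, by nearest points of the fibre.\<close>

lemma local_section:
  assumes haus: "Hausdorff_space X" and x: "x \<in> topspace X" and C: "compat (pre {x}) C"
  shows "\<exists>U S. sec U S \<and> x \<in> U \<and> (\<forall>u\<in>pre {x}. S u = C u)"
proof -
  let ?P = "pre {x}"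
  have finP: "finite ?P" by (rule finite_fibre)
  \<comment> \<open>At most half the least distance between fibre points in one cell: no point is
    closer than this to two of them.\<close>
  have "\<exists>d>0. \<forall>q\<in>?P \<times> ?P. fst (fst q) = fst (snd q) \<longrightarrow> snd (fst q) \<noteq> snd (snd q) \<longrightarrow>
      2 * d \<le> dist (snd (fst q)) (snd (snd q))"
  proof (rule finite_uniform_bound)
    fix q :: "('t \<times> (real^3)) \<times> ('t \<times> (real^3))"
    let ?d = "dist (snd (fst q)) (snd (snd q))"
    show "\<exists>d>0. fst (fst q) = fst (snd q) \<longrightarrow> snd (fst q) \<noteq> snd (snd q) \<longrightarrow> 2 * d \<le> ?d"
      by (cases "snd (fst q) = snd (snd q)") (auto intro: exI[of _ 1] exI[of _ "?d / 2"])
  qed (use finP in auto)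
  then obtain \<epsilon> where \<epsilon>: "\<epsilon> > 0" and
    "\<forall>q\<in>?P \<times> ?P. fst (fst q) = fst (snd q) \<longrightarrow> snd (fst q) \<noteq> snd (snd q) \<longrightarrow>
      2 * \<epsilon> \<le> dist (snd (fst q)) (snd (snd q))" by blast
  then have sep: "2 * \<epsilon> \<le> dist y z" if "(t, y) \<in> ?P" "(t, z) \<in> ?P" "y \<noteq> z" for t y z
    using that by force
  \<comment> \<open>The radius has two duties: a face that comes closer to a fibre point must
    contain it, and gluing maps keep nearby points within \<open>\<epsilon>\<close> of the image of
    the fibre point.\<close>
  define Q where "Q q d \<longleftrightarrow> (case q of ((t, y), i) \<Rightarrow>
      (y \<notin> face \<T> t i \<longrightarrow> (\<forall>y'\<in>face \<T> t i. d \<le> dist y y')) \<and>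
      (y \<in> face \<T> t i \<longrightarrow> (\<forall>y'\<in>face \<T> t i. dist y y' < d \<longrightarrow>
        dist (glue \<T> (t, face \<T> t i) y) (glue \<T> (t, face \<T> t i) y') < \<epsilon>)))" for q d
  have "\<exists>d>0. \<forall>q\<in>?P \<times> {1..4}. Q q d"
  proof (rule finite_uniform_bound)
    fix q assume "q \<in> ?P \<times> {1..4::nat}"
    then obtain t y i where q: "q = ((t, y), i)" "t \<in> T" "i \<in> {1..4}" by (auto simp: pre_def)
    show "\<exists>d>0. Q q d"
    proof (cases "y \<in> face \<T> t i")
      case True
      then obtain d where "d > 0" "\<And>y'. y' \<in> face \<T> t i \<Longrightarrow> dist y' y < d \<Longrightarrow>
          dist (glue \<T> (t, face \<T> t i) y') (glue \<T> (t, face \<T> t i) y) < \<epsilon>"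
        using continuous_glue[OF q(2,3)] \<epsilon> unfolding continuous_on_iff by metis
      then show ?thesis using True by (auto simp: Q_def q(1) dist_commute)
    next
      case False
      have "closed (face \<T> t i)"
        unfolding face_def by (intro compact_imp_closed finite_imp_compact_convex_hull) auto
      from separate_point_closed[OF this False]
      show ?thesis using False by (auto simp: Q_def q(1))
    qed
  next
    fix q d e assume "Q q d" "0 < e" "e \<le> d"
    then show "Q q e" by (fastforce simp: Q_def split: prod.splits)
  qed (use finP in auto)
  then obtain \<delta>' where \<delta>': "\<delta>' > 0" "\<forall>q\<in>?P \<times> {1..4}. Q q \<delta>'" by blast
  define \<delta> where "\<delta> = min \<delta>' \<epsilon>"
  have \<delta>: "\<delta> > 0" "\<delta> \<le> \<epsilon>" "\<delta> \<le> \<delta>'" using \<delta>' \<epsilon> by (auto simp: \<delta>_def)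
  have far: "\<delta> \<le> dist y y'" if "(t, y) \<in> ?P" "i \<in> {1..4}" "y \<notin> face \<T> t i" "y' \<in> face \<T> t i" for t y y' i
    using \<delta>'(2) that \<delta>(3) unfolding Q_def by fastforce
  have near: "dist (glue \<T> (t, face \<T> t i) y) (glue \<T> (t, face \<T> t i) y') < \<epsilon>"
    if "(t, y) \<in> ?P" "i \<in> {1..4}" "y \<in> face \<T> t i" "y' \<in> face \<T> t i" "dist y y' < \<delta>" for t y y' i
    using \<delta>'(2) that \<delta>(3) unfolding Q_def by fastforce
  define W where "W = {(t, y'). t \<in> T \<and> y' \<in> cell \<T> t \<and> (\<exists>y. (t, y) \<in> ?P \<and> dist y y' < \<delta>)}"
  have "openin (disjoint_union \<T>) W"
    unfolding openin_disjoint_union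
  proof (intro conjI ballI)
    show "W \<subseteq> pre UNIV" by (auto simp: W_def pre_def)
    fix t assume "t \<in> T"
    have "{y'. (t, y') \<in> W} = cell \<T> t \<inter> (\<Union>y\<in>{y. (t, y) \<in> ?P}. ball y \<delta>)"
      using \<open>t \<in> T\<close> by (auto simp: W_def)
    then show "openin (top_of_set (cell \<T> t)) {y'. (t, y') \<in> W}"
      by (simp add: openin_open_Int open_UN)
  qed
  moreover have "?P \<subseteq> W" using \<delta>(1) by (auto simp: W_def pre_def)
  ultimately obtain U where U: "openin X U" "x \<in> U" "pre U \<subseteq> W"
    using fibre_neighbourhood[OF haus _ _ x] by blast
  define S where "S u = C (fst u, SOME y. (fst u, y) \<in> ?P \<and> dist y (snd u) < \<delta>)" for u
  have S: "S (t, y') = C (t, y)" if "(t, y) \<in> ?P" "dist y y' < \<delta>" for t y y'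
  proof -
    define z where "z = (SOME z. (t, z) \<in> ?P \<and> dist z y' < \<delta>)"
    have z: "(t, z) \<in> ?P" "dist z y' < \<delta>"
      using someI[of "\<lambda>z. (t, z) \<in> ?P \<and> dist z y' < \<delta>" y] that by (auto simp: z_def)
    have "dist y z < 2 * \<epsilon>" using dist_triangle2[of y z y'] z(2) that(2) \<delta>(2) by linarith
    then have "y = z" using sep[OF that(1) z(1)] by force
    then show ?thesis by (simp add: S_def z_def)
  qed
  have "compat (pre U) S"
    unfolding compat_def
  proof (intro conjI ballI impI)
    fix u assume "u \<in> pre U"
    then obtain t y y' where "u = (t, y')" "(t, y) \<in> ?P" "dist y y' < \<delta>" using U(3) by (auto simp: W_def)
    then show "S u permutes {1..4}" using S compatD(1)[OF C] by simp
  next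
    fix t i \<mu> assume t: "t \<in> T" "i \<in> {1..4}" "\<mu> \<in> bary" "\<mu> i = 0" and pU: "(t, bpoint (cr t) \<mu>) \<in> pre U"
    define y' where "y' = bpoint (cr t) \<mu>"
    obtain y where y: "(t, y) \<in> ?P" "dist y y' < \<delta>" using pU U(3) by (auto simp: W_def y'_def)
    have y'F: "y' \<in> face \<T> t i" unfolding y'_def face_eq[OF t(1,2)] using t by blast
    have yF: "y \<in> face \<T> t i" using far[OF y(1) t(2) _ y'F] y(2) by force
    then obtain \<nu> where \<nu>: "\<nu> \<in> bary" "\<nu> i = 0" "y = bpoint (cr t) \<nu>" unfolding face_eq[OF t(1,2)] by blast
    define z z' where "z = bpoint (cr (nb t i)) (\<nu> \<circ> inv' (gp t i))"
      and "z' = bpoint (cr (nb t i)) (\<mu> \<circ> inv' (gp t i))"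
    have "glued \<T> (t, y) (nb t i, z)" "glued \<T> (t, y') (nb t i, z')"
      unfolding glued_iff z_def z'_def y'_def \<nu>(3)
      by (rule bexI[OF _ t(1)], rule bexI[OF _ t(2)], rule bexI[OF _ \<nu>(1)], simp add: \<nu>(2),
        rule bexI[OF _ t(1)], rule bexI[OF _ t(2)], rule bexI[OF _ t(3)], simp add: t(4))
    then have zP: "(nb t i, z) \<in> ?P" and z'U: "(nb t i, z') \<in> pre U"
      using glued_pre y(1) pU by (auto simp: pre_def y'_def)
    have "dist z z' < \<epsilon>"
      using near[OF y(1) t(2) yF y'F y(2)] nbr(4)[OF t(1,2) \<nu>(1,2)] nbr(4)[OF t]
      by (simp add: z_def z'_def \<nu>(3) y'_def)
    moreover obtain w where w: "(nb t i, w) \<in> ?P" "dist w z' < \<delta>" using z'U U(3) by (auto simp: W_def)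
    \<comment> \<open>\<open>z'\<close> is close both to \<open>z\<close>, the partner of the fibre
      point \<open>y\<close>, and to \<open>w\<close>, the fibre point that defines \<open>S\<close>
      there; separation identifies the two.\<close>
    ultimately have "dist z w < 2 * \<epsilon>" using dist_triangle2[of z w z'] \<delta>(2) by linarith
    then have "z = w" using sep[OF zP w(1)] by force
    then have "S (nb t i, z') = C (nb t i, z)" using S[OF w] by simp
    also have "\<dots> = C (t, y) \<circ> inv' (gp t i)"
      using compatD(2)[OF C t(1,2) \<nu>(1,2)] y(1) unfolding z_def \<nu>(3) by blast
    also have "\<dots> = S (t, y') \<circ> inv' (gp t i)" using S[OF y] by simp
    finally show "S (nb t i, bpoint (cr (nb t i)) (\<mu> \<circ> inv' (gp t i))) = S (t, bpoint (cr t) \<mu>) \<circ> inv' (gp t i)"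
      by (simp only: z'_def y'_def)
  qed
  moreover have "\<forall>\<^sub>F z in at y' within cell \<T> t. S (t, z) = S (t, y')" if ty: "(t, y') \<in> pre U" for t y'
  proof -
    obtain y where y: "(t, y) \<in> ?P" "dist y y' < \<delta>" using ty U(3) by (auto simp: W_def)
    have *: "S (t, z) = S (t, y')" if "dist z y' < \<delta> - dist y y'" for z
    proof -
      have "dist y z < \<delta>" using dist_triangle[of y z y'] that by (simp add: dist_commute)
      then show ?thesis using S[OF y(1)] y(2) by simp
    qed
    show ?thesis
      unfolding eventually_at
      by (rule exI[of _ "\<delta> - dist y y'"], intro conjI ballI impI *) (use y(2) in simp_all)
  qed
  ultimately have "sec U S" unfolding sec_def using U(1) by blast
  moreover have "\<forall>u\<in>?P. S u = C u" using S \<delta>(1) by auto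
  ultimately show ?thesis using U(2) by blast
qed

lemma sec_nonvertex:
  assumes haus: "Hausdorff_space X" and ev: "even_triangulation \<T>" and x: "x \<in> topspace X" "x \<notin> vertices \<T>"
  shows "\<exists>U S. sec U S \<and> x \<in> U"
proof -
  obtain t \<mu> where u: "t \<in> T" "\<mu> \<in> bary" "proj \<T> (t, bpoint (cr t) \<mu>) = x"
    using fibre_nonempty[OF x(1)] by (blast elim: pre_cases)
  define Z where "Z = {i \<in> {1..4}. \<mu> i = 0}"
  have finZ: "finite Z" by (simp add: Z_def)
  have "\<exists>C. compat (pre {x}) C"
  proof -
    consider "card Z = 0" | "card Z = 1" | "card Z = 2" | "card Z \<ge> 3" by linarith
    then show ?thesis
    proof cases
      case 1
      then have "\<mu> i \<noteq> 0" if "i \<in> {1..4}" for i using finZ that by (auto simp: Z_def)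
      then show ?thesis using compat_interior[OF u] by blast
    next
      case 2
      then obtain i where i: "Z = {i}" by (auto simp: card_1_singleton_iff)
      then have "i \<in> {1..4}" "\<And>j. j \<in> {1..4} \<Longrightarrow> \<mu> j = 0 \<longleftrightarrow> j = i" unfolding Z_def by blast+
      then show ?thesis using compat_face[OF u] by blast
    next
      case 3
      then obtain a b where ab: "Z = {a, b}" "a \<noteq> b" by (auto simp: card_2_iff)
      then have "a \<in> {1..4}" "b \<in> {1..4}" "\<And>j. j \<in> {1..4} \<Longrightarrow> \<mu> j = 0 \<longleftrightarrow> j = a \<or> j = b"
        unfolding Z_def by blast+
      then show ?thesis using compat_edge[OF ev u _ _ ab(2)] by blast
    next
      case 4
      \<comment> \<open>The coordinates sum to 1, so exactly one is nonzero, and the point is a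
        corner lying over \<open>x\<close>, which is not a vertex.\<close>
      have "\<exists>j\<in>{1..4}. \<mu> j \<noteq> 0"
      proof (rule ccontr)
        assume "\<not> (\<exists>j\<in>{1..4}. \<mu> j \<noteq> 0)"
        then have "sum \<mu> {1..4} = 0" by (intro sum.neutral) blast
        then show False using u(2) by (simp add: bary_def)
      qed
      then obtain j where j: "j \<in> {1..4}" "\<mu> j \<noteq> 0" by blast
      have "Z \<subseteq> {1..4} - {j}" using j by (auto simp: Z_def)
      moreover have "card ({1..4} - {j}) = 3" using j by simp
      ultimately have Z: "Z = {1..4} - {j}" using 4 by (intro card_seteq) auto
      have zero: "\<mu> i = 0" if "i \<noteq> j" for i
        using u(2) that Z unfolding bary_def Z_def by blast
      have "sum \<mu> {1..4} = \<mu> j"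
        using sum.mono_neutral_right[of "{1..4}" "{j}" \<mu>] j(1) zero
        by (simp del: atLeastAtMost_iff One_nat_def)
      then have "\<mu> = vertex_coord j" using u(2) zero by (auto simp: vertex_coord_def bary_def fun_eq_iff)
      then have "x = proj \<T> (t, cr t j)" using u(3) j by (simp add: bpoint_vertex_coord)
      moreover have "cr t j extreme_point_of cell \<T> t"
        unfolding corner(2)[OF u(1)] extreme_point_of_convex_hull_affine_independent[OF corner_indep[OF u(1)]]
        using j by blast
      ultimately show ?thesis using x(2) u(1) by (auto simp: vertices_def)
    qed
  qed
  then show ?thesis using local_section[OF haus x(1)] by blast
qed

text \<open>A colouring of a fibre is determined by its value at one point, so
  \<open>S (pick x)\<close> encodes it as an element of Sym(4).\<close>

definition pick :: "'a \<Rightarrow> 't \<times> (real^3)" where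
  "pick x = (SOME u. u \<in> pre {x})"

lemma pick: "x \<in> topspace X \<Longrightarrow> pick x \<in> pre {x}"
  unfolding pick_def by (rule someI_ex[of "\<lambda>u. u \<in> pre {x}"]) (use fibre_nonempty in blast)

lemma sec_ratio:
  assumes "sec U S" "sec V S'" "x \<in> U" "x \<in> V" "u \<in> pre {x}" "v \<in> pre {x}"
  shows "S' v \<circ> inv' (S v) = S' u \<circ> inv' (S u)"
proof (rule compat_ratio[OF _ _ _ assms(5,6)])
  show "compat (pre (U \<inter> V)) S" "compat (pre (U \<inter> V)) S'"
    using secD(2)[OF assms(1)] secD(2)[OF assms(2)] by (auto intro: compat_subset simp: pre_def)
  show "pre {x} \<subseteq> pre (U \<inter> V)" using assms by (intro pre_mono) auto
qed

lemma sec_permutes: "sec U S \<Longrightarrow> u \<in> pre U \<Longrightarrow> S u permutes {1..4}"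
  using compatD(1) secD(2) by blast

text \<open>The ratio is constant on fibres, so its level sets pull back to saturated sets. Openness
  can thus be checked in the cells, where both colourings are locally constant.\<close>

lemma openin_sec_ratio:
  assumes S: "sec U S" "sec V S'"
  shows "openin X {x \<in> U \<inter> V. S' (pick x) \<circ> inv' (S (pick x)) = \<gamma>}"
proof -
  let ?A = "{x \<in> U \<inter> V. S' (pick x) \<circ> inv' (S (pick x)) = \<gamma>}"
  have UV: "U \<subseteq> topspace X" "V \<subseteq> topspace X" using secD(1) S openin_subset by blast+
  have eq: "S' (pick (proj \<T> u)) \<circ> inv' (S (pick (proj \<T> u))) = S' u \<circ> inv' (S u)"
    if "u \<in> pre (U \<inter> V)" for u
    using sec_ratio[OF S, of "proj \<T> u" u "pick (proj \<T> u)"] that pick[of "proj \<T> u"] UV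
    by (auto simp: pre_def)
  have preA: "pre ?A = {u \<in> pre (U \<inter> V). S' u \<circ> inv' (S u) = \<gamma>}"
  proof -
    have "pre ?A = {u \<in> pre (U \<inter> V). S' (pick (proj \<T> u)) \<circ> inv' (S (pick (proj \<T> u))) = \<gamma>}"
      unfolding pre_def by auto
    then show ?thesis using eq by auto
  qed
  have "openin (disjoint_union \<T>) (pre ?A)"
    unfolding openin_disjoint_union
  proof (intro conjI ballI)
    show "pre ?A \<subseteq> pre UNIV" by (rule pre_mono) blast
    fix t assume t: "t \<in> T"
    show "openin (top_of_set (cell \<T> t)) {y. (t, y) \<in> pre ?A}"
      unfolding openin_subopen[of _ "{y. (t, y) \<in> pre ?A}"]
    proof clarify
      fix y assume y: "(t, y) \<in> pre ?A"
      then have yU: "(t, y) \<in> pre U" "(t, y) \<in> pre V" "(t, y) \<in> pre (U \<inter> V)" "y \<in> cell \<T> t" by (auto simp: pre_def)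
      have "openin (top_of_set (cell \<T> t)) {y. (t, y) \<in> pre (U \<inter> V)}"
        by (rule continuous_on_proj[OF t openin_Int[OF secD(1)[OF S(1)] secD(1)[OF S(2)]]])
      with yU have "\<forall>\<^sub>F z in at y within cell \<T> t. (t, z) \<in> pre (U \<inter> V)"
        using eventually_at_within_openin[of "cell \<T> t" "{y. (t, y) \<in> pre (U \<inter> V)}" y] by simp
      then have "\<forall>\<^sub>F z in at y within cell \<T> t. (t, z) \<in> pre ?A"
        using secD(3)[OF S(1) yU(1)] secD(3)[OF S(2) yU(2)]
        by eventually_elim (use y in \<open>simp only: preA mem_Collect_eq simp_thms\<close>)
      then obtain O' where O': "open O'" "y \<in> O'" "\<And>z. z \<in> O' \<Longrightarrow> z \<noteq> y \<Longrightarrow> z \<in> cell \<T> t \<Longrightarrow> (t, z) \<in> pre ?A"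
        by (auto simp: eventually_at_topological)
      then have "cell \<T> t \<inter> O' \<subseteq> {y. (t, y) \<in> pre ?A}" using y by fast
      then show "\<exists>O''. openin (top_of_set (cell \<T> t)) O'' \<and> y \<in> O'' \<and> O'' \<subseteq> {y. (t, y) \<in> pre ?A}"
        using O' yU(4) by (intro exI[of _ "cell \<T> t \<inter> O'"]) (auto simp: openin_open_Int)
    qed
  qed
  moreover have "pre ?A = {u \<in> topspace (disjoint_union \<T>). proj \<T> u \<in> ?A}"
    unfolding topspace_disjoint_union by (auto simp: pre_def)
  moreover have "openin (disjoint_union \<T>) {u \<in> topspace (disjoint_union \<T>). proj \<T> u \<in> B} \<longleftrightarrow> openin X B"
    if "B \<subseteq> topspace X" for B
    using quotient_map_proj that unfolding quotient_map_def by blast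
  moreover have "?A \<subseteq> topspace X" using UV(1) by blast
  ultimately show ?thesis by (simp only:)
qed

end

section \<open>Extension over the vertex\<close>

text \<open>Turns equality of ratios at two points of a fibre into equality of the transports
  between these points; this gives independence of the local section used.\<close>

lemma permutes_ratio:
  assumes "p permutes A" "q permutes A" "r permutes A" "s permutes A" "p \<circ> inv' q = r \<circ> inv' s"
  shows "inv' q \<circ> s = inv' p \<circ> r"
proof -
  have "inv' q \<circ> s = inv' p \<circ> (p \<circ> inv' q) \<circ> s"
    using permutes_inv_o(2)[OF assms(1)] by (simp flip: comp_assoc)
  also have "\<dots> = inv' p \<circ> r \<circ> (inv' s \<circ> s)" unfolding assms(5) by (simp only: comp_assoc)
  also have "\<dots> = inv' p \<circ> r" using permutes_inv_o(2)[OF assms(4)] by simp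
  finally show ?thesis .
qed

lemma eventually_within_relative:
  assumes "\<forall>\<^sub>F y in at x within Y. P y" "\<forall>\<^sub>F y in at x within C. y \<in> Y"
  shows "\<forall>\<^sub>F y in at x within C. P y"
  using assms unfolding eventually_at_filter by eventually_elim blast

locale triangulated_set = triangulated "top_of_set M" \<T>
  for M :: "'a::topological_space set" and \<T> :: "('t, 'a) triangulation_data" +
  assumes haus: "Hausdorff_space (top_of_set M)"
begin

definition sections :: "'a set \<Rightarrow> ('a set \<times> ('a \<Rightarrow> nat \<Rightarrow> nat)) set" where
  "sections N = {(U, \<lambda>x. S (pick x)) |U S. sec U S \<and> U \<subseteq> N}"

lemma sec_subset_M: "sec U S \<Longrightarrow> U \<subseteq> M"
  using secD(1) openin_subset by fastforce

lemma pick_pre: "x \<in> U \<Longrightarrow> U \<subseteq> M \<Longrightarrow> pick x \<in> pre U"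
  using pick[of x] by (auto simp: pre_def)

lemma sec_pick_permutes: "sec U S \<Longrightarrow> x \<in> U \<Longrightarrow> S (pick x) permutes {1..4}"
  using sec_permutes pick_pre sec_subset_M by blast

lemma inv_sym_group: "p permutes {1..n} \<Longrightarrow> inv\<^bsub>sym_group n\<^esub> p = inv' p"
  by (rule sym_group_inv_equality) (simp only: sym_group_carrier)

lemma flat_system_sections:
  assumes N: "openin (top_of_set M) N" and cov: "\<And>x. x \<in> N \<Longrightarrow> \<exists>U S. sec U S \<and> x \<in> U"
  shows "flat_system (sym_group 4) N (sections N)"
proof (rule flat_system.intro[OF sym_group_is_group flat_system_axioms.intro])
  have NM: "N \<subseteq> M" using openin_subset[OF N] by simp
  show "openin (top_of_set N) U" if "(U, s) \<in> sections N" for U s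
    using that secD(1) NM unfolding sections_def by (blast intro: openin_subset_trans)
  show "s x \<in> carrier (sym_group 4)" if "(U, s) \<in> sections N" "x \<in> U" for U s x
    using that sec_pick_permutes unfolding sections_def sym_group_carrier by blast
  show "\<exists>(U, s)\<in>sections N. x \<in> U" if x: "x \<in> N" for x
  proof -
    obtain U S where U: "sec U S" "x \<in> U" using cov[OF x] by blast
    have "sec (U \<inter> N) S" by (rule sec_subset[OF U(1) openin_Int[OF secD(1)[OF U(1)] N]]) blast
    then have "(U \<inter> N, \<lambda>x. S (pick x)) \<in> sections N" unfolding sections_def by blast
    then show ?thesis using U(2) x by blast
  qed
  fix U s V t x assume Us: "(U, s) \<in> sections N" "(V, t) \<in> sections N" "x \<in> U" "x \<in> V"
  then obtain S S' where S: "sec U S" "U \<subseteq> N" "s = (\<lambda>x. S (pick x))"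
    and S': "sec V S'" "V \<subseteq> N" "t = (\<lambda>x. S' (pick x))" unfolding sections_def by blast
  have eq: "t y \<otimes>\<^bsub>sym_group 4\<^esub> inv\<^bsub>sym_group 4\<^esub> s y = S' (pick y) \<circ> inv' (S (pick y))" if "y \<in> U" for y
    using inv_sym_group[OF sec_pick_permutes[OF S(1) that]] by (simp add: S(3) S'(3) sym_group_mult)
  let ?A = "{y \<in> U \<inter> V. S' (pick y) \<circ> inv' (S (pick y)) = S' (pick x) \<circ> inv' (S (pick x))}"
  have "openin (top_of_set N) ?A"
    by (rule openin_subset_trans[OF openin_sec_ratio[OF S(1) S'(1)] _ NM]) (use S(2) in blast)
  then have "\<forall>\<^sub>F y in at x within N. y \<in> ?A"
    by (rule eventually_at_within_openin) (use Us in blast)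
  then show "\<forall>\<^sub>F y in at x within N. t y \<otimes>\<^bsub>sym_group 4\<^esub> inv\<^bsub>sym_group 4\<^esub> s y
      = t x \<otimes>\<^bsub>sym_group 4\<^esub> inv\<^bsub>sym_group 4\<^esub> s x"
    by eventually_elim (use eq Us(3) in auto)
qed

lemma proj_continuous: "t \<in> T \<Longrightarrow> continuous_on (cell \<T> t) (\<lambda>y. proj \<T> (t, y))"
  and proj_in_M: "t \<in> T \<Longrightarrow> y \<in> cell \<T> t \<Longrightarrow> proj \<T> (t, y) \<in> M"
proof -
  assume t: "t \<in> T"
  have "continuous_map (top_of_set (cell \<T> t)) (top_of_set M) (proj \<T> \<circ> Pair t)"
    by (rule continuous_map_compose[OF _ quotient_imp_continuous_map[OF quotient_map_proj]],
      unfold disjoint_union_def, rule continuous_map_component_injection[OF t])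
  then show "continuous_on (cell \<T> t) (\<lambda>y. proj \<T> (t, y))" by (simp add: o_def)
  show "y \<in> cell \<T> t \<Longrightarrow> proj \<T> (t, y) \<in> M" using proj_in[of "(t, y)"] t by (simp add: pre_def)
qed

text \<open>A lift of the inclusion prescribes the colouring at \<open>pick x\<close>. Any local
  section \<open>S\<close> transports it to another point \<open>u\<close> of the fibre by
  \<open>inv' (S (pick x)) \<circ> S u\<close>, with the same result for every
  \<open>S\<close>.\<close>

lemma sec_of_flat:
  assumes fs: "flat_system (sym_group 4) N (sections N)" and N: "openin (top_of_set M) N"
    and W: "openin (top_of_set M) W" "W \<subseteq> N"
    and k: "flat_system.flat (sym_group 4) (sections N) W (\<lambda>x. x) k"
  shows "\<exists>K. sec W K"
proof -
  interpret F: flat_system "sym_group 4" N "sections N" by (rule fs)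
  have WM: "W \<subseteq> M" using openin_subset[OF W(1)] by simp
  have local: "\<exists>U S. sec U S \<and> U \<subseteq> N \<and> x \<in> U" if "x \<in> W" for x
    using F.cover[of x] that W(2) unfolding sections_def by blast
  define K where "K u = (let x = proj \<T> u; S = (SOME S. \<exists>U. sec U S \<and> x \<in> U)
    in k x \<circ> (inv' (S (pick x)) \<circ> S u))" for u
  have K: "K u = k (proj \<T> u) \<circ> (inv' (S (pick (proj \<T> u))) \<circ> S u)"
    if U: "sec U S" "proj \<T> u \<in> U" and u: "u \<in> pre UNIV" for U S u
  proof -
    let ?x = "proj \<T> u"
    define S0 where "S0 = (SOME S. \<exists>U. sec U S \<and> ?x \<in> U)"
    obtain U0 where U0: "sec U0 S0" "?x \<in> U0"
      using someI[of "\<lambda>S. \<exists>U. sec U S \<and> ?x \<in> U" S] U unfolding S0_def by blast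
    have ux: "u \<in> pre {?x}" "u \<in> pre U" "u \<in> pre U0" using u U(2) U0(2) by (auto simp: pre_def)
    have pk: "pick ?x \<in> pre {?x}" using sec_subset_M[OF U(1)] U(2) by (intro pick) auto
    have "S (pick ?x) \<circ> inv' (S0 (pick ?x)) = S u \<circ> inv' (S0 u)"
      by (rule sec_ratio[OF U0(1) U(1) U0(2) U(2) ux(1) pk])
    then have "inv' (S0 (pick ?x)) \<circ> S0 u = inv' (S (pick ?x)) \<circ> S u"
      by (intro permutes_ratio[where A = "{1..4}"] sec_pick_permutes[OF U] sec_pick_permutes[OF U0]
          sec_permutes[OF U(1) ux(2)] sec_permutes[OF U0(1) ux(3)])
    then show ?thesis unfolding K_def S0_def[symmetric] Let_def by simp
  qed
  have kp: "k x permutes {1..4}" if "x \<in> W" for x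
    using F.flat_closed[OF k that] by (simp only: sym_group_carrier)
  have "compat (pre W) K"
    unfolding compat_def
  proof (intro conjI ballI impI)
    fix u assume u: "u \<in> pre W"
    then have "proj \<T> u \<in> W" by (auto simp: pre_def)
    then obtain U S where U: "sec U S" "proj \<T> u \<in> U" using local by blast
    have u': "u \<in> pre UNIV" "u \<in> pre U" "proj \<T> u \<in> W" using u U(2) by (auto simp: pre_def)
    show "K u permutes {1..4}"
      unfolding K[OF U u'(1)]
      by (intro permutes_compose permutes_inv kp u'(3) sec_pick_permutes[OF U] sec_permutes[OF U(1) u'(2)])
  next
    fix t i \<mu> assume t: "t \<in> T" "i \<in> {1..4}" "\<mu> \<in> bary" "\<mu> i = 0" and u: "(t, bpoint (cr t) \<mu>) \<in> pre W"
    let ?u = "(t, bpoint (cr t) \<mu>)" and ?v = "(nb t i, bpoint (cr (nb t i)) (\<mu> \<circ> inv' (gp t i)))"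
    have "proj \<T> ?u \<in> W" using u by (simp add: pre_def)
    then obtain U S where U: "sec U S" "proj \<T> ?u \<in> U" using local by blast
    have g: "glued \<T> ?u ?v" unfolding glued_iff using t
      by (intro bexI[OF _ t(1)] bexI[OF _ t(2)] bexI[OF _ t(3)]) simp
    note gp = glued_pre[OF g]
    have uU: "?u \<in> pre U" using U(2) gp(1) by (auto simp: pre_def)
    have "K ?v = k (proj \<T> ?v) \<circ> (inv' (S (pick (proj \<T> ?v))) \<circ> S ?v)"
      by (rule K[OF U(1) _ gp(2)]) (use U(2) gp(3) in simp)
    also have "S ?v = S ?u \<circ> inv' (gp t i)" by (rule compatD(2)[OF secD(2)[OF U(1)] t uU])
    finally show "K ?v = K ?u \<circ> inv' (gp t i)"
      unfolding K[OF U gp(1)] gp(3) by (simp only: comp_assoc)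
  qed
  moreover have "\<forall>\<^sub>F y' in at y within cell \<T> t. K (t, y') = K (t, y)" if u: "(t, y) \<in> pre W" for t y
  proof -
    let ?x = "proj \<T> (t, y)"
    have t: "t \<in> T" "y \<in> cell \<T> t" "?x \<in> W" using u by (auto simp: pre_def)
    obtain U S where U: "sec U S" "U \<subseteq> N" "?x \<in> U" using local[OF t(3)] by blast
    have s: "(U, \<lambda>x. S (pick x)) \<in> sections N" unfolding sections_def using U by blast
    have WU: "openin (top_of_set M) (W \<inter> U)" by (rule openin_Int[OF W(1) secD(1)[OF U(1)]])
    let ?Y = "{z. (t, z) \<in> pre (W \<inter> U)}"
    have Y: "\<forall>\<^sub>F z in at y within cell \<T> t. z \<in> ?Y"
      by (rule eventually_at_within_openin[OF continuous_on_proj[OF t(1) WU]]) (use t U in \<open>simp add: pre_def\<close>)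
    have Yc: "?Y \<subseteq> cell \<T> t" by (auto simp: pre_def)
    \<comment> \<open>\<open>K (t, z)\<close> is \<open>?c\<close> at the image of \<open>z\<close>,
      locally constant by flatness, composed with the locally constant
      \<open>S (t, z)\<close>.\<close>
    let ?c = "\<lambda>x. k x \<circ> inv' (S (pick x))"
    have ev: "\<forall>\<^sub>F x in at ?x within W. x \<in> U \<and> k x \<otimes>\<^bsub>sym_group 4\<^esub> inv\<^bsub>sym_group 4\<^esub> S (pick x)
        = k ?x \<otimes>\<^bsub>sym_group 4\<^esub> inv\<^bsub>sym_group 4\<^esub> S (pick ?x)"
      by (rule F.flatD[OF k t(3) s U(3)])
    have conv: "k x \<otimes>\<^bsub>sym_group 4\<^esub> inv\<^bsub>sym_group 4\<^esub> S (pick x) = ?c x" if "x \<in> U" for x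
      using inv_sym_group[OF sec_pick_permutes[OF U(1) that]] by (simp add: sym_group_mult)
    from ev have "\<forall>\<^sub>F x in at ?x within W. ?c x = ?c ?x"
      by eventually_elim (use conv U(3) in metis)
    then have "\<forall>\<^sub>F z in at y within ?Y. ?c (proj \<T> (t, z)) = ?c ?x"
      by (rule eventually_at_within_continuous[of ?Y "\<lambda>z. proj \<T> (t, z)" W, rotated 3])
        (use continuous_on_subset[OF proj_continuous[OF t(1)] Yc] t U in \<open>auto simp: pre_def\<close>)
    from eventually_within_relative[OF this Y]
    have evc: "\<forall>\<^sub>F z in at y within cell \<T> t. ?c (proj \<T> (t, z)) = ?c ?x" .
    have uU: "(t, y) \<in> pre U" using t U(3) by (simp add: pre_def)
    show ?thesis using evc secD(3)[OF U(1) uU] Y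
    proof eventually_elim
      case (elim z)
      then have z: "(t, z) \<in> pre UNIV" "proj \<T> (t, z) \<in> U" by (auto simp: pre_def)
      have y: "(t, y) \<in> pre UNIV" using t by (simp add: pre_def)
      show "K (t, z) = K (t, y)"
        using elim(1,2) unfolding K[OF U(1) z(2,1)] K[OF U(1,3) y] by (simp only: comp_assoc[symmetric])
    qed
  qed
  ultimately have "sec W K" unfolding sec_def using W(1) by blast
  then show ?thesis by blast
qed

text \<open>Points moving along an edge towards corner \<open>j\<close> stay in both faces of the
  cell at that edge, so the gluing condition can be carried to the limit
  \<open>s = 0\<close>.\<close>

definition edge_point :: "'t \<Rightarrow> nat \<Rightarrow> nat \<Rightarrow> real \<Rightarrow> real^3" where
  "edge_point t j k s = (1 - s) *\<^sub>R cr t j + s *\<^sub>R cr t k"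

definition edge_coord :: "nat \<Rightarrow> nat \<Rightarrow> real \<Rightarrow> nat \<Rightarrow> real" where
  "edge_coord j k s = (\<lambda>i. (1 - s) * vertex_coord j i + s * vertex_coord k i)"

lemma edge_coord_bary:
  assumes "j \<in> {1..4}" "k \<in> {1..4}" "0 \<le> s" "s \<le> 1"
  shows "edge_coord j k s \<in> bary"
  using vertex_coord_bary[OF assms(1)] vertex_coord_bary[OF assms(2)] assms(3,4)
  by (auto simp: bary_def edge_coord_def sum.distrib simp flip: sum_distrib_left)

lemma bpoint_edge_coord:
  assumes "j \<in> {1..4}" "k \<in> {1..4}"
  shows "bpoint (cr t) (edge_coord j k s) = edge_point t j k s"
proof -
  have "bpoint (cr t) (edge_coord j k s)
      = (1 - s) *\<^sub>R bpoint (cr t) (vertex_coord j) + s *\<^sub>R bpoint (cr t) (vertex_coord k)"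
    by (simp add: bpoint_def edge_coord_def scaleR_add_left sum.distrib scaleR_sum_right)
  then show ?thesis using assms by (simp add: bpoint_vertex_coord edge_point_def)
qed

lemma filterlim_edge_point:
  assumes t: "t \<in> T" and jk: "j \<in> {1..4}" "k \<in> {1..4}" "j \<noteq> k"
  shows "filterlim (edge_point t j k) (at (cr t j) within cell \<T> t) (at_right 0)"
  unfolding filterlim_at
proof
  have "\<forall>\<^sub>F s in at_right (0::real). 0 < s \<and> s < 1"
    by (rule eventually_conj[OF eventually_at_right_less eventually_at_right_real[of 0 1, THEN eventually_mono]]) auto
  then show "\<forall>\<^sub>F s in at_right 0. edge_point t j k s \<in> cell \<T> t \<and> edge_point t j k s \<noteq> cr t j"
  proof eventually_elim
    case (elim s)
    have b: "edge_coord j k s \<in> bary" by (rule edge_coord_bary) (use jk elim in auto)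
    have "edge_coord j k s k \<noteq> vertex_coord j k" using jk elim by (simp add: edge_coord_def vertex_coord_def)
    then have "bpoint (cr t) (edge_coord j k s) \<noteq> bpoint (cr t) (vertex_coord j)"
      using bp_inj[OF t b vertex_coord_bary[OF jk(1)]] by metis
    then show ?case
      using bpoint_in_cell[OF t b] unfolding bpoint_edge_coord[OF jk(1,2)] bpoint_vertex_coord[OF jk(1)] by blast
  qed
  have "(edge_point t j k \<longlongrightarrow> (1 - 0) *\<^sub>R cr t j + 0 *\<^sub>R cr t k) (at_right 0)"
    unfolding edge_point_def by (intro tendsto_intros)
  then show "(edge_point t j k \<longlongrightarrow> cr t j) (at_right 0)" by simp
qed

lemma fibre_vertex:
  assumes t: "t \<in> T" "j \<in> {1..4}" and s: "s \<in> T" "\<mu> \<in> bary"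
    and eq: "proj \<T> (s, bpoint (cr s) \<mu>) = proj \<T> (t, cr t j)"
  shows "\<exists>i\<in>{1..4}. \<mu> = vertex_coord i"
proof -
  obtain \<rho> where \<rho>: "\<rho> permutes {1..4}" "\<mu> = vertex_coord j \<circ> \<rho>"
    using fibre_coords'[OF t(1) vertex_coord_bary[OF t(2)] s] eq
    unfolding bpoint_vertex_coord[OF t(2)] by blast
  have "vertex_coord j \<circ> \<rho> = vertex_coord (inv' \<rho> j)"
    using vertex_coord_permute[OF permutes_inv[OF \<rho>(1)], of j] permutes_inv_inv[OF \<rho>(1)] by simp
  then show ?thesis using \<rho> permutes_in_image[OF permutes_inv[OF \<rho>(1)]] t(2) by blast
qed

lemma proj_corner:
  assumes "vertices \<T> = {v}" "t \<in> T" "j \<in> {1..4}"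
  shows "proj \<T> (t, cr t j) = v" "cr t j extreme_point_of cell \<T> t"
proof -
  show ex: "cr t j extreme_point_of cell \<T> t"
    unfolding corner(2)[OF assms(2)] extreme_point_of_convex_hull_affine_independent[OF corner_indep[OF assms(2)]]
    using assms(3) by blast
  then have "proj \<T> (t, cr t j) \<in> vertices \<T>" using assms(2) unfolding vertices_def by blast
  then show "proj \<T> (t, cr t j) = v" using assms(1) by simp
qed

text \<open>Near a corner, the cell without the corner is convex, hence connected.\<close>

lemma sec_limit_at_corner:
  assumes v: "vertices \<T> = {v}" and U: "openin (top_of_set M) U" "v \<in> U" and K: "sec (U - {v}) K"
    and t: "t \<in> T" "j \<in> {1..4}"
  shows "\<exists>\<gamma>. \<forall>\<^sub>F y in at (cr t j) within cell \<T> t. (t, y) \<in> pre (U - {v}) \<and> K (t, y) = \<gamma>"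
proof -
  note pc = proj_corner[OF v t]
  let ?c = "cr t j"
  have cc: "?c \<in> cell \<T> t" using pc(2) by (simp add: extreme_point_of_def)
  have "\<forall>\<^sub>F y in at ?c within cell \<T> t. y \<in> {y. (t, y) \<in> pre U}"
    by (rule eventually_at_within_openin[OF continuous_on_proj[OF t(1) U(1)]])
      (use t cc pc U in \<open>simp add: pre_def\<close>)
  then obtain d1 where d1: "d1 > 0" "\<And>y. y \<in> cell \<T> t \<Longrightarrow> y \<noteq> ?c \<Longrightarrow> dist y ?c < d1 \<Longrightarrow> (t, y) \<in> pre U"
    unfolding eventually_at by auto
  have "finite (snd ` pre {v})" using finite_fibre by blast
  \<comment> \<open>\<open>d2\<close> keeps the ball away from the other corners of the cell, which
    may also lie over \<open>v\<close>.\<close>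
  then obtain d2 where d2: "d2 > 0" "\<And>y. y \<in> snd ` pre {v} \<Longrightarrow> y \<noteq> ?c \<Longrightarrow> d2 \<le> dist ?c y"
    using finite_set_avoid[of "snd ` pre {v}" ?c] by blast
  define d where "d = min d1 d2"
  define B where "B = (ball ?c d \<inter> cell \<T> t) - {?c}"
  have d: "d > 0" using d1 d2 by (simp add: d_def)
  have BW: "(t, y) \<in> pre (U - {v})" if "y \<in> B" for y
  proof -
    have y: "y \<in> cell \<T> t" "y \<noteq> ?c" "dist y ?c < d1" "dist ?c y < d2"
      using that by (auto simp: B_def d_def dist_commute)
    have "(t, y) \<in> pre U" using d1(2) y by blast
    moreover have "(t, y) \<notin> pre {v}" using d2(2)[of y] y(2,4) by force
    ultimately show ?thesis by (auto simp: pre_def)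
  qed
  have "?c extreme_point_of (ball ?c d \<inter> cell \<T> t)"
    using pc(2) d by (auto simp: extreme_point_of_def)
  moreover have "convex (ball ?c d \<inter> cell \<T> t)"
    unfolding corner(2)[OF t(1)] by (intro convex_Int convex_ball convex_convex_hull)
  ultimately have "convex B" unfolding B_def by (simp add: extreme_point_of_stillconvex)
  then have conn: "connected B" by (rule convex_connected)
  have const: "K (t, y) = K (t, z)" if "y \<in> B" "z \<in> B" for y z
  proof (rule connected_local_const[OF conn that], intro ballI)
    fix a assume a: "a \<in> B"
    have "\<forall>\<^sub>F b in at a within cell \<T> t. K (t, b) = K (t, a)" by (rule secD(3)[OF K BW[OF a]])
    then have "\<forall>\<^sub>F b in at a within B. K (t, b) = K (t, a)"
      by (rule filter_leD[OF at_le, rotated]) (auto simp: B_def)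
    then show "\<forall>\<^sub>F b in at a within B. K (t, a) = K (t, b)" by eventually_elim simp
  qed
  have "\<forall>\<^sub>F y in at ?c within cell \<T> t. y \<in> B"
    unfolding eventually_at using d by (intro exI[of _ d]) (auto simp: B_def dist_commute)
  then show ?thesis
    by (intro exI[of _ "K (t, SOME y. y \<in> B)"], elim eventually_mono)
      (use const BW someI[of "\<lambda>y. y \<in> B"] in blast)
qed

text \<open>The chart turns the punctured neighbourhood into a punctured Euclidean space, where
  simple connectedness gives a lift. Its limits at the corners colour the fibre of \<open>v\<close>;
  they inherit the gluing condition from an edge that ends at the corner and lies in the glued
  face.\<close>

lemma sec_vertex:
  assumes ev: "even_triangulation \<T>" and mf: "manifold3 (top_of_set M)" and v: "vertices \<T> = {v}" "v \<in> M"
  shows "\<exists>U S. sec U S \<and> v \<in> U"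
proof -
  define N where "N = M - {v}"
  have N: "openin (top_of_set M) N"
    unfolding N_def using openin_diff[OF openin_topspace closedin_Hausdorff_singleton[OF haus, of v]] v(2) by simp
  have cov: "\<exists>U S. sec U S \<and> x \<in> U" if "x \<in> N" for x
    using sec_nonvertex[OF haus ev, of x] that v by (simp add: N_def)
  note fs = flat_system_sections[OF N cov]
  interpret F: flat_system "sym_group 4" N "sections N" by (rule fs)
  obtain U where U: "openin (top_of_set M) U" "v \<in> U"
    "subtopology (top_of_set M) U homeomorphic_space (euclidean :: (real^3) topology)"
    using mf v(2) unfolding manifold3_def by auto
  have UM: "U \<subseteq> M" using openin_subset[OF U(1)] by simp
  have "subtopology (top_of_set M) U = top_of_set U"
    using UM by (simp add: subtopology_subtopology Int_absorb1)
  then obtain f g where fg: "homeomorphic_maps (top_of_set U) (euclidean :: (real^3) topology) f g"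
    using U(3) unfolding homeomorphic_space_def by auto
  have f: "continuous_on U f" and g: "continuous_on UNIV g" "g \<in> UNIV \<rightarrow> U"
    and gf: "\<And>x. x \<in> U \<Longrightarrow> g (f x) = x" and fg': "\<And>z. f (g z) = z"
    using fg by (auto simp: homeomorphic_maps_def continuous_map_in_subtopology)
  define Z where "Z = - {f v}"
  define W where "W = U - {v}"
  have W: "openin (top_of_set M) W" "W \<subseteq> N"
  proof -
    have "W = U \<inter> N" using UM by (auto simp: W_def N_def)
    then show "openin (top_of_set M) W" "W \<subseteq> N" using openin_Int[OF U(1) N] by auto
  qed
  have "g z \<noteq> v" if "z \<in> Z" for z using fg'[of z] that by (auto simp: Z_def)
  then have gZ: "g \<in> Z \<rightarrow> N" using g(2) UM by (auto simp: N_def)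
  have "\<exists>k. F.flat Z g k"
  proof (rule F.flat_exists_simply_connected[OF _ _ _ gZ])
    show "open Z" by (simp add: Z_def open_Compl)
    show "simply_connected Z" unfolding Z_def by (rule simply_connected_punctured_universe) simp
    show "continuous_on Z g" using g(1) by (rule continuous_on_subset) simp
  qed
  then obtain k where k: "F.flat Z g k" ..
  have fW: "f \<in> W \<rightarrow> Z" using gf by (auto simp: W_def Z_def U(2)) (metis U(2))
  have "F.flat W (g \<circ> f) (k \<circ> f)"
    by (rule F.flat_compose[OF k continuous_on_subset[OF f] fW]) (auto simp: W_def)
  then have "F.flat W (\<lambda>x. x) (k \<circ> f)"
    by (rule F.flat_cong) (auto simp: W_def gf)
  then obtain K where K: "sec (U - {v}) K" using sec_of_flat[OF fs N W] unfolding W_def by blast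
  define C where "C u = (SOME \<gamma>. \<forall>\<^sub>F y in at (snd u) within cell \<T> (fst u).
      (fst u, y) \<in> pre (U - {v}) \<and> K (fst u, y) = \<gamma>)" for u
  have C: "\<forall>\<^sub>F y in at (cr t j) within cell \<T> t. (t, y) \<in> pre (U - {v}) \<and> K (t, y) = C (t, cr t j)"
    if "t \<in> T" "j \<in> {1..4}" for t j
    using someI_ex[OF sec_limit_at_corner[OF v(1) U(1,2) K that]] by (simp add: C_def)
  have Cs: "\<forall>\<^sub>F s in at_right 0. (t, edge_point t j k s) \<in> pre (U - {v}) \<and> K (t, edge_point t j k s) = C (t, cr t j)"
    if "t \<in> T" "j \<in> {1..4}" "k \<in> {1..4}" "j \<noteq> k" for t j k
    using C[OF that(1,2)] filterlim_edge_point[OF that] by (rule eventually_compose_filterlim)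
  have s01: "\<forall>\<^sub>F s in at_right (0::real). 0 < s \<and> s < 1"
    by (rule eventually_conj[OF eventually_at_right_less eventually_at_right_real[of 0 1, THEN eventually_mono]]) auto
  have Cp: "C (t, cr t j) permutes {1..4}" if "t \<in> T" "j \<in> {1..4}" for t j
  proof -
    have "\<exists>k\<in>{1..4::nat}. j \<noteq> k"
      by (cases "j = 1") (auto intro: bexI[of _ 1] bexI[of _ 2])
    then obtain k where k: "k \<in> {1..4}" "j \<noteq> k" by blast
    from eventually_happens[OF Cs[OF that k]]
    obtain s where "(t, edge_point t j k s) \<in> pre (U - {v})" "K (t, edge_point t j k s) = C (t, cr t j)"
      by (auto simp: trivial_limit_at_right_real)
    then show ?thesis using sec_permutes[OF K] by metis
  qed
  have corner_fibre: "\<exists>j\<in>{1..4}. \<mu> = vertex_coord j"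
    if "t \<in> T" "\<mu> \<in> bary" "(t, bpoint (cr t) \<mu>) \<in> pre {v}" for t \<mu>
    using fibre_vertex[OF that(1) _ that(1,2), of 1] proj_corner(1)[OF v(1) that(1), of 1] that(3)
    by (simp add: pre_def)
  have "compat (pre {v}) C"
    unfolding compat_def
  proof (intro conjI ballI impI)
    fix u assume uv: "u \<in> pre {v}"
    from pre_cases[OF this] obtain t \<mu> where u: "u = (t, bpoint (cr t) \<mu>)" "t \<in> T" "\<mu> \<in> bary" by blast
    obtain j where "j \<in> {1..4}" "\<mu> = vertex_coord j"
      using corner_fibre[OF u(2,3) uv[unfolded u(1)]] by blast
    then show "C u permutes {1..4}" using Cp[OF u(2)] u(1) by (simp add: bpoint_vertex_coord)
  next
    fix t i \<mu> assume t: "t \<in> T" "i \<in> {1..4}" "\<mu> \<in> bary" "\<mu> i = 0" and u: "(t, bpoint (cr t) \<mu>) \<in> pre {v}"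
    let ?n = "nb t i" and ?g = "gp t i"
    obtain j where j: "j \<in> {1..4}" "\<mu> = vertex_coord j" using corner_fibre[OF t(1,3) u] by blast
    have ij: "i \<noteq> j" using t(4) j(2) by (auto simp: vertex_coord_def)
    \<comment> \<open>A second corner \<open>k\<close> of the face opposite to \<open>i\<close> is
      wanted: the edge from \<open>j\<close> to \<open>k\<close> then lies in that face.\<close>
    have "card ({1..4} - {i, j}) = card {1..4::nat} - card {i, j}"
      using t(2) j(1) by (intro card_Diff_subset) simp_all
    then have "card ({1..4} - {i, j}) = 2" using ij by simp
    then have "{1..4} - {i, j} \<noteq> {}" by (metis card.empty zero_neq_numeral)
    then obtain k where k: "k \<in> {1..4}" "k \<noteq> i" "k \<noteq> j" by blast
    note gperm = nbr(2)[OF t(1,2)]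
    have gj: "?g j \<in> {1..4}" "?g k \<in> {1..4}" using gp_in[OF t(1,2)] j k by blast+
    have gjk: "?g j \<noteq> ?g k" using k(3)[symmetric] unfolding inj_eq[OF permutes_inj[OF gperm]] .
    have coord: "edge_coord j k s \<circ> inv' ?g = edge_coord (?g j) (?g k) s" for s
      using vertex_coord_permute[OF gperm, of j] vertex_coord_permute[OF gperm, of k]
      unfolding edge_coord_def fun_eq_iff o_apply by simp
    have "\<forall>\<^sub>F s in at_right (0::real). C (?n, cr ?n (?g j)) = C (t, cr t j) \<circ> inv' ?g"
      using s01 Cs[OF t(1) j(1) k(1) k(3)[symmetric]] Cs[OF nbr(1)[OF t(1,2)] gj gjk]
    proof eventually_elim
      case (elim s)
      have b: "edge_coord j k s \<in> bary" "edge_coord j k s i = 0"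
        using elim ij j(1) k edge_coord_bary[of j k s] by (auto simp: edge_coord_def vertex_coord_def)
      have "K (?n, bpoint (cr ?n) (edge_coord j k s \<circ> inv' ?g)) = K (t, bpoint (cr t) (edge_coord j k s)) \<circ> inv' ?g"
        by (rule compatD(2)[OF secD(2)[OF K] t(1,2) b]) (use elim bpoint_edge_coord[OF j(1) k(1)] in simp)
      then show ?case
        using elim unfolding coord bpoint_edge_coord[OF gj] bpoint_edge_coord[OF j(1) k(1)] by simp
    qed
    from eventually_happens[OF this]
    have "C (?n, cr ?n (?g j)) = C (t, cr t j) \<circ> inv' ?g" by (simp add: trivial_limit_at_right_real)
    then show "C (?n, bpoint (cr ?n) (\<mu> \<circ> inv' ?g)) = C (t, bpoint (cr t) \<mu>) \<circ> inv' ?g"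
      unfolding j(2) vertex_coord_permute[OF gperm] bpoint_vertex_coord[OF j(1)] bpoint_vertex_coord[OF gj(1)] .
  qed
  then show ?thesis using local_section[OF haus, of v C] v(2) unfolding topspace_euclidean_subtopology by blast
qed

end

section \<open>Transitivity of the holonomy\<close>

context triangulated_set
begin

text \<open>Gluing sends the label \<open>l\<close> to \<open>gp r i l\<close> and composes the
  colouring with \<open>inv' (gp r i)\<close>, so the colour of the corner at which the point sits
  does not change. This is the colour of the vertex.\<close>

lemma corner_colour_const:
  assumes v: "vertices \<T> = {v}" and S: "sec U S" "v \<in> U" and t: "t \<in> T" "j \<in> {1..4}" and s: "s \<in> T" "k \<in> {1..4}"
  shows "S (s, cr s k) k = S (t, cr t j) j"
proof -
  define Q where "Q u \<longleftrightarrow> (\<forall>i\<in>{1..4}. snd u = cr (fst u) i \<longrightarrow> S u i = S (t, cr t j) j)" for u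
  have pre: "(t, cr t j) \<in> pre {v}" if "t \<in> T" "j \<in> {1..4}" for t j
    using proj_corner[OF v that] that(1) by (simp add: pre_def extreme_point_of_def)
  have cr_inj: "cr t i = cr t j \<longleftrightarrow> i = j" if "t \<in> T" "i \<in> {1..4}" "j \<in> {1..4}" for t i j
    using inj_on_eq_iff[OF corner_inj[OF that(1)] that(2,3)] .
  have "Q (s, cr s k)"
  proof (rule fibre_induct[of "(t, cr t j)" "(s, cr s k)"])
    show "(t, cr t j) \<in> pre UNIV" "(s, cr s k) \<in> pre UNIV" "proj \<T> (t, cr t j) = proj \<T> (s, cr s k)"
      using pre[OF t] pre[OF s] by (auto simp: pre_def)
    show "Q (t, cr t j)" unfolding Q_def fst_conv snd_conv using cr_inj[OF t] by metis
  next
    fix r i \<mu> assume r: "r \<in> T" "i \<in> {1..4}" "\<mu> \<in> bary" "\<mu> i = 0"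
      and pr: "proj \<T> (r, bpoint (cr r) \<mu>) = proj \<T> (t, cr t j)" and Q: "Q (r, bpoint (cr r) \<mu>)"
    obtain l where l: "l \<in> {1..4}" "\<mu> = vertex_coord l" using fibre_vertex[OF t r(1,3) pr] by blast
    note g = nbr(1,2)[OF r(1,2)]
    have gl: "gp r i l \<in> {1..4}" by (rule gp_in[OF r(1,2) l(1)])
    have "(r, bpoint (cr r) \<mu>) \<in> pre U"
      using r pr proj_corner(1)[OF v t] S(2) bpoint_in_cell by (simp add: pre_def)
    from compatD(2)[OF secD(2)[OF S(1)] r this]
    have eq: "S (nb r i, cr (nb r i) (gp r i l)) = S (r, cr r l) \<circ> inv' (gp r i)"
      unfolding l(2) vertex_coord_permute[OF g(2)] bpoint_vertex_coord[OF l(1)] bpoint_vertex_coord[OF gl] .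
    have "S (r, cr r l) l = S (t, cr t j) j"
      using Q l(1) unfolding Q_def l(2) bpoint_vertex_coord[OF l(1)] by simp
    then have "S (nb r i, cr (nb r i) (gp r i l)) (gp r i l) = S (t, cr t j) j"
      unfolding eq using permutes_inverses(2)[OF g(2)] by simp
    then show "Q (nb r i, bpoint (cr (nb r i)) (\<mu> \<circ> inv' (gp r i)))"
      unfolding Q_def l(2) vertex_coord_permute[OF g(2)] bpoint_vertex_coord[OF gl] fst_conv snd_conv
      using cr_inj[OF g(1) gl] by metis
  qed
  then show ?thesis using s(2) by (simp add: Q_def)
qed

text \<open>The value at \<open>pick x\<close> of the fibre colouring that, at
  \<open>(t, y)\<close>, gives every corner of \<open>t\<close> its own label as colour. By
  \<open>frame_eq\<close> every local section computes the same value.\<close>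

definition frame :: "'t \<Rightarrow> real^3 \<Rightarrow> nat \<Rightarrow> nat" where
  "frame t y = (let x = proj \<T> (t, y); S = (SOME S. \<exists>U. sec U S \<and> x \<in> U) in inv' (S (t, y)) \<circ> S (pick x))"

lemma frame_eq:
  assumes U: "sec U S" "proj \<T> (t, y) \<in> U" and t: "t \<in> T" "y \<in> cell \<T> t"
  shows "frame t y = inv' (S (t, y)) \<circ> S (pick (proj \<T> (t, y)))"
proof -
  let ?x = "proj \<T> (t, y)"
  define S0 where "S0 = (SOME S. \<exists>U. sec U S \<and> ?x \<in> U)"
  obtain U0 where U0: "sec U0 S0" "?x \<in> U0"
    using someI[of "\<lambda>S. \<exists>U. sec U S \<and> ?x \<in> U" S] U unfolding S0_def by blast
  have u: "(t, y) \<in> pre {?x}" "(t, y) \<in> pre U" "(t, y) \<in> pre U0" using t U(2) U0(2) by (auto simp: pre_def)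
  have pk: "pick ?x \<in> pre {?x}" using sec_subset_M[OF U(1)] U(2) by (intro pick) auto
  have "S (t, y) \<circ> inv' (S0 (t, y)) = S (pick ?x) \<circ> inv' (S0 (pick ?x))"
    by (rule sec_ratio[OF U0(1) U(1) U0(2) U(2) pk u(1)])
  then have "inv' (S0 (t, y)) \<circ> S0 (pick ?x) = inv' (S (t, y)) \<circ> S (pick ?x)"
    by (intro permutes_ratio[where A = "{1..4}"] sec_pick_permutes[OF U] sec_pick_permutes[OF U0]
        sec_permutes[OF U(1) u(2)] sec_permutes[OF U0(1) u(3)])
  then show ?thesis unfolding frame_def S0_def[symmetric] Let_def by simp
qed

text \<open>Inside the cell \<open>t\<close> the frame is a lift, so the holonomy along segments of
  \<open>t\<close> is explicit. Two segments from the base point to corners \<open>i\<close> and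
  \<open>j\<close> close up to a loop because both corners lie over \<open>v\<close>.\<close>

lemma epi_from_fundamental_group:
  assumes cov: "\<And>x. x \<in> M \<Longrightarrow> \<exists>U S. sec U S \<and> x \<in> U" and v: "vertices \<T> = {v}" "v \<in> M" and a: "a \<in> M"
  shows "\<exists>H h. subgroup H (sym_group 4) \<and> (\<forall>i\<in>{1..4}. \<forall>j\<in>{1..4}. \<exists>h\<in>H. h i = j) \<and>
    h \<in> epi (fundamental_group M a) ((sym_group 4)\<lparr>carrier := H\<rparr>)"
proof -
  have MM: "openin (top_of_set M) M" by simp
  note fs = flat_system_sections[OF MM cov]
  interpret F: flat_system "sym_group 4" M "sections M" by (rule fs)
  have mult: "p \<otimes>\<^bsub>sym_group 4\<^esub> q = p \<circ> q" for p q by (simp add: sym_group_mult)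
  obtain t y where ty: "t \<in> T" "y \<in> cell \<T> t" "proj \<T> (t, y) = a"
    using fibre_nonempty[of a] a by (auto simp: pre_def)
  have fr_perm: "frame t z permutes {1..4}" if z: "z \<in> cell \<T> t" for z
  proof -
    obtain U S where U: "sec U S" "proj \<T> (t, z) \<in> U" using cov[OF proj_in_M[OF ty(1) z]] by blast
    have "(t, z) \<in> pre U" using z ty(1) U(2) by (simp add: pre_def)
    then show ?thesis
      unfolding frame_eq[OF U ty(1) z]
      by (intro permutes_compose permutes_inv sec_pick_permutes[OF U] sec_permutes[OF U(1)])
  qed
  define p where "p j r = proj \<T> (t, linepath y (cr t j) r)" for j r
  have crc: "cr t j \<in> cell \<T> t" if "j \<in> {1..4}" for j
    using proj_corner(2)[OF v(1) ty(1) that] by (simp add: extreme_point_of_def)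
  have convex: "convex (cell \<T> t)" unfolding corner(2)[OF ty(1)] by (rule convex_convex_hull)
  have line: "linepath y (cr t j) r \<in> cell \<T> t" if "j \<in> {1..4}" "r \<in> {0..1}" for j r
    using closed_segment_subset[OF ty(2) crc[OF that(1)] convex] linepath_in_path[OF that(2)] by blast
  have line_cont: "continuous_on {0..1} (linepath y (cr t j))" for j
    using path_linepath unfolding path_def by blast
  have p: "path (p j)" "path_image (p j) \<subseteq> M" "pathstart (p j) = a" "pathfinish (p j) = v" if j: "j \<in> {1..4}" for j
  proof -
    have "continuous_on {0..1} (p j)"
      unfolding p_def
      by (rule continuous_on_compose2[OF proj_continuous[OF ty(1)] line_cont]) (use line[OF j] in blast)
    then show "path (p j)" by (simp add: path_def)
    show "path_image (p j) \<subseteq> M" using proj_in_M[OF ty(1) line[OF j]] by (auto simp: path_image_def p_def)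
    show "pathstart (p j) = a" by (simp add: pathstart_def p_def linepath_def ty(3))
    show "pathfinish (p j) = v"
      using proj_corner(1)[OF v(1) ty(1) j] by (simp add: pathfinish_def p_def linepath_def)
  qed
  have hol_p: "F.hol (p j) = inv' (frame t y) \<circ> frame t (cr t j)" if j: "j \<in> {1..4}" for j
  proof -
    let ?l = "linepath y (cr t j)"
    have "F.flat {0..1} (p j) (\<lambda>r. frame t (?l r))"
    proof (rule F.flatI)
      show "continuous_on {0..1} (p j)" using p(1)[OF j] by (simp add: path_def)
      show "p j \<in> {0..1} \<rightarrow> M" using p(2)[OF j] by (auto simp: path_image_def)
      show "(\<lambda>r. frame t (?l r)) \<in> {0..1} \<rightarrow> carrier (sym_group 4)"
        by (intro Pi_I, unfold sym_group_carrier, rule fr_perm[OF line[OF j]])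
      fix r :: real assume r: "r \<in> {0..1}"
      have "p j r \<in> M" using proj_in_M[OF ty(1) line[OF j r]] by (simp add: p_def)
      then obtain U S where U: "sec U S" "p j r \<in> U" using cov by blast
      \<comment> \<open>The ratio of the frame to the section: \<open>S (pick _)\<close> cancels,
        and what remains is locally constant in the cell.\<close>
      let ?I = "\<lambda>z. inv' (S (t, ?l z))"
      have eq: "frame t (?l z) \<otimes>\<^bsub>sym_group 4\<^esub> inv\<^bsub>sym_group 4\<^esub> S (pick (p j z)) = ?I z"
        if z: "z \<in> {0..1}" "p j z \<in> U" for z
      proof -
        have pm: "S (pick (p j z)) permutes {1..4}" by (rule sec_pick_permutes[OF U(1) z(2)])
        show ?thesis
          unfolding inv_sym_group[OF pm] mult frame_eq[OF U(1) z(2)[unfolded p_def] ty(1) line[OF j z(1)], folded p_def]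
          by (simp only: comp_assoc permutes_inv_o(1)[OF pm] comp_id)
      qed
      have lr: "(t, ?l r) \<in> pre U" using line[OF j r] ty(1) U(2) by (simp add: pre_def p_def)
      have "\<forall>\<^sub>F w in at (?l r) within cell \<T> t. S (t, w) = S (t, ?l r)" by (rule secD(3)[OF U(1) lr])
      then have e1: "\<forall>\<^sub>F z in at r within {0..1}. S (t, ?l z) = S (t, ?l r)"
        by (rule eventually_at_within_continuous[OF line_cont _ r, rotated]) (use line[OF j] in auto)
      have "\<forall>\<^sub>F w in at (?l r) within cell \<T> t. w \<in> {w. (t, w) \<in> pre U}"
        by (rule eventually_at_within_openin[OF continuous_on_proj[OF ty(1) secD(1)[OF U(1)]]]) (use lr in simp)
      then have e2: "\<forall>\<^sub>F z in at r within {0..1}. ?l z \<in> {w. (t, w) \<in> pre U}"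
        by (rule eventually_at_within_continuous[OF line_cont _ r, rotated]) (use line[OF j] lr in auto)
      have e3: "\<forall>\<^sub>F z in at r within {0..1}. z \<in> {0..1}" by (auto simp: eventually_at_topological)
      from e1 e2 e3 have "\<forall>\<^sub>F z in at r within {0..1}.
        frame t (?l z) \<otimes>\<^bsub>sym_group 4\<^esub> inv\<^bsub>sym_group 4\<^esub> S (pick (p j z))
          = frame t (?l r) \<otimes>\<^bsub>sym_group 4\<^esub> inv\<^bsub>sym_group 4\<^esub> S (pick (p j r))"
      proof eventually_elim
        case (elim z)
        have pz: "p j z \<in> U" using elim(2) by (simp add: pre_def p_def)
        show ?case unfolding eq[OF elim(3) pz] eq[OF r U(2)] elim(1) by (rule refl)
      qed
      moreover have "(U, \<lambda>x. S (pick x)) \<in> sections M"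
        unfolding sections_def using U(1) sec_subset_M by blast
      ultimately show "\<exists>(U, s)\<in>sections M. p j r \<in> U \<and> (\<forall>\<^sub>F w in at r within {0..1}.
          frame t (?l w) \<otimes>\<^bsub>sym_group 4\<^esub> inv\<^bsub>sym_group 4\<^esub> s (p j w)
            = frame t (?l r) \<otimes>\<^bsub>sym_group 4\<^esub> inv\<^bsub>sym_group 4\<^esub> s (p j r))"
        using U(2) by (intro bexI[of _ "(U, \<lambda>x. S (pick x))"]) simp_all
    qed
    from F.hol_eq[OF p(1,2)[OF j] this] show ?thesis
      using inv_sym_group[OF fr_perm[OF ty(2)]] by (simp add: linepath_def mult)
  qed
  obtain V S where V: "sec V S" "v \<in> V" using cov[OF v(2)] by blast
  define A where "A = frame t y"
  have A: "A permutes {1..4}" unfolding A_def by (rule fr_perm[OF ty(2)])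
  define B where "B = S (pick v)"
  have B: "B permutes {1..4}" unfolding B_def by (rule sec_pick_permutes[OF V])
  have Sp: "S (t, cr t j) permutes {1..4}" if "j \<in> {1..4}" for j
    using sec_permutes[OF V(1)] proj_corner(1)[OF v(1) ty(1) that] crc[OF that] ty(1) V(2) by (simp add: pre_def)
  have hol_p': "F.hol (p j) = inv' A \<circ> (inv' (S (t, cr t j)) \<circ> B)" if j: "j \<in> {1..4}" for j
    using hol_p[OF j] frame_eq[OF V(1) _ ty(1) crc[OF j]] proj_corner(1)[OF v(1) ty(1) j] V(2)
    by (simp add: A_def B_def)
  define h where "h C = F.hol (SOME q. q \<in> C)" for C
  define H where "H = h ` carrier (fundamental_group M a)"
  have hom: "h \<in> hom (fundamental_group M a) (sym_group 4)"
    unfolding h_def by (rule F.hol_hom(1)[OF a])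
  interpret gh: group_hom "fundamental_group M a" "sym_group 4" h
    by (intro group_hom.intro group_hom_axioms.intro group_fundamental_group[OF a] sym_group_is_group hom)
  have sub: "subgroup H (sym_group 4)" unfolding H_def by (rule gh.img_is_subgroup)
  have "\<exists>g\<in>H. g m = n" if mn: "m \<in> {1..4}" "n \<in> {1..4}" for m n
  proof -
    \<comment> \<open>The holonomy of the loop is a permutation sending the label \<open>j\<close>
      to \<open>i\<close>, conjugated by \<open>A\<close>; hence these labels.\<close>
    define i j where "i = A n" and "j = A m"
    have ij: "i \<in> {1..4}" "j \<in> {1..4}" using mn permutes_in_image[OF A] by (auto simp only: i_def j_def)
    let ?q = "p i +++ reversepath (p j)"
    have q: "?q \<in> loops_at M a"
      using p[OF ij(1)] p[OF ij(2)] by (auto simp: loops_at_def subset_path_image_join)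
    have "F.hol ?q = F.hol (p i) \<circ> inv' (F.hol (p j))"
    proof -
      have "F.hol (p j) permutes {1..4}" using F.hol_closed[OF p(1,2)[OF ij(2)]] by (simp only: sym_group_carrier)
      then show ?thesis
        using F.hol_join[of "p i" "reversepath (p j)"] F.hol_reversepath[OF p(1,2)[OF ij(2)]] p[OF ij(1)] p[OF ij(2)]
        by (simp add: mult inv_sym_group)
    qed
    also have "inv' (F.hol (p j)) = inv' B \<circ> S (t, cr t j) \<circ> A"
      unfolding hol_p'[OF ij(2)]
      using permutes_bij[OF A] permutes_bij[OF B] permutes_bij[OF Sp[OF ij(2)]]
      by (simp add: o_inv_distrib bij_comp bij_imp_bij_inv inv_inv_eq comp_assoc)
    finally have "F.hol ?q = inv' A \<circ> inv' (S (t, cr t i)) \<circ> (B \<circ> inv' B) \<circ> S (t, cr t j) \<circ> A"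
      unfolding hol_p'[OF ij(1)] by (simp only: comp_assoc)
    then have "F.hol ?q m = inv' A (inv' (S (t, cr t i)) (S (t, cr t j) j))"
      unfolding permutes_inv_o(1)[OF B] by (simp add: j_def)
    \<comment> \<open>The common colour of the vertex, read at two corners of
      \<open>t\<close>.\<close>
    also have "S (t, cr t j) j = S (t, cr t i) i"
      by (rule corner_colour_const[OF v(1) V ty(1) ij(1) ty(1) ij(2)])
    also have "inv' A (inv' (S (t, cr t i)) (S (t, cr t i) i)) = n"
      using permutes_inverses(2)[OF Sp[OF ij(1)]] permutes_inverses(2)[OF A] by (simp add: i_def)
    finally have "F.hol ?q m = n" .
    moreover have "F.hol ?q = h (path_class M ?q)" unfolding h_def by (rule F.hol_hom(2)[OF a q, symmetric])
    moreover have "path_class M ?q \<in> carrier (fundamental_group M a)"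
      using q by (simp add: fundamental_group_def)
    ultimately show ?thesis unfolding H_def by (intro bexI[of _ "h (path_class M ?q)"]) auto
  qed
  moreover have "h \<in> epi (fundamental_group M a) ((sym_group 4)\<lparr>carrier := H\<rparr>)"
    using hom by (auto simp: epi_def hom_def H_def)
  ultimately show ?thesis using sub by blast
qed

end

theorem theorem30:
  fixes M :: "'a::topological_space set"
    and \<T> :: "('t, 'a) triangulation_data"
    and a :: 'a
  assumes "closed_connected_orientable_3manifold (top_of_set M)"
    and "singular_triangulation (top_of_set M) \<T>"
    and "even_triangulation \<T>"
    and "card (vertices \<T>) = 1"
    and "a \<in> M"
  shows "(\<exists>h. h \<in> epi (fundamental_group M a) (integer_mod_group 2 \<times>\<times> integer_mod_group 2)) \<or>
         (\<exists>h. h \<in> epi (fundamental_group M a) (integer_mod_group 4)) \<or>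
         (\<exists>h. h \<in> epi (fundamental_group M a) (alt_group 4)) \<or>
         (\<exists>h. h \<in> epi (fundamental_group M a) (sym_group 4))"
proof -
  have mf: "manifold3 (top_of_set M)" using assms(1) by (simp add: closed_connected_orientable_3manifold_def)
  interpret triangulated_set M \<T>
    by unfold_locales (use assms(2) mf in \<open>simp_all add: manifold3_def\<close>)
  obtain v where v: "vertices \<T> = {v}" using assms(4) by (auto simp: card_1_singleton_iff)
  then have "v \<in> vertices \<T>" by simp
  then obtain t w where "t \<in> T" "w extreme_point_of cell \<T> t" "v = proj \<T> (t, w)"
    unfolding vertices_def by blast
  then have vM: "v \<in> M" using proj_in_M by (auto simp: extreme_point_of_def)
  have cov: "\<exists>U S. sec U S \<and> x \<in> U" if "x \<in> M" for x
    using sec_nonvertex[OF haus assms(3), of x] sec_vertex[OF assms(3) mf v vM] v that by (cases "x = v") auto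
  obtain H h where H: "subgroup H (sym_group 4)" "\<forall>i\<in>{1..4}. \<forall>j\<in>{1..4}. \<exists>h\<in>H. h i = j"
    and h: "h \<in> epi (fundamental_group M a) ((sym_group 4)\<lparr>carrier := H\<rparr>)"
    using epi_from_fundamental_group[OF cov v vM assms(5)] by blast
  from transitive_subgroup_epi[OF H] show ?thesis
    by (elim disjE exE) (blast dest: epi_compose[OF h])+
qed

end
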